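(* Let $\Phi$ be a discrete-time $\psi$-irreducible, aperiodic Markov chain satisfying the Doeblin condition $R(x,A)\ge\epsilon\nu(A)$ for all $x\in\mathsf X$, $A\in\mathcal B$, for some $\epsilon>0$ and some probability measure $\nu$ (so that $\Phi$ is geometrically ergodic with a bounded Lyapunov function), and let $F:\mathsf X\to[-1,1]$ be measurable with $\pi(F)=0$ and asymptotic variance $\sigma^2>0$. Let $\bar a=\big(\frac{e-1}{2-\epsilon}\big)\epsilon$. (i) The partial sums $S_n$ satisfy a large deviations principle in a neighborhood of the origin: for any $c\in(0,\Lambda'(\bar a))$ and any $c'\in(\Lambda'(-\bar a),0)$, $$\lim_{n\to\infty}\frac1n\log\mathsf P_\pi\{S_n\ge nc\}=-\Lambda^*(c),\qquad\lim_{n\to\infty}\frac1n\log\mathsf P_\pi\{S_n\le nc'\}=-\Lambda^*(c'),$$ where $\Lambda^*(c):=\sup_{-\bar a<a<\bar a}[ac-\Lambda(a)]$. (ii) Part (i) cannot in general be extended to a full large deviations principle on the whole real line: there exist a discrete-time $\psi$-irreducible, aperiodic Markov chain $\Phi$ satisfying the Doeblin condition $R(x,A)\ge\epsilon\nu(A)$ for all $x\in\mathsf X$, $A\in\mathcal B$, for some $\epsilon>0$ and some probability measure $\nu$, and a measurable functional $F:\mathsf X\to[-1,1]$ with $\pi(F)=0$ and asymptotic variance $\sigma^2>0$, for which the laws of $S_n/n$ under $\mathsf P_\pi$ do not satisfy a large deviations principle on $\mathbb R$.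
   Context: $\mathsf X$ is a general state space with a countably generated $\sigma$-field $\mathcal B$. $\Phi=\{\Phi(n):n\ge0\}$ is a time-homogeneous Markov chain on $\mathsf X$ with transition kernel $P$; $\mathsf P_x,\mathsf E_x$ denote law and expectation given $\Phi(0)=x$, and $\mathsf P_\pi$ the law of the chain with $\Phi(0)\sim\pi$, where $\pi$ is the unique invariant probability measure. Resolvents: $R_\theta=\sum_{n\ge0}(1-e^{-\theta})e^{-\theta n}P^n$, $R:=R_1$. $\Phi$ is $\psi$-irreducible if there is a $\sigma$-finite measure $\psi$ on $\mathcal B$ and $\theta>0$ such that $R_\theta s(x)>0$ for all $x$ whenever $s:\mathsf X\to[0,\infty)$ is measurable with $\psi(s)>0$; it is aperiodic if for every such $s$ and every $x$, $P^ns(x)>0$ for all sufficiently large $n$. Geometric ergodicity with a Lyapunov function $V:\mathsf X\to[1,\infty)$ means: $\psi$-irreducible, aperiodic, and there are a probability measure $\nu$, constants $b<\infty,\delta>0$ and a function $s:\mathsf X\to(0,1]$ with $PV-V\le-\delta V+bs$ and $R(x,A)\ge s(x)\nu(A)$; the Doeblin condition is equivalent to this with bounded $V$. $S_n=\sum_{i=0}^{n-1}F(\Phi(i))$; $\sigma^2:=\lim_n\mathrm{Var}_x(S_n/\sqrt n)$. For real $a\in[-\bar a,\bar a]$, $\Lambda(a)=\lim_n\frac1n\log\mathsf E_x[e^{aS_n}]$; the limit exists, is independent of $x$, equals the logarithm of the spectral radius of the operator $\hat P_ag(x)=e^{aF(x)}Pg(x)$ on bounded measurable functions, and $\Lambda$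 is analytic in a neighborhood of $[-\bar a,\bar a]$. A large deviations principle on $\mathbb R$ for $\{S_n/n\}$ means: there is a lower semicontinuous rate function $I:\mathbb R\to[0,\infty]$ with $-\inf_{B^\circ}I\le\liminf_n\frac1n\log\mathsf P_\pi\{S_n/n\in B\}\le\limsup_n\frac1n\log\mathsf P_\pi\{S_n/n\in B\}\le-\inf_{\bar B}I$ for all measurable $B\subset\mathbb R$ ($B^\circ$ the interior, $\bar B$ the closure). *)

theory Defs
  imports "HOL-Probability.Probability"
begin

definition countably_generated :: "'a measure \<Rightarrow> bool" where
  "countably_generated M \<longleftrightarrow>
     (\<exists>G. countable G \<and> G \<subseteq> Pow (space M) \<and> sets M = sigma_sets (space M) G)"

text \<open>Throughout, \<open>M\<close> only serves as the measurable space \<open>(X, \<B>)\<close>; its measure is irrelevant.\<close>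

locale markov_kernel =
  fixes M :: "'a measure" and K :: "'a \<Rightarrow> 'a measure"
  assumes countably_generated: "countably_generated M"
    and kernel [measurable]: "K \<in> M \<rightarrow>\<^sub>M prob_algebra M"

subsection \<open>Iterates, resolvents, irreducibility, invariance\<close>

primrec iterate_kernel :: "'a measure \<Rightarrow> ('a \<Rightarrow> 'a measure) \<Rightarrow> nat \<Rightarrow> 'a \<Rightarrow> 'a measure" where
  "iterate_kernel M K 0 x = return M x"
| "iterate_kernel M K (Suc n) x = iterate_kernel M K n x \<bind> K"

text \<open>\<open>resolvent M K \<theta> s x\<close> is \<open>R\<^sub>\<theta> s(x)\<close>, so that \<open>R\<^sub>\<theta>(x, A)\<close> is the value at the indicator of \<open>A\<close>.\<close>

definition resolvent ::
  "'a measure \<Rightarrow> ('a \<Rightarrow> 'a measure) \<Rightarrow> real \<Rightarrow> ('a \<Rightarrow> ennreal) \<Rightarrow> 'a \<Rightarrow> ennreal" where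
  "resolvent M K \<theta> s x =
     (\<Sum>n. ennreal ((1 - exp (-\<theta>)) * exp (-\<theta> * real n)) * (\<integral>\<^sup>+y. s y \<partial>iterate_kernel M K n x))"

text \<open>The irreducibility measure \<open>\<psi>\<close> is required to be nonzero; for \<open>\<psi> = 0\<close> the notion is void.\<close>

definition psi_irreducible :: "'a measure \<Rightarrow> ('a \<Rightarrow> 'a measure) \<Rightarrow> 'a measure \<Rightarrow> bool" where
  "psi_irreducible M K \<psi> \<longleftrightarrow>
     sets \<psi> = sets M \<and> sigma_finite_measure \<psi> \<and> emeasure \<psi> (space M) \<noteq> 0 \<and>
     (\<exists>\<theta>>0. \<forall>s\<in>borel_measurable M. (\<forall>x\<in>space M. (0::real) \<le> s x) \<longrightarrow>
        (\<integral>\<^sup>+y. ennreal (s y) \<partial>\<psi>) > 0 \<longrightarrow>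
        (\<forall>x\<in>space M. resolvent M K \<theta> (\<lambda>y. ennreal (s y)) x > 0))"

definition psi_aperiodic :: "'a measure \<Rightarrow> ('a \<Rightarrow> 'a measure) \<Rightarrow> 'a measure \<Rightarrow> bool" where
  "psi_aperiodic M K \<psi> \<longleftrightarrow>
     (\<forall>s\<in>borel_measurable M. (\<forall>x\<in>space M. (0::real) \<le> s x) \<longrightarrow>
        (\<integral>\<^sup>+y. ennreal (s y) \<partial>\<psi>) > 0 \<longrightarrow>
        (\<forall>x\<in>space M. \<forall>\<^sub>F n in sequentially. (\<integral>\<^sup>+y. ennreal (s y) \<partial>iterate_kernel M K n x) > 0))"

definition invariant_prob :: "'a measure \<Rightarrow> ('a \<Rightarrow> 'a measure) \<Rightarrow> 'a measure \<Rightarrow> bool" where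
  "invariant_prob M K \<pi> \<longleftrightarrow> \<pi> \<in> space (prob_algebra M) \<and> \<pi> \<bind> K = \<pi>"

subsection \<open>The law of the chain on path space\<close>

definition chain_step :: "('a \<Rightarrow> 'a measure) \<Rightarrow> 'a measure \<Rightarrow> nat \<Rightarrow> (nat \<Rightarrow> 'a) \<Rightarrow> 'a measure" where
  "chain_step K \<mu> i \<omega> = (case i of 0 \<Rightarrow> \<mu> | Suc j \<Rightarrow> K (\<omega> j))"

text \<open>The Ionescu-Tulcea measure on \<open>X\<^sup>\<nat>\<close> under which the coordinate process is the chain with kernel
  \<open>K\<close> and initial law \<open>\<mu>\<close>.\<close>

definition chain_law :: "'a measure \<Rightarrow> ('a \<Rightarrow> 'a measure) \<Rightarrow> 'a measure \<Rightarrow> (nat \<Rightarrow> 'a) measure" where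
  "chain_law M K \<mu> =
     projective_family.lim UNIV (Ionescu_Tulcea.CI (chain_step K \<mu>) (\<lambda>_. M)) (\<lambda>_. M)"

lemma (in markov_kernel) Ionescu_Tulcea_chain_step:
  assumes \<mu>: "\<mu> \<in> space (prob_algebra M)"
  shows "Ionescu_Tulcea (chain_step K \<mu>) (\<lambda>_. M)"
proof (rule Ionescu_Tulcea.intro)
  have meas: "chain_step K \<mu> i \<in> PiM {0..<i} (\<lambda>_. M) \<rightarrow>\<^sub>M prob_algebra M" for i
  proof (cases i)
    case 0
    then show ?thesis using \<mu> by (simp add: chain_step_def[abs_def])
  next
    case (Suc j)
    have "(\<lambda>\<omega>. \<omega> j) \<in> PiM {0..<i} (\<lambda>_. M) \<rightarrow>\<^sub>M M"
      by (rule measurable_component_singleton) (simp add: Suc)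
    then have "(\<lambda>\<omega>. K (\<omega> j)) \<in> PiM {0..<i} (\<lambda>_. M) \<rightarrow>\<^sub>M prob_algebra M"
      by (rule measurable_compose[OF _ kernel])
    then show ?thesis by (simp add: Suc chain_step_def[abs_def])
  qed
  then show "chain_step K \<mu> i \<in> PiM {0..<i} (\<lambda>_. M) \<rightarrow>\<^sub>M subprob_algebra M" for i
    by (rule measurable_prob_algebraD)
  show "prob_space (chain_step K \<mu> i x)" if "x \<in> space (PiM {0..<i} (\<lambda>_. M))" for i x
    using measurable_space[OF meas that] by (simp add: space_prob_algebra)
qed

lemma (in markov_kernel)
  assumes \<mu>: "\<mu> \<in> space (prob_algebra M)"
  shows sets_chain_law: "sets (chain_law M K \<mu>) = sets (PiM UNIV (\<lambda>_. M))"
    and distr_chain_law: "finite J \<Longrightarrow>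
      distr (chain_law M K \<mu>) (PiM J (\<lambda>_. M)) (\<lambda>\<omega>. restrict \<omega> J) =
      Ionescu_Tulcea.CI (chain_step K \<mu>) (\<lambda>_. M) J"
proof -
  interpret Ionescu_Tulcea "chain_step K \<mu>" "\<lambda>_. M"
    by (rule Ionescu_Tulcea_chain_step[OF \<mu>])
  show "sets (chain_law M K \<mu>) = sets (PiM UNIV (\<lambda>_. M))"
    unfolding chain_law_def by (rule PF.sets_lim)
  show "distr (chain_law M K \<mu>) (PiM J (\<lambda>_. M)) (\<lambda>\<omega>. restrict \<omega> J) = CI J" if "finite J"
    unfolding chain_law_def by (rule distr_lim[OF that])
qed

subsection \<open>Partial sums\<close>

definition partial_sum :: "('a \<Rightarrow> real) \<Rightarrow> nat \<Rightarrow> (nat \<Rightarrow> 'a) \<Rightarrow> real" where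
  "partial_sum F n \<omega> = (\<Sum>i<n. F (\<omega> i))"

definition has_asymptotic_variance ::
  "'a measure \<Rightarrow> ('a \<Rightarrow> 'a measure) \<Rightarrow> ('a \<Rightarrow> real) \<Rightarrow> real \<Rightarrow> bool" where
  "has_asymptotic_variance M K F v \<longleftrightarrow>
     (\<forall>x\<in>space M.
        (\<lambda>n. prob_space.variance (chain_law M K (return M x)) (\<lambda>\<omega>. partial_sum F n \<omega> / sqrt (real n)))
          \<longlonglongrightarrow> v)"

text \<open>\<open>\<Lambda>(a)\<close>, computed from the initial state \<open>x\<close>.\<close>

definition log_mgf_rate ::
  "'a measure \<Rightarrow> ('a \<Rightarrow> 'a measure) \<Rightarrow> ('a \<Rightarrow> real) \<Rightarrow> 'a \<Rightarrow> real \<Rightarrow> real" where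
  "log_mgf_rate M K F x a =
     lim (\<lambda>n. ln (\<integral>\<omega>. exp (a * partial_sum F n \<omega>) \<partial>chain_law M K (return M x)) / real n)"

definition restricted_conjugate :: "real \<Rightarrow> (real \<Rightarrow> real) \<Rightarrow> real \<Rightarrow> ereal" where
  "restricted_conjugate r \<Lambda> c = (SUP a\<in>{-r<..<r}. ereal (a * c - \<Lambda> a))"

subsection \<open>Large deviations\<close>

text \<open>Logarithm of a probability, with \<open>log 0 = -\<infinity>\<close> (whereas \<open>ln 0 = 0\<close>).\<close>

definition elog :: "real \<Rightarrow> ereal" where
  "elog p = (if p = 0 then -\<infinity> else ereal (ln p))"

definition lower_semicontinuous :: "('a::topological_space \<Rightarrow> ereal) \<Rightarrow> bool" where
  "lower_semicontinuous I \<longleftrightarrow> (\<forall>c. closed {x. I x \<le> c})"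

definition satisfies_LDP :: "(nat \<Rightarrow> real measure) \<Rightarrow> bool" where
  "satisfies_LDP \<mu> \<longleftrightarrow>
     (\<exists>I :: real \<Rightarrow> ereal. (\<forall>x. 0 \<le> I x) \<and> lower_semicontinuous I \<and>
       (\<forall>B\<in>sets borel.
          - (INF x\<in>interior B. I x) \<le> liminf (\<lambda>n. elog (measure (\<mu> n) B) / ereal (real n)) \<and>
          liminf (\<lambda>n. elog (measure (\<mu> n) B) / ereal (real n))
            \<le> limsup (\<lambda>n. elog (measure (\<mu> n) B) / ereal (real n)) \<and>
          limsup (\<lambda>n. elog (measure (\<mu> n) B) / ereal (real n)) \<le> - (INF x\<in>closure B. I x)))"

subsection \<open>The standing hypotheses\<close>

locale doeblin_chain = markov_kernel M K
  for M :: "'a measure" and K :: "'a \<Rightarrow> 'a measure" +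
  fixes \<epsilon> :: real and \<nu> :: "'a measure"
  assumes irreducible_aperiodic: "\<exists>\<psi>. psi_irreducible M K \<psi> \<and> psi_aperiodic M K \<psi>"
    and eps_pos: "0 < \<epsilon>"
    and nu_prob: "\<nu> \<in> space (prob_algebra M)"
    and doeblin: "\<And>x A. x \<in> space M \<Longrightarrow> A \<in> sets M \<Longrightarrow>
      ennreal \<epsilon> * emeasure \<nu> A \<le> resolvent M K 1 (indicator A) x"

locale doeblin_functional = doeblin_chain M K \<epsilon> \<nu>
  for M :: "'a measure" and K :: "'a \<Rightarrow> 'a measure" and \<epsilon> :: real and \<nu> :: "'a measure" +
  fixes \<pi> :: "'a measure" and F :: "'a \<Rightarrow> real"
  assumes invariant: "invariant_prob M K \<pi>"
    and F_measurable: "F \<in> borel_measurable M"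
    and F_bounded: "\<And>x. x \<in> space M \<Longrightarrow> F x \<in> {-1..1}"
    and F_mean: "(\<integral>x. F x \<partial>\<pi>) = 0"
    and F_variance: "\<exists>v>0. has_asymptotic_variance M K F v"

end

theory Submission
  imports Defs
begin

text \<open>
  Write \<open>w = l e\<^sup>-\<^sup>a\<^sup>F\<close>, so that \<open>P f = w f\<close> says that \<open>f\<close> is an eigenfunction of
  \<open>e\<^sup>a\<^sup>F P\<close> with eigenvalue \<open>l\<close>. Part (i) follows from exponential tilting once the growth rate
  \<open>\<Lambda>(a)\<close> is known to exist and to be differentiable up to and slightly beyond \<open>abar\<close>. Both come
  from the resolvent: since \<open>R (e - P) = e - 1\<close>, the equation \<open>P f = w f\<close> is equivalent to
  \<open>f = R (k f)\<close> with \<open>k = (e - w) / (e - 1)\<close>. Split \<open>R = Q + \<epsilon> \<nu>\<close>. The Doeblin condition makes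
  \<open>Q\<close> positive with norm \<open>1 - \<epsilon>\<close>, and \<open>abar\<close> is such that \<open>(1 - \<epsilon>) sup \<bar>k\<bar> < 1\<close> for
  \<open>\<bar>a\<bar> \<le> abar\<close> and all \<open>l\<close> between \<open>1\<close> and \<open>e\<^sup>\<bar>\<^sup>a\<^sup>\<bar>\<close> (\<open>abar_gap\<close>, a numerical fact about \<open>e\<close>). Hence \<open>k Q\<close> is a
  contraction, and what remains of \<open>R\<close> has rank one.

  The growth rate \<open>r(a)\<close> is introduced as the infimum of the \<open>l\<close> that admit a bounded supersolution
  \<open>P g + 1 \<le> w g\<close>; Jensen's inequality under the invariant law gives \<open>r(a) \<ge> 1\<close>. For \<open>l > r(a)\<close>
  the minimal solution of \<open>P g + 1 = w g\<close> is a multiple of the solution of \<open>h = 1 + Q (k h)\<close>.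
  As \<open>l\<close> decreases to \<open>r(a)\<close> the solutions \<open>h\<close> converge uniformly, whereas the multiples blow up;
  the limit is an eigenfunction which, by the minorisation, is bounded away from \<open>0\<close>
  (\<open>principal_eigenfunction\<close>). So \<open>E e\<^sup>a\<^sup>S\<close> with \<open>S = S_n\<close> is \<open>r(a)\<^sup>n\<close> up to constant factors
  (\<open>mgf_bounds\<close>), for every initial law. Pairing with the functional \<open>\<epsilon> \<nu> (1 - k Q)\<^sup>-\<^sup>1\<close>, which
  annihilates the range of \<open>w - P\<close>, turns the dependence of \<open>r\<close> on \<open>a\<close> into an explicit relation
  between difference quotients (\<open>radius_differentiable\<close>). In the tilting argument
  (\<open>half_line_large_deviations\<close>) the maximiser of \<open>a c - \<Lambda>(a)\<close> over \<open>[0, abar]\<close> is interior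
  because \<open>c > 0\<close>, \<open>\<Lambda>\<close> is minimal at \<open>0\<close>, and its slope at \<open>abar\<close> exceeds \<open>c\<close>.

  For part (ii), let the chain climb by \<open>1\<close> or fall to \<open>0\<close> with probability \<open>1/2\<close> each, and let
  \<open>F\<close> be the centred indicator of the union of the blocks \<open>[b, 2 b)\<close> with \<open>b = (j + 3)!\<close>. At time
  \<open>n = b\<close> the path may lie entirely inside a block with probability \<open>4\<^sup>-\<^sup>n\<close>. At time \<open>n = 32 b\<close>
  the next block is so far away that reaching it has superexponentially small probability, and
  otherwise the fraction of time spent in blocks is at most \<open>13/16\<close>. Thus the exponential rate
  of the same deviation is finite along one sequence of times and infinite along another, which no
  rate function allows (\<open>ladder_no_LDP\<close>).
\<close>


section \<open>Expectations of path functionals\<close>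

context markov_kernel
begin

lemma prob_space_K: "x \<in> space M \<Longrightarrow> prob_space (K x)"
  using measurable_space[OF kernel] by (simp add: space_prob_algebra)

lemma sets_K: "x \<in> space M \<Longrightarrow> sets (K x) = sets M"
  using measurable_space[OF kernel] by (simp add: space_prob_algebra)

lemma space_K: "x \<in> space M \<Longrightarrow> space (K x) = space M"
  by (rule sets_eq_imp_space_eq[OF sets_K])

lemma prob_space_chain_law:
  assumes \<mu>: "\<mu> \<in> space (prob_algebra M)"
  shows "prob_space (chain_law M K \<mu>)"
proof -
  interpret Ionescu_Tulcea "chain_step K \<mu>" "\<lambda>_. M"
    by (rule Ionescu_Tulcea_chain_step[OF \<mu>])
  have "prob_space (distr (chain_law M K \<mu>) (PiM {} (\<lambda>_. M)) (\<lambda>\<omega>. restrict \<omega> {}))"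
    unfolding distr_chain_law[OF \<mu> finite.emptyI] by (rule PF.prob_space_P) auto
  then show ?thesis
    by (rule prob_space_distrD[rotated])
      (auto simp: measurable_cong_sets[OF sets_chain_law[OF \<mu>] refl] intro!: measurable_restrict_subset)
qed

lemma measurable_chain_law:
  assumes \<mu>: "\<mu> \<in> space (prob_algebra M)"
  shows "measurable (chain_law M K \<mu>) N = measurable (PiM UNIV (\<lambda>_. M)) N"
  by (rule measurable_cong_sets[OF sets_chain_law[OF \<mu>] refl])

lemma space_chain_law:
  assumes \<mu>: "\<mu> \<in> space (prob_algebra M)"
  shows "space (chain_law M K \<mu>) = UNIV \<rightarrow> space M"
  using sets_eq_imp_space_eq[OF sets_chain_law[OF \<mu>]] by (simp add: space_PiM PiE_def)

lemma integral_chain_law_prefix: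
  fixes H :: "(nat \<Rightarrow> 'a) \<Rightarrow> real"
  assumes \<mu>: "\<mu> \<in> space (prob_algebra M)"
    and H: "H \<in> borel_measurable (PiM {0..<n} (\<lambda>_. M))"
  shows "(\<integral>\<omega>. H (restrict \<omega> {0..<n}) \<partial>chain_law M K \<mu>) =
    (\<integral>\<omega>. H \<omega> \<partial>Ionescu_Tulcea.C (chain_step K \<mu>) (\<lambda>_. M) 0 n (\<lambda>_. undefined))"
proof -
  interpret Ionescu_Tulcea "chain_step K \<mu>" "\<lambda>_. M"
    by (rule Ionescu_Tulcea_chain_step[OF \<mu>])
  have up: "up_to {0..<n} = n"
  proof (rule antisym)
    show "up_to {0..<n} \<le> n" by (subst up_to_iff) auto
    have "\<forall>i\<in>{0..<n}. i < up_to {0..<n}" using up_to_less[of "{0..<n}"] by auto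
    then show "n \<le> up_to {0..<n}" by (cases n) (auto dest: bspec[of _ _ "n - 1"])
  qed
  have u: "(\<lambda>_. undefined) \<in> space (PiM {0..<0::nat} (\<lambda>_. M))" by (auto simp: space_PiM)
  have ext: "restrict \<omega> {0..<n} = \<omega>" if "\<omega> \<in> space (C 0 n (\<lambda>_. undefined))" for \<omega>
    using that by (auto simp: space_C[OF u] space_PiM PiE_def extensional_restrict)
  have "(\<integral>\<omega>. H (restrict \<omega> {0..<n}) \<partial>chain_law M K \<mu>) =
      (\<integral>\<omega>. H \<omega> \<partial>distr (chain_law M K \<mu>) (PiM {0..<n} (\<lambda>_. M)) (\<lambda>\<omega>. restrict \<omega> {0..<n}))"
    using H by (subst integral_distr) (auto simp: measurable_chain_law[OF \<mu>] intro!: measurable_restrict_subset)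
  also have "\<dots> = (\<integral>\<omega>. H \<omega> \<partial>distr (C 0 n (\<lambda>_. undefined)) (PiM {0..<n} (\<lambda>_. M)) (\<lambda>\<omega>. restrict \<omega> {0..<n}))"
    by (simp add: distr_chain_law[OF \<mu>] CI_def up)
  also have "\<dots> = (\<integral>\<omega>. H (restrict \<omega> {0..<n}) \<partial>C 0 n (\<lambda>_. undefined))"
    using H by (subst integral_distr)
      (auto simp: measurable_cong_sets[OF sets_C[OF u] refl] intro!: measurable_restrict_subset)
  also have "\<dots> = (\<integral>\<omega>. H \<omega> \<partial>C 0 n (\<lambda>_. undefined))"
    by (intro Bochner_Integration.integral_cong refl) (simp add: ext)
  finally show ?thesis .
qed

lemma integral_chain_law_0:
  fixes f :: "'a \<Rightarrow> real"
  assumes \<mu>: "\<mu> \<in> space (prob_algebra M)" and f: "f \<in> borel_measurable M"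
  shows "(\<integral>\<omega>. f (\<omega> 0) \<partial>chain_law M K \<mu>) = (\<integral>x. f x \<partial>\<mu>)"
proof -
  interpret Ionescu_Tulcea "chain_step K \<mu>" "\<lambda>_. M"
    by (rule Ionescu_Tulcea_chain_step[OF \<mu>])
  have u: "(\<lambda>_. undefined) \<in> space (PiM {0..<0::nat} (\<lambda>_. M))" by (auto simp: space_PiM)
  have s: "sets \<mu> = sets M" using \<mu> by (simp add: space_prob_algebra)
  have m: "(\<lambda>\<omega>. f (\<omega> 0)) \<in> borel_measurable (PiM {0..<1::nat} (\<lambda>_. M))"
    by (rule measurable_compose[OF measurable_component_singleton[where M="\<lambda>_. M"] f]) auto
  have "(\<integral>\<omega>. f (restrict \<omega> {0..<1} 0) \<partial>chain_law M K \<mu>) = (\<integral>\<omega>. f (\<omega> 0) \<partial>C 0 1 (\<lambda>_. undefined))"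
    using integral_chain_law_prefix[OF \<mu> m] by simp
  also have "C 0 1 (\<lambda>_. undefined) = eP 0 (\<lambda>_. undefined)"
    using bind_return[OF measurable_eP[of 0] u] by simp
  also have "(\<integral>\<omega>. f (\<omega> 0) \<partial>eP 0 (\<lambda>_. undefined)) = (\<integral>x. f x \<partial>\<mu>)"
    unfolding eP_def
  proof (subst integral_distr)
    have "(\<lambda>_. undefined)(0 := x) \<in> space (PiM {0..<Suc 0} (\<lambda>_. M))" if "x \<in> space M" for x
      using that by (auto simp: space_PiM PiE_def extensional_def)
    have "(\<lambda>x. (\<lambda>_. undefined)(0 := x)) \<in> M \<rightarrow>\<^sub>M PiM {0..<Suc 0} (\<lambda>_. M)"
      by (rule measurable_fun_upd[where J="{}"]) (auto simp: space_PiM)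
    then show "(\<lambda>x. (\<lambda>_. undefined)(0 := x)) \<in> chain_step K \<mu> 0 (\<lambda>_. undefined) \<rightarrow>\<^sub>M PiM {0..<Suc 0} (\<lambda>_. M)"
      by (simp add: chain_step_def measurable_cong_sets[OF s refl])
  qed (use m in \<open>simp_all add: chain_step_def\<close>)
  finally show ?thesis by simp
qed

text \<open>The Markov property at time \<open>n\<close>, for functionals of the first \<open>n + 2\<close> coordinates: the last
  coordinate may be integrated out with the kernel.\<close>

lemma integral_chain_law_Suc:
  fixes H :: "(nat \<Rightarrow> 'a) \<Rightarrow> real"
  assumes \<mu>: "\<mu> \<in> space (prob_algebra M)"
    and H: "H \<in> borel_measurable (PiM {0..<Suc (Suc n)} (\<lambda>_. M))"
    and bd: "\<And>\<omega>. \<omega> \<in> space (PiM {0..<Suc (Suc n)} (\<lambda>_. M)) \<Longrightarrow> \<bar>H \<omega>\<bar> \<le> B"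
  shows "(\<integral>\<omega>. H (restrict \<omega> {0..<Suc (Suc n)}) \<partial>chain_law M K \<mu>) =
    (\<integral>\<omega>. (\<integral>y. H ((restrict \<omega> {0..<Suc n})(Suc n := y)) \<partial>K (\<omega> n)) \<partial>chain_law M K \<mu>)"
proof -
  interpret Ionescu_Tulcea "chain_step K \<mu>" "\<lambda>_. M"
    by (rule Ionescu_Tulcea_chain_step[OF \<mu>])
  have u: "(\<lambda>_. undefined) \<in> space (PiM {0..<0::nat} (\<lambda>_. M))" by (auto simp: space_PiM)
  let ?C = "C 0 (Suc n) (\<lambda>_. undefined)"
  interpret C: prob_space ?C by (rule prob_space_C[OF u])
  have step: "(\<integral>\<omega>'. H \<omega>' \<partial>eP (Suc n) \<omega>) = (\<integral>y. H (fun_upd \<omega> (Suc n) y) \<partial>K (\<omega> n))"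
    if \<omega>: "\<omega> \<in> space (PiM {0..<Suc n} (\<lambda>_. M))" for \<omega>
  proof -
    have n: "\<omega> n \<in> space M" using \<omega> by (auto simp: space_PiM PiE_def)
    have "(\<lambda>x. fun_upd \<omega> (Suc n) x) \<in> K (\<omega> n) \<rightarrow>\<^sub>M PiM {0..<Suc (Suc n)} (\<lambda>_. M)"
      unfolding measurable_cong_sets[OF sets_K[OF n] refl]
      by (rule measurable_fun_upd[where J="{0..<Suc n}"]) (use \<omega> in auto)
    then show ?thesis
      unfolding eP_def using H by (subst integral_distr) (simp_all add: chain_step_def)
  qed
  have mI: "(\<lambda>\<omega>. \<integral>\<omega>'. H \<omega>' \<partial>eP (Suc n) \<omega>) \<in> borel_measurable (PiM {0..<Suc n} (\<lambda>_. M))"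
    by (rule measurable_compose[OF measurable_eP integral_measurable_subprob_algebra[OF H]])
  have m: "(\<lambda>\<omega>. \<integral>y. H (fun_upd \<omega> (Suc n) y) \<partial>K (\<omega> n)) \<in> borel_measurable (PiM {0..<Suc n} (\<lambda>_. M))"
    by (rule measurable_cong[THEN iffD1, OF _ mI]) (simp add: step)
  have "(\<integral>\<omega>. H (restrict \<omega> {0..<Suc (Suc n)}) \<partial>chain_law M K \<mu>) = (\<integral>\<omega>. H \<omega> \<partial>C 0 (Suc (Suc n)) (\<lambda>_. undefined))"
    by (rule integral_chain_law_prefix[OF \<mu> H])
  also have "\<dots> = (\<integral>\<omega>. H \<omega> \<partial>(?C \<bind> eP (Suc n)))"
    by simp
  also have "\<dots> = (\<integral>\<omega>. (\<integral>\<omega>'. H \<omega>' \<partial>eP (Suc n) \<omega>) \<partial>?C)"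
  proof (rule integral_bind[OF H bd, where B'=1])
    show "eP (Suc n) \<in> ?C \<rightarrow>\<^sub>M subprob_algebra (PiM {0..<Suc (Suc n)} (\<lambda>_. M))"
      unfolding measurable_cong_sets[OF sets_C[OF u, of "Suc n"] refl] using measurable_eP[of "Suc n"] by simp
    show "finite_measure ?C" by unfold_locales
    show "AE x in ?C. emeasure (eP (Suc n) x) (space (eP (Suc n) x)) \<le> ennreal 1"
      by (rule AE_I2) (use space_C[OF u, of "Suc n"] prob_space_eP prob_space.emeasure_space_1 in fastforce)
  qed
  also have "\<dots> = (\<integral>\<omega>. (\<integral>y. H (fun_upd \<omega> (Suc n) y) \<partial>K (\<omega> n)) \<partial>?C)"
    by (intro Bochner_Integration.integral_cong refl step) (use space_C[OF u, of "Suc n"] in simp)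
  also have "\<dots> = (\<integral>\<omega>. (\<integral>y. H ((restrict \<omega> {0..<Suc n})(Suc n := y)) \<partial>K (restrict \<omega> {0..<Suc n} n)) \<partial>chain_law M K \<mu>)"
    by (rule integral_chain_law_prefix[OF \<mu> m, symmetric])
  finally show ?thesis by simp
qed

lemma integral_chain_law_mult:
  fixes G :: "(nat \<Rightarrow> 'a) \<Rightarrow> real" and f :: "'a \<Rightarrow> real"
  assumes \<mu>: "\<mu> \<in> space (prob_algebra M)"
    and G: "G \<in> borel_measurable (PiM {0..<Suc n} (\<lambda>_. M))"
    and past: "\<And>\<omega>. G (restrict \<omega> {0..<Suc n}) = G \<omega>"
    and bdG: "\<And>\<omega>. \<omega> \<in> space (PiM {0..<Suc n} (\<lambda>_. M)) \<Longrightarrow> \<bar>G \<omega>\<bar> \<le> B"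
    and f: "f \<in> borel_measurable M" and bdf: "\<And>x. x \<in> space M \<Longrightarrow> \<bar>f x\<bar> \<le> B'"
  shows "(\<integral>\<omega>. G \<omega> * f (\<omega> (Suc n)) \<partial>chain_law M K \<mu>) =
    (\<integral>\<omega>. G \<omega> * (\<integral>y. f y \<partial>K (\<omega> n)) \<partial>chain_law M K \<mu>)"
proof -
  let ?H = "\<lambda>\<omega>. G (restrict \<omega> {0..<Suc n}) * f (\<omega> (Suc n))"
  have r: "(\<lambda>\<omega>. restrict \<omega> {0..<Suc n}) \<in> PiM {0..<Suc (Suc n)} (\<lambda>_. M) \<rightarrow>\<^sub>M PiM {0..<Suc n} (\<lambda>_. M)"
    by (rule measurable_restrict_subset) auto
  have c: "(\<lambda>\<omega>. \<omega> (Suc n)) \<in> PiM {0..<Suc (Suc n)} (\<lambda>_. M) \<rightarrow>\<^sub>M M"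
    by (rule measurable_component_singleton) auto
  have H: "?H \<in> borel_measurable (PiM {0..<Suc (Suc n)} (\<lambda>_. M))"
    by (intro borel_measurable_times measurable_compose[OF r G] measurable_compose[OF c f])
  have B0: "\<bar>?H \<omega>\<bar> \<le> \<bar>B\<bar> * \<bar>B'\<bar>" if "\<omega> \<in> space (PiM {0..<Suc (Suc n)} (\<lambda>_. M))" for \<omega>
    using bdG[OF measurable_space[OF r that]] bdf[OF measurable_space[OF c that]]
    unfolding abs_mult by (intro mult_mono) auto
  have "restrict (restrict \<omega> {0..<Suc (Suc n)}) {0..<Suc n} = restrict \<omega> {0..<Suc n}" for \<omega> :: "nat \<Rightarrow> 'a"
    by (simp add: inf.absorb2)
  moreover have "G ((restrict \<omega> {0..<Suc n})(Suc n := y)) = G \<omega>" for \<omega> y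
  proof -
    have "restrict ((restrict \<omega> {0..<Suc n})(Suc n := y)) {0..<Suc n} = restrict \<omega> {0..<Suc n}"
      by (auto simp: fun_eq_iff)
    then show ?thesis by (metis past)
  qed
  ultimately show ?thesis
    using integral_chain_law_Suc[OF \<mu> H B0] by (simp add: past)
qed

lemma measurable_partial_sum:
  assumes "F \<in> borel_measurable M" "n \<le> m"
  shows "partial_sum F n \<in> borel_measurable (PiM {0..<m} (\<lambda>_. M))"
    and "partial_sum F n \<in> borel_measurable (PiM UNIV (\<lambda>_. M))"
  unfolding partial_sum_def
  using assms(2)
  by (auto intro!: borel_measurable_sum measurable_compose[OF measurable_component_singleton[where M="\<lambda>_. M"] assms(1)])

lemma partial_sum_restrict: "n \<le> m \<Longrightarrow> partial_sum F n (restrict \<omega> {0..<m}) = partial_sum F n \<omega>"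
  unfolding partial_sum_def by (intro sum.cong) auto

lemma abs_partial_sum_le:
  assumes "\<And>x. x \<in> space M \<Longrightarrow> \<bar>F x\<bar> \<le> 1" "\<And>i. i < n \<Longrightarrow> \<omega> i \<in> space M"
  shows "\<bar>partial_sum F n \<omega>\<bar> \<le> real n"
proof -
  have "\<bar>partial_sum F n \<omega>\<bar> \<le> (\<Sum>i<n. \<bar>F (\<omega> i)\<bar>)" unfolding partial_sum_def by (rule sum_abs)
  also have "\<dots> \<le> (\<Sum>i<n. 1)" using assms by (intro sum_mono) auto
  finally show ?thesis by simp
qed

end


section \<open>The resolvent kernel\<close>

lemma (in prob_space) abs_integral_le:
  fixes g :: "'a \<Rightarrow> real"
  assumes "g \<in> borel_measurable M" "\<And>y. y \<in> space M \<Longrightarrow> \<bar>g y\<bar> \<le> C"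
  shows "integrable M g" "\<bar>\<integral>y. g y \<partial>M\<bar> \<le> C"
proof -
  show i: "integrable M g"
    by (rule integrable_const_bound[where B=C]) (use assms in auto)
  have "\<bar>\<integral>y. g y \<partial>M\<bar> \<le> (\<integral>y. \<bar>g y\<bar> \<partial>M)" by (rule integral_abs_bound)
  also have "\<dots> \<le> (\<integral>y. C \<partial>M)"
    using assms i by (intro integral_mono) auto
  finally show "\<bar>\<integral>y. g y \<partial>M\<bar> \<le> C" by (simp add: prob_space)
qed

context markov_kernel
begin

lemma iterate_kernel_measurable [measurable]: "iterate_kernel M K n \<in> M \<rightarrow>\<^sub>M prob_algebra M"
proof (induction n)
  case 0
  have "iterate_kernel M K 0 = return M" by (simp add: fun_eq_iff)
  then show ?case by (simp add: measurable_return_prob_space)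
next
  case (Suc n)
  have "iterate_kernel M K (Suc n) = (\<lambda>x. iterate_kernel M K n x \<bind> K)" by (simp add: fun_eq_iff)
  moreover have "(\<lambda>x. iterate_kernel M K n x \<bind> K) \<in> M \<rightarrow>\<^sub>M prob_algebra M"
    using Suc by measurable
  ultimately show ?case by simp
qed

lemma iterate_kernel_props:
  assumes "x \<in> space M"
  shows "prob_space (iterate_kernel M K n x)" "sets (iterate_kernel M K n x) = sets M"
    "space (iterate_kernel M K n x) = space M"
    "iterate_kernel M K n x \<in> space (subprob_algebra M)"
proof -
  show p: "prob_space (iterate_kernel M K n x)" and s: "sets (iterate_kernel M K n x) = sets M"
    using measurable_space[OF iterate_kernel_measurable assms, of n] by (auto simp: space_prob_algebra)
  show "space (iterate_kernel M K n x) = space M" by (rule sets_eq_imp_space_eq[OF s])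
  show "iterate_kernel M K n x \<in> space (subprob_algebra M)"
    using measurable_space[OF measurable_prob_algebraD[OF iterate_kernel_measurable] assms, of n] .
qed

lemma measurable_K_subprob [measurable]: "K \<in> M \<rightarrow>\<^sub>M subprob_algebra M"
  by (rule measurable_prob_algebraD[OF kernel])

lemma measurable_integral_K [measurable]:
  assumes "(g :: 'a \<Rightarrow> real) \<in> borel_measurable M"
  shows "(\<lambda>x. \<integral>y. g y \<partial>K x) \<in> borel_measurable M"
  using assms by measurable

lemma integral_K_bound:
  assumes "(g :: 'a \<Rightarrow> real) \<in> borel_measurable M" "\<And>y. y \<in> space M \<Longrightarrow> \<bar>g y\<bar> \<le> C" "x \<in> space M"
  shows "integrable (K x) g" "\<bar>\<integral>y. g y \<partial>K x\<bar> \<le> C"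
  using prob_space.abs_integral_le[OF prob_space_K[OF assms(3)], of g C] assms
  by (auto simp: space_K measurable_cong_sets[OF sets_K refl])

lemma integral_iterate_Suc:
  assumes "(g :: 'a \<Rightarrow> real) \<in> borel_measurable M" "\<And>y. y \<in> space M \<Longrightarrow> \<bar>g y\<bar> \<le> C" "x \<in> space M"
  shows "(\<integral>y. g y \<partial>iterate_kernel M K (Suc n) x) = (\<integral>z. (\<integral>y. g y \<partial>K z) \<partial>iterate_kernel M K n x)"
  unfolding iterate_kernel.simps
proof (rule integral_bind[OF assms(1,2), where B'=1])
  show "K \<in> iterate_kernel M K n x \<rightarrow>\<^sub>M subprob_algebra M"
    by (simp add: measurable_cong_sets[OF iterate_kernel_props(2)[OF assms(3)] refl])
  show "finite_measure (iterate_kernel M K n x)"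
    using iterate_kernel_props(1)[OF assms(3)] prob_space.finite_measure by auto
  show "AE x in iterate_kernel M K n x. emeasure (K x) (space (K x)) \<le> ennreal 1"
    by (rule AE_I2) (simp add: iterate_kernel_props(3)[OF assms(3)] prob_space.emeasure_space_1[OF prob_space_K])
qed

lemma integral_iterate_bound:
  assumes "(g :: 'a \<Rightarrow> real) \<in> borel_measurable M" "\<And>y. y \<in> space M \<Longrightarrow> \<bar>g y\<bar> \<le> C" "x \<in> space M"
  shows "integrable (iterate_kernel M K n x) g" "\<bar>\<integral>y. g y \<partial>iterate_kernel M K n x\<bar> \<le> C"
  using prob_space.abs_integral_le[OF iterate_kernel_props(1)[OF assms(3)], of g n C] assms
  by (auto simp: iterate_kernel_props measurable_cong_sets[OF iterate_kernel_props(2)[OF assms(3)] refl])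

text \<open>The probability kernel \<open>R = R\<^sub>1\<close>: the chain observed at an independent geometric time.\<close>

definition Res :: "'a \<Rightarrow> 'a measure" where
  "Res x = measure_pmf (geometric_pmf (1 - exp (-1))) \<bind> (\<lambda>n. iterate_kernel M K n x)"

lemma geometric_weight:
  "pmf (geometric_pmf (1 - exp (-1))) n = (1 - exp (-1)) * exp (- real n)"
  by (simp add: exp_of_nat_mult[symmetric] power_one_over exp_minus field_simps)

lemma iterate_subprob:
  assumes "x \<in> space M"
  shows "(\<lambda>n. iterate_kernel M K n x) \<in> measure_pmf q \<rightarrow>\<^sub>M subprob_algebra M"
  using iterate_kernel_props(4)[OF assms] by auto

lemma sets_Res [simp]: "x \<in> space M \<Longrightarrow> sets (Res x) = sets M"
  unfolding Res_def by (rule sets_bind) (use iterate_kernel_props in auto)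

lemma space_Res [simp]: "x \<in> space M \<Longrightarrow> space (Res x) = space M"
  by (rule sets_eq_imp_space_eq[OF sets_Res])

lemma prob_space_Res: "x \<in> space M \<Longrightarrow> prob_space (Res x)"
  unfolding Res_def
  by (rule prob_space.prob_space_bind[where S=M])
     (use iterate_kernel_props iterate_subprob in \<open>auto intro: prob_space_measure_pmf\<close>)

lemma nn_integral_Res:
  assumes "x \<in> space M" "f \<in> borel_measurable M"
  shows "(\<integral>\<^sup>+y. f y \<partial>Res x) = resolvent M K 1 f x"
  unfolding Res_def resolvent_def
  apply (subst nn_integral_bind[OF assms(2) iterate_subprob[OF assms(1)]])
  apply (subst nn_integral_measure_pmf)
  apply (subst nn_integral_count_space_nat)
  apply (simp add: geometric_weight del: pmf_geometric)
  done

lemma integral_Res_sums: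
  assumes g: "(g :: 'a \<Rightarrow> real) \<in> borel_measurable M" and C: "\<And>y. y \<in> space M \<Longrightarrow> \<bar>g y\<bar> \<le> C" and x: "x \<in> space M"
  shows "(\<lambda>n. (1 - exp (-1)) * exp (- real n) * (\<integral>y. g y \<partial>iterate_kernel M K n x)) sums (\<integral>y. g y \<partial>Res x)"
proof -
  let ?q = "geometric_pmf (1 - exp (-1))"
  have "(\<integral>y. g y \<partial>Res x) = (\<integral>n. (\<integral>y. g y \<partial>iterate_kernel M K n x) \<partial>measure_pmf ?q)"
    unfolding Res_def
  proof (rule integral_bind[OF g C iterate_subprob[OF x], where B'=1])
    show "finite_measure ?q" by (rule prob_space.finite_measure) (rule prob_space_measure_pmf)
    show "AE n in ?q. emeasure (iterate_kernel M K n x) (space (iterate_kernel M K n x)) \<le> ennreal 1"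
      by (rule AE_I2) (simp add: prob_space.emeasure_space_1[OF iterate_kernel_props(1)[OF x]])
  qed
  moreover have "integrable ?q (\<lambda>n. \<integral>y. g y \<partial>iterate_kernel M K n x)"
    by (rule measure_pmf.integrable_const_bound[where B=C])
       (use integral_iterate_bound(2)[OF g C x] in auto)
  then have i: "integrable (count_space UNIV) (\<lambda>n. pmf ?q n *\<^sub>R (\<integral>y. g y \<partial>iterate_kernel M K n x))"
    unfolding measure_pmf_eq_density by (subst (asm) integrable_density) auto
  then have "(\<lambda>n. pmf ?q n *\<^sub>R (\<integral>y. g y \<partial>iterate_kernel M K n x)) sums
      (\<integral>n. pmf ?q n *\<^sub>R (\<integral>y. g y \<partial>iterate_kernel M K n x) \<partial>count_space UNIV)"
    by (rule sums_integral_count_space_nat)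
  moreover have "(\<integral>n. (\<integral>y. g y \<partial>iterate_kernel M K n x) \<partial>measure_pmf ?q) =
     (\<integral>n. pmf ?q n *\<^sub>R (\<integral>y. g y \<partial>iterate_kernel M K n x) \<partial>count_space UNIV)"
    unfolding measure_pmf_eq_density by (subst integral_density) auto
  ultimately show ?thesis
    by (simp add: geometric_weight del: pmf_geometric)
qed

lemma measurable_integral_Res:
  assumes g: "(g :: 'a \<Rightarrow> real) \<in> borel_measurable M" and C: "\<And>y. y \<in> space M \<Longrightarrow> \<bar>g y\<bar> \<le> C"
  shows "(\<lambda>x. \<integral>y. g y \<partial>Res x) \<in> borel_measurable M"
proof (rule measurable_cong[THEN iffD1])
  show "(\<Sum>n. (1 - exp (-1)) * exp (- real n) * (\<integral>y. g y \<partial>iterate_kernel M K n x)) = (\<integral>y. g y \<partial>Res x)"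
    if "x \<in> space M" for x
    by (rule sums_unique[OF integral_Res_sums[OF g C that], symmetric])
  show "(\<lambda>x. \<Sum>n. (1 - exp (-1)) * exp (- real n) * (\<integral>y. g y \<partial>iterate_kernel M K n x)) \<in> borel_measurable M"
    by (intro borel_measurable_suminf borel_measurable_times borel_measurable_const
        measurable_compose[OF measurable_prob_algebraD[OF iterate_kernel_measurable] integral_measurable_subprob_algebra[OF g]])
qed

lemma integral_Res_bound:
  assumes "(g :: 'a \<Rightarrow> real) \<in> borel_measurable M" "\<And>y. y \<in> space M \<Longrightarrow> \<bar>g y\<bar> \<le> C" "x \<in> space M"
  shows "integrable (Res x) g" "\<bar>\<integral>y. g y \<partial>Res x\<bar> \<le> C"
  using prob_space.abs_integral_le[OF prob_space_Res[OF assms(3)], of g C] assms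
  by (auto simp: measurable_cong_sets[OF sets_Res refl])

text \<open>The resolvent equation \<open>R (e - P) = e - 1\<close>, a shift of the geometric series.\<close>

lemma resolvent_equation:
  assumes g: "(g :: 'a \<Rightarrow> real) \<in> borel_measurable M" and C: "\<And>y. y \<in> space M \<Longrightarrow> \<bar>g y\<bar> \<le> C" and x: "x \<in> space M"
  shows "(\<integral>y. (exp 1 * g y - (\<integral>z. g z \<partial>K y)) \<partial>Res x) = (exp 1 - 1) * g x"
proof -
  let ?a = "\<lambda>n. (1 - exp (-1)) * exp (- real n) * (\<integral>y. g y \<partial>iterate_kernel M K n x)"
  have Pg: "(\<lambda>y. \<integral>z. g z \<partial>K y) \<in> borel_measurable M" "\<And>y. y \<in> space M \<Longrightarrow> \<bar>\<integral>z. g z \<partial>K y\<bar> \<le> C"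
    using g integral_K_bound(2)[OF g C] by auto
  have s1: "?a sums (\<integral>y. g y \<partial>Res x)" by (rule integral_Res_sums[OF g C x])
  have "(\<lambda>n. (1 - exp (-1)) * exp (- real n) * (\<integral>y. g y \<partial>iterate_kernel M K (Suc n) x)) sums
      (\<integral>y. (\<integral>z. g z \<partial>K y) \<partial>Res x)"
    using integral_Res_sums[OF Pg x] by (simp only: integral_iterate_Suc[OF g C x, symmetric])
  then have "(\<lambda>n. exp (-1) * ((1 - exp (-1)) * exp (- real n) * (\<integral>y. g y \<partial>iterate_kernel M K (Suc n) x))) sums
      (exp (-1) * (\<integral>y. (\<integral>z. g z \<partial>K y) \<partial>Res x))"
    by (rule sums_mult)
  moreover have "exp (-1) * ((1 - exp (-1)) * exp (- real n) * I) = (1 - exp (-1)) * exp (- real (Suc n)) * I" for n and I :: real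
    by (simp add: exp_add exp_diff exp_minus field_simps)
  ultimately have "(\<lambda>n. ?a (Suc n)) sums (exp (-1) * (\<integral>y. (\<integral>z. g z \<partial>K y) \<partial>Res x))"
    by simp
  then have "?a sums (exp (-1) * (\<integral>y. (\<integral>z. g z \<partial>K y) \<partial>Res x) + ?a 0)"
    by (subst (asm) sums_Suc_iff) simp
  with s1 have eq: "(\<integral>y. g y \<partial>Res x) = exp (-1) * (\<integral>y. (\<integral>z. g z \<partial>K y) \<partial>Res x) + ?a 0"
    by (rule sums_unique2)
  have a0: "?a 0 = (1 - exp (-1)) * g x"
    using g x by (simp add: integral_return)
  have "(\<integral>y. (exp 1 * g y - (\<integral>z. g z \<partial>K y)) \<partial>Res x) = exp 1 * (\<integral>y. g y \<partial>Res x) - (\<integral>y. (\<integral>z. g z \<partial>K y) \<partial>Res x)"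
    using integral_Res_bound(1)[OF g C x] integral_Res_bound(1)[OF Pg x] by simp
  also have "\<dots> = (exp 1 - 1) * g x"
    unfolding eq a0 by (simp add: exp_minus field_simps)
  finally show ?thesis .
qed

end

section \<open>The resolvent minus its minorising part\<close>

context doeblin_chain
begin

lemma prob_space_nu: "prob_space \<nu>" and sets_nu [simp]: "sets \<nu> = sets M" 
  using nu_prob by (auto simp: space_prob_algebra)

lemma space_nu [simp]: "space \<nu> = space M"
  by (rule sets_eq_imp_space_eq[OF sets_nu])

lemma space_nonempty: "space M \<noteq> {}"
  using prob_space.not_empty[OF prob_space_nu] by simp

lemma integral_nu_bound:
  assumes "(g :: 'a \<Rightarrow> real) \<in> borel_measurable M" "\<And>y. y \<in> space M \<Longrightarrow> \<bar>g y\<bar> \<le> C"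
  shows "integrable \<nu> g" "\<bar>\<integral>y. g y \<partial>\<nu>\<bar> \<le> C"
  using prob_space.abs_integral_le[OF prob_space_nu, of g C] assms
  by (auto simp: measurable_cong_sets[OF sets_nu refl])

lemma minorised_integral:
  assumes g: "(g :: 'a \<Rightarrow> real) \<in> borel_measurable M" and C: "\<And>y. y \<in> space M \<Longrightarrow> \<bar>g y\<bar> \<le> C"
    and nonneg: "\<And>y. y \<in> space M \<Longrightarrow> 0 \<le> g y" and x: "x \<in> space M"
  shows "\<epsilon> * (\<integral>y. g y \<partial>\<nu>) \<le> (\<integral>y. g y \<partial>Res x)"
proof -
  have "scale_measure (ennreal \<epsilon>) \<nu> \<le> Res x"
  proof (subst le_measure)
    show "sets (scale_measure (ennreal \<epsilon>) \<nu>) = sets (Res x)" using x by simp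
    show "\<forall>A\<in>sets (scale_measure (ennreal \<epsilon>) \<nu>). emeasure (scale_measure (ennreal \<epsilon>) \<nu>) A \<le> emeasure (Res x) A"
    proof
      fix A assume "A \<in> sets (scale_measure (ennreal \<epsilon>) \<nu>)"
      then have A: "A \<in> sets M" by simp
      have "emeasure (Res x) A = (\<integral>\<^sup>+y. indicator A y \<partial>Res x)" using A x by simp
      also have "\<dots> = resolvent M K 1 (indicator A) x" using A x by (intro nn_integral_Res) auto
      finally show "emeasure (scale_measure (ennreal \<epsilon>) \<nu>) A \<le> emeasure (Res x) A"
        using doeblin[OF x A] by simp
    qed
  qed
  then have "(\<integral>\<^sup>+y. ennreal (g y) \<partial>scale_measure (ennreal \<epsilon>) \<nu>) \<le> (\<integral>\<^sup>+y. ennreal (g y) \<partial>Res x)"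
    using x by (intro nn_integral_mono_measure) auto
  then have "ennreal \<epsilon> * (\<integral>\<^sup>+y. ennreal (g y) \<partial>\<nu>) \<le> (\<integral>\<^sup>+y. ennreal (g y) \<partial>Res x)"
    using g by (subst (asm) nn_integral_scale_measure) (simp_all add: measurable_cong_sets[OF sets_nu refl])
  moreover have "(\<integral>\<^sup>+y. ennreal (g y) \<partial>\<nu>) = ennreal (\<integral>y. g y \<partial>\<nu>)"
    using nonneg by (intro nn_integral_eq_integral integral_nu_bound(1)[OF g C] AE_I2) auto
  moreover have "(\<integral>\<^sup>+y. ennreal (g y) \<partial>Res x) = ennreal (\<integral>y. g y \<partial>Res x)"
    using nonneg x by (intro nn_integral_eq_integral integral_Res_bound(1)[OF g C x] AE_I2) auto
  moreover have "0 \<le> (\<integral>y. g y \<partial>\<nu>)" "0 \<le> (\<integral>y. g y \<partial>Res x)"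
    using nonneg x by (auto intro!: Bochner_Integration.integral_nonneg)
  ultimately show ?thesis
    using eps_pos by (simp add: ennreal_mult[symmetric])
qed

lemma eps_le_1: "\<epsilon> \<le> 1"
proof -
  obtain x where x: "x \<in> space M" using space_nonempty by auto
  have "\<epsilon> * (\<integral>y. 1 \<partial>\<nu>) \<le> (\<integral>y. 1 \<partial>Res x)"
    by (rule minorised_integral[where C=1]) (use x in auto)
  then show ?thesis
    using prob_space.prob_space[OF prob_space_nu] prob_space.prob_space[OF prob_space_Res[OF x]] by simp
qed

text \<open>\<open>Q\<close> is a positive operator of norm \<open>1 - \<epsilon>\<close>; all contraction estimates below come from this
  factor.\<close>

definition Q :: "('a \<Rightarrow> real) \<Rightarrow> 'a \<Rightarrow> real" where
  "Q g x = (\<integral>y. g y \<partial>Res x) - \<epsilon> * (\<integral>y. g y \<partial>\<nu>)"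

lemma Q_measurable:
  assumes "g \<in> borel_measurable M" "\<And>y. y \<in> space M \<Longrightarrow> \<bar>g y\<bar> \<le> C"
  shows "Q g \<in> borel_measurable M"
  unfolding Q_def[abs_def] using measurable_integral_Res[OF assms] by simp

lemma Q_bound:
  assumes g: "g \<in> borel_measurable M" and C: "\<And>y. y \<in> space M \<Longrightarrow> \<bar>g y\<bar> \<le> C" and x: "x \<in> space M"
  shows "\<bar>Q g x\<bar> \<le> (1 - \<epsilon>) * C"
proof -
  interpret N: prob_space \<nu> by (rule prob_space_nu)
  interpret R: prob_space "Res x" by (rule prob_space_Res[OF x])
  have *: "Q g x \<le> (1 - \<epsilon>) * C"
    if g: "g \<in> borel_measurable M" and C: "\<And>y. y \<in> space M \<Longrightarrow> \<bar>g y\<bar> \<le> C" for g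
  proof -
    have "\<epsilon> * (\<integral>y. C - g y \<partial>\<nu>) \<le> (\<integral>y. C - g y \<partial>Res x)"
    proof (rule minorised_integral[where C="2*C"])
      fix y assume "y \<in> space M" from C[OF this] show "\<bar>C - g y\<bar> \<le> 2 * C" "0 \<le> C - g y" by auto
    qed (use g x in auto)
    then have "\<epsilon> * (C - (\<integral>y. g y \<partial>\<nu>)) \<le> C - (\<integral>y. g y \<partial>Res x)"
      using integral_nu_bound(1)[OF g C] integral_Res_bound(1)[OF g C x]
      using N.prob_space R.prob_space x by simp
    then show ?thesis unfolding Q_def by (simp add: algebra_simps)
  qed
  have "Q (\<lambda>y. - g y) x = - Q g x" unfolding Q_def by simp
  moreover have "Q (\<lambda>y. - g y) x \<le> (1 - \<epsilon>) * C" using g C by (intro *) auto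
  ultimately show ?thesis using *[OF g C] by auto
qed

lemma Q_cong: "(\<And>y. y \<in> space M \<Longrightarrow> g y = g' y) \<Longrightarrow> x \<in> space M \<Longrightarrow> Q g x = Q g' x"
  unfolding Q_def by (auto intro!: arg_cong2[where f="(-)"] arg_cong2[where f="(*)"] Bochner_Integration.integral_cong)

lemma Q_add:
  assumes "g \<in> borel_measurable M" "\<And>y. y \<in> space M \<Longrightarrow> \<bar>g y\<bar> \<le> C"
    and "h \<in> borel_measurable M" "\<And>y. y \<in> space M \<Longrightarrow> \<bar>h y\<bar> \<le> D" and x: "x \<in> space M"
  shows "Q (\<lambda>y. a * g y + b * h y) x = a * Q g x + b * Q h x"
  using integral_nu_bound(1)[OF assms(1,2)] integral_nu_bound(1)[OF assms(3,4)]
    integral_Res_bound(1)[OF assms(1,2) x] integral_Res_bound(1)[OF assms(3,4) x]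
  unfolding Q_def by (simp add: algebra_simps)

lemma Q_one: "x \<in> space M \<Longrightarrow> Q (\<lambda>_. 1) x = 1 - \<epsilon>"
  using prob_space.prob_space[OF prob_space_nu] prob_space.prob_space[OF prob_space_Res]
  unfolding Q_def by simp

end


section \<open>The left eigenfunctional\<close>

context markov_kernel
begin

definition bounded_by :: "real \<Rightarrow> ('a \<Rightarrow> real) \<Rightarrow> bool" where
  "bounded_by C g \<longleftrightarrow> g \<in> borel_measurable M \<and> (\<forall>x\<in>space M. \<bar>g x\<bar> \<le> C)"

lemma bounded_byI: "g \<in> borel_measurable M \<Longrightarrow> (\<And>x. x \<in> space M \<Longrightarrow> \<bar>g x\<bar> \<le> C) \<Longrightarrow> bounded_by C g"
  unfolding bounded_by_def by auto

lemma bounded_byD: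
  assumes "bounded_by C g"
  shows "g \<in> borel_measurable M" "\<And>x. x \<in> space M \<Longrightarrow> \<bar>g x\<bar> \<le> C"
  using assms unfolding bounded_by_def by auto

lemma bounded_by_mono: "bounded_by C g \<Longrightarrow> C \<le> D \<Longrightarrow> bounded_by D g"
  unfolding bounded_by_def by fastforce

lemma bounded_by_const: "bounded_by \<bar>c\<bar> (\<lambda>_. c)"
  unfolding bounded_by_def by auto

lemma bounded_by_lin:
  assumes "bounded_by C g" "bounded_by D h"
  shows "bounded_by (\<bar>a\<bar> * C + \<bar>b\<bar> * D) (\<lambda>x. a * g x + b * h x)"
proof (rule bounded_byI)
  fix x assume x: "x \<in> space M"
  have "\<bar>a * g x + b * h x\<bar> \<le> \<bar>a * g x\<bar> + \<bar>b * h x\<bar>" by (rule abs_triangle_ineq)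
  also have "\<dots> \<le> \<bar>a\<bar> * C + \<bar>b\<bar> * D"
    unfolding abs_mult using bounded_byD(2)[OF assms(1) x] bounded_byD(2)[OF assms(2) x]
    by (intro add_mono mult_left_mono) auto
  finally show "\<bar>a * g x + b * h x\<bar> \<le> \<bar>a\<bar> * C + \<bar>b\<bar> * D" .
qed (use assms[THEN bounded_byD(1)] in measurable)

lemma bounded_by_diff: "bounded_by C g \<Longrightarrow> bounded_by D h \<Longrightarrow> bounded_by (C + D) (\<lambda>x. g x - h x)"
  using bounded_by_lin[of C g D h 1 "-1"] by simp

lemma bounded_by_add: "bounded_by C g \<Longrightarrow> bounded_by D h \<Longrightarrow> bounded_by (C + D) (\<lambda>x. g x + h x)"
  using bounded_by_lin[of C g D h 1 1] by simp

lemma bounded_by_cmult: "bounded_by C g \<Longrightarrow> bounded_by (\<bar>a\<bar> * C) (\<lambda>x. a * g x)"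
  using bounded_by_lin[of C g C g a 0] by simp

lemma bounded_by_mult:
  assumes "bounded_by C g" "bounded_by D h"
  shows "bounded_by (C * D) (\<lambda>x. g x * h x)"
proof (rule bounded_byI)
  fix x assume x: "x \<in> space M"
  show "\<bar>g x * h x\<bar> \<le> C * D"
    unfolding abs_mult using bounded_byD(2)[OF assms(1) x] bounded_byD(2)[OF assms(2) x]
    by (intro mult_mono) auto
qed (use assms[THEN bounded_byD(1)] in measurable)

lemma bounded_by_K: "bounded_by C g \<Longrightarrow> bounded_by C (\<lambda>x. \<integral>y. g y \<partial>K x)"
  using integral_K_bound(2)[of g C] unfolding bounded_by_def by auto

lemma integrable_K: "bounded_by C g \<Longrightarrow> x \<in> space M \<Longrightarrow> integrable (K x) g"
  by (rule integral_K_bound(1)) (auto simp: bounded_by_def)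

lemma bounded_by_uniform_limit:
  fixes g :: "nat \<Rightarrow> 'a \<Rightarrow> real"
  assumes "uniform_limit (space M) g f sequentially" "\<And>n. bounded_by C (g n)"
  shows "bounded_by C f"
proof (rule bounded_byI)
  have lim: "(\<lambda>n. g n x) \<longlonglongrightarrow> f x" if "x \<in> space M" for x
    by (rule tendsto_uniform_limitI[OF assms(1) that])
  show "f \<in> borel_measurable M"
    using lim bounded_byD(1)[OF assms(2)] by (rule borel_measurable_LIMSEQ_real)
  show "\<bar>f x\<bar> \<le> C" if "x \<in> space M" for x
    by (rule tendsto_upperbound[OF tendsto_rabs[OF lim[OF that]]])
       (use bounded_byD(2)[OF assms(2) that] in auto)
qed

lemma tendsto_integral_K:
  assumes lim: "\<And>x. x \<in> space M \<Longrightarrow> (\<lambda>n. h n x) \<longlonglongrightarrow> f x" and h: "\<And>n. bounded_by B (h n)"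
    and f: "bounded_by B f" and x: "x \<in> space M"
  shows "(\<lambda>n. \<integral>y. h n y \<partial>K x) \<longlonglongrightarrow> (\<integral>y. f y \<partial>K x)"
proof -
  interpret Kx: prob_space "K x" by (rule prob_space_K[OF x])
  have mK: "g \<in> borel_measurable M \<Longrightarrow> g \<in> borel_measurable (K x)" for g :: "'a \<Rightarrow> real"
    by (simp add: measurable_cong_sets[OF sets_K[OF x] refl])
  show ?thesis
  proof (rule integral_dominated_convergence[where w="\<lambda>_. B"])
    show "AE y in K x. (\<lambda>n. h n y) \<longlonglongrightarrow> f y" by (rule AE_I2) (simp add: space_K[OF x] lim)
    show "AE y in K x. norm (h n y) \<le> B" for n
      by (rule AE_I2) (simp add: space_K[OF x] bounded_byD(2)[OF h])
    show "f \<in> borel_measurable (K x)" by (rule mK[OF bounded_byD(1)[OF f]])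
    show "h n \<in> borel_measurable (K x)" for n by (rule mK[OF bounded_byD(1)[OF h]])
  qed simp
qed

lemma bounded_by_image: "bounded_by C g \<Longrightarrow> bounded (g ` space M)"
  unfolding bounded_by_def bounded_iff by auto

end

context doeblin_chain
begin

text \<open>A contraction estimate bounds its fixed points, because the supremum of a bounded function is
  the least of its bounds.\<close>

lemma bounded_by_contraction:
  assumes v: "bounded_by B v" and \<theta>: "\<theta> < 1"
    and step: "\<And>C. 0 \<le> C \<Longrightarrow> bounded_by C v \<Longrightarrow> bounded_by (\<theta> * C + c) v"
  shows "bounded_by (c / (1 - \<theta>)) v"
proof -
  define s where "s = (SUP x\<in>space M. \<bar>v x\<bar>)"
  have bdd: "bdd_above ((\<lambda>x. \<bar>v x\<bar>) ` space M)"
    using bounded_byD(2)[OF v] by (auto intro!: bdd_aboveI2)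
  have s: "bounded_by s v"
    using bounded_byD(1)[OF v] unfolding s_def by (intro bounded_byI cSUP_upper bdd)
  then have s0: "0 \<le> s" using space_nonempty unfolding bounded_by_def by fastforce
  have "s \<le> \<theta> * s + c"
    using cSUP_least[OF space_nonempty bounded_byD(2)[OF step[OF s0 s]]] by (simp add: s_def)
  then have "s \<le> c / (1 - \<theta>)" using \<theta> by (simp add: field_simps)
  then show ?thesis by (rule bounded_by_mono[OF s])
qed

lemma bounded_by_Q: "bounded_by C g \<Longrightarrow> bounded_by ((1 - \<epsilon>) * C) (Q g)"
  by (intro bounded_byI Q_measurable[where C=C] Q_bound) (auto simp: bounded_by_def)

lemma Q_lin:
  "bounded_by C g \<Longrightarrow> bounded_by D h \<Longrightarrow> x \<in> space M \<Longrightarrow> Q (\<lambda>y. a * g y + b * h y) x = a * Q g x + b * Q h x"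
  by (rule Q_add[where C=C and D=D]) (auto simp: bounded_by_def)

lemma integrable_nu: "bounded_by C g \<Longrightarrow> integrable \<nu> g"
  by (rule integral_nu_bound(1)) (auto simp: bounded_by_def)

lemma abs_integral_nu_le: "bounded_by C g \<Longrightarrow> \<bar>\<integral>y. g y \<partial>\<nu>\<bar> \<le> C"
  by (rule integral_nu_bound(2)) (auto simp: bounded_by_def)

lemma uniform_limit_Q:
  assumes lim: "uniform_limit (space M) g f G"
    and g: "eventually (\<lambda>j. \<exists>C. bounded_by C (g j)) G" and f: "bounded_by D f"
  shows "uniform_limit (space M) (\<lambda>j. Q (g j)) (Q f) G"
proof (rule uniform_limitI)
  fix e :: real assume e: "0 < e"
  have "eventually (\<lambda>j. \<forall>x\<in>space M. dist (g j x) (f x) < e / 2) G"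
    using e by (intro uniform_limitD[OF lim]) auto
  with g show "eventually (\<lambda>j. \<forall>x\<in>space M. dist (Q (g j) x) (Q f x) < e) G"
  proof eventually_elim
    case (elim j)
    then obtain C where C: "bounded_by C (g j)" by blast
    show ?case
    proof
      fix x assume x: "x \<in> space M"
      have "bounded_by (e / 2) (\<lambda>y. 1 * g j y + (-1) * f y)"
        by (rule bounded_byI) (use elim bounded_byD(1)[OF C] bounded_byD(1)[OF f] in \<open>auto simp: dist_real_def intro: less_imp_le\<close>)
      from bounded_byD(2)[OF bounded_by_Q[OF this] x]
      have "\<bar>Q (g j) x - Q f x\<bar> \<le> (1 - \<epsilon>) * (e / 2)"
        by (simp only: Q_lin[OF C f x])
      also have "\<dots> \<le> 1 * (e / 2)" using eps_pos e by (intro mult_right_mono) auto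
      finally show "dist (Q (g j) x) (Q f x) < e" using e by (simp add: dist_real_def)
    qed
  qed
qed

lemma tendsto_integral_nu:
  assumes lim: "uniform_limit (space M) g f G"
    and g: "eventually (\<lambda>j. \<exists>C. bounded_by C (g j)) G" and f: "bounded_by D f"
  shows "((\<lambda>j. \<integral>y. g j y \<partial>\<nu>) \<longlongrightarrow> (\<integral>y. f y \<partial>\<nu>)) G"
proof (rule tendstoI)
  fix e :: real assume e: "0 < e"
  have "eventually (\<lambda>j. \<forall>x\<in>space M. dist (g j x) (f x) < e / 2) G"
    using e by (intro uniform_limitD[OF lim]) auto
  with g show "eventually (\<lambda>j. dist (\<integral>y. g j y \<partial>\<nu>) (\<integral>y. f y \<partial>\<nu>) < e) G"
  proof eventually_elim
    case (elim j)
    then obtain C where C: "bounded_by C (g j)" by blast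
    have "bounded_by (e / 2) (\<lambda>y. g j y - f y)"
      by (rule bounded_byI) (use elim bounded_byD(1)[OF C] bounded_byD(1)[OF f] in \<open>auto simp: dist_real_def intro: less_imp_le\<close>)
    from abs_integral_nu_le[OF this] show ?case
      using e integrable_nu[OF C] integrable_nu[OF f] by (simp add: dist_real_def)
  qed
qed

text \<open>\<open>L k = \<epsilon> \<nu> (1 - k Q)\<^sup>-\<^sup>1\<close>, as a Neumann series. For the \<open>k\<close> that belongs to the growth
  rate, it is the counterpart of a left eigenvector.\<close>

definition kQ :: "('a \<Rightarrow> real) \<Rightarrow> ('a \<Rightarrow> real) \<Rightarrow> 'a \<Rightarrow> real" where
  "kQ k g x = k x * Q g x"

definition L :: "('a \<Rightarrow> real) \<Rightarrow> ('a \<Rightarrow> real) \<Rightarrow> real" where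
  "L k g = (\<Sum>n. \<epsilon> * (\<integral>x. (kQ k ^^ n) g x \<partial>\<nu>))"

lemma bounded_by_kQ: 
  assumes "bounded_by \<kappa> k" "bounded_by C g" 
  shows "bounded_by ((1 - \<epsilon>) * \<kappa> * C) (kQ k g)"
  using bounded_by_mult[OF assms(1) bounded_by_Q[OF assms(2)]] unfolding kQ_def[abs_def] by (simp add: mult_ac)

lemma bounded_by_kQ_pow:
  assumes "bounded_by \<kappa> k" "bounded_by C g" 
  shows "bounded_by (((1 - \<epsilon>) * \<kappa>) ^ n * C) ((kQ k ^^ n) g)"
  by (induction n) (use assms(2) bounded_by_kQ[OF assms(1)] in \<open>auto simp: mult.assoc\<close>)

lemma kQ_pow_lin:
  assumes k: "bounded_by \<kappa> k" and g: "bounded_by C g" and h: "bounded_by D h" and x: "x \<in> space M"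
  shows "(kQ k ^^ n) (\<lambda>y. a * g y + b * h y) x = a * (kQ k ^^ n) g x + b * (kQ k ^^ n) h x"
  using x
proof (induction n arbitrary: x)
  case (Suc n)
  have "Q ((kQ k ^^ n) (\<lambda>y. a * g y + b * h y)) x = Q (\<lambda>y. a * (kQ k ^^ n) g y + b * (kQ k ^^ n) h y) x"
    by (intro Q_cong Suc)
  also have "\<dots> = a * Q ((kQ k ^^ n) g) x + b * Q ((kQ k ^^ n) h) x"
    by (rule Q_lin[OF bounded_by_kQ_pow[OF k g] bounded_by_kQ_pow[OF k h] Suc.prems])
  finally have *: "Q ((kQ k ^^ n) (\<lambda>y. a * g y + b * h y)) x = \<dots>" .
  have kQ_at: "kQ k G x = k x * Q G x" for G by (simp add: kQ_def)
  show ?case by (simp add: kQ_at * algebra_simps)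
qed auto

context
  fixes \<kappa> :: real
  assumes \<kappa>: "(1 - \<epsilon>) * \<kappa> < 1" "0 \<le> \<kappa>"
begin

lemma \<theta>_nonneg: "0 \<le> (1 - \<epsilon>) * \<kappa>"
  using eps_le_1 \<kappa> by auto

lemma L_summable:
  assumes "bounded_by \<kappa> k" "bounded_by C g" 
  shows "summable (\<lambda>n. \<epsilon> * (\<integral>x. (kQ k ^^ n) g x \<partial>\<nu>))"
proof (rule summable_comparison_test')
  show "summable (\<lambda>n. \<epsilon> * (((1 - \<epsilon>) * \<kappa>) ^ n * C))"
    using \<theta>_nonneg \<kappa> by (intro summable_mult summable_mult2 summable_geometric) auto
  show "norm (\<epsilon> * (\<integral>x. (kQ k ^^ n) g x \<partial>\<nu>)) \<le> \<epsilon> * (((1 - \<epsilon>) * \<kappa>) ^ n * C)" for n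
    using eps_pos abs_integral_nu_le[OF bounded_by_kQ_pow[OF assms]] by (simp add: abs_mult)
qed

lemma L_lin:
  assumes k: "bounded_by \<kappa> k" and g: "bounded_by C g" and h: "bounded_by D h"
  shows "L k (\<lambda>y. a * g y + b * h y) = a * L k g + b * L k h"
proof -
  have "(\<integral>x. (kQ k ^^ n) (\<lambda>y. a * g y + b * h y) x \<partial>\<nu>) =
      a * (\<integral>x. (kQ k ^^ n) g x \<partial>\<nu>) + b * (\<integral>x. (kQ k ^^ n) h x \<partial>\<nu>)" for n
  proof -
    have "(\<integral>x. (kQ k ^^ n) (\<lambda>y. a * g y + b * h y) x \<partial>\<nu>) = (\<integral>x. a * (kQ k ^^ n) g x + b * (kQ k ^^ n) h x \<partial>\<nu>)"
      by (intro Bochner_Integration.integral_cong refl) (simp add: kQ_pow_lin[OF k g h])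
    then show ?thesis
      using integrable_nu[OF bounded_by_kQ_pow[OF k g]] integrable_nu[OF bounded_by_kQ_pow[OF k h]] by simp
  qed
  then have "L k (\<lambda>y. a * g y + b * h y) = (\<Sum>n. a * (\<epsilon> * (\<integral>x. (kQ k ^^ n) g x \<partial>\<nu>)) + b * (\<epsilon> * (\<integral>x. (kQ k ^^ n) h x \<partial>\<nu>)))"
    unfolding L_def by (simp add: algebra_simps)
  also have "\<dots> = a * L k g + b * L k h"
    using L_summable[OF k g] L_summable[OF k h]
    unfolding L_def by (simp add: suminf_add[symmetric] suminf_mult summable_mult)
  finally show ?thesis .
qed

lemma L_cong:
  assumes "\<And>x. x \<in> space M \<Longrightarrow> g x = h x"
  shows "L k g = L k h"
proof -
  have "(kQ k ^^ n) g x = (kQ k ^^ n) h x" if "x \<in> space M" for n x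
    using that by (induction n arbitrary: x) (auto simp: assms kQ_def intro!: Q_cong)
  then have "(\<integral>x. (kQ k ^^ n) g x \<partial>\<nu>) = (\<integral>x. (kQ k ^^ n) h x \<partial>\<nu>)" for n
    by (intro Bochner_Integration.integral_cong) auto
  then show ?thesis unfolding L_def by simp
qed

lemma L_rec:
  assumes k: "bounded_by \<kappa> k" and g: "bounded_by C g"
  shows "L k g = \<epsilon> * (\<integral>x. g x \<partial>\<nu>) + L k (kQ k g)"
  using suminf_split_head[OF L_summable[OF k g]]
  unfolding L_def by (simp add: funpow_Suc_right del: funpow.simps(2))

text \<open>With \<open>w = e - (e - 1) k\<close>, the functional \<open>L k\<close> annihilates the range of \<open>w - P\<close> as soon as
  \<open>L k k = 1\<close>: put \<open>u = (e - P) h\<close>; then \<open>(e - 1) h = R u = Q u + \<epsilon> \<nu>(u)\<close>, so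
  \<open>(w - P) h = u - k Q u - \<epsilon> \<nu>(u) k\<close>, and \<open>L k u - L k (k Q u) = \<epsilon> \<nu>(u)\<close>.\<close>

lemma L_range:
  assumes k: "bounded_by \<kappa> k" and h: "bounded_by C h"
  shows "L k (\<lambda>x. (exp 1 - (exp 1 - 1) * k x) * h x - (\<integral>y. h y \<partial>K x)) =
     \<epsilon> * (\<integral>x. exp 1 * h x - (\<integral>y. h y \<partial>K x) \<partial>\<nu>) * (1 - L k k)"
proof -
  define u where "u x = exp 1 * h x - (\<integral>y. h y \<partial>K x)" for x
  have u: "bounded_by (exp 1 * C + C) u"
    unfolding u_def[abs_def] using bounded_by_lin[OF h bounded_by_K[OF h], of "exp 1" "-1"] by simp
  have eq: "(exp 1 - (exp 1 - 1) * k x) * h x - (\<integral>y. h y \<partial>K x) =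
      1 * (1 * u x + (-1) * kQ k u x) + (- \<epsilon> * (\<integral>x. u x \<partial>\<nu>)) * k x" if x: "x \<in> space M" for x
  proof -
    have "(\<integral>y. u y \<partial>Res x) = (exp 1 - 1) * h x"
      unfolding u_def by (rule resolvent_equation) (use h x in \<open>auto simp: bounded_by_def\<close>)
    then have Qu: "Q u x = (exp 1 - 1) * h x - \<epsilon> * (\<integral>x. u x \<partial>\<nu>)" unfolding Q_def by simp
    show ?thesis unfolding kQ_def Qu u_def[of x] by (simp add: algebra_simps)
  qed
  have "L k (\<lambda>x. (exp 1 - (exp 1 - 1) * k x) * h x - (\<integral>y. h y \<partial>K x)) =
     L k (\<lambda>x. 1 * (1 * u x + (-1) * kQ k u x) + (- \<epsilon> * (\<integral>x. u x \<partial>\<nu>)) * k x)"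
    by (rule L_cong) (rule eq)
  also have "\<dots> = L k u - L k (kQ k u) - \<epsilon> * (\<integral>x. u x \<partial>\<nu>) * L k k"
    by (simp only: L_lin[OF k bounded_by_lin[OF u bounded_by_kQ[OF k u]] k] L_lin[OF k u bounded_by_kQ[OF k u]]) simp
  also have "\<dots> = \<epsilon> * (\<integral>x. u x \<partial>\<nu>) * (1 - L k k)"
    unfolding L_rec[OF k u] by (simp add: algebra_simps)
  finally show ?thesis unfolding u_def .
qed

text \<open>An eigenfunction \<open>f\<close> with \<open>\<nu>(k f) \<noteq> 0\<close> makes the left side of the previous identity vanish
  while its factor \<open>\<nu>((e - P) f)\<close> does not, so that \<open>L k k = 1\<close>.\<close>

lemma L_eigen:
  assumes k: "bounded_by \<kappa> k" and f: "bounded_by C f"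
    and eigen: "\<And>x. x \<in> space M \<Longrightarrow> (\<integral>y. f y \<partial>K x) = (exp 1 - (exp 1 - 1) * k x) * f x"
    and norm: "(\<integral>x. k x * f x \<partial>\<nu>) \<noteq> 0"
  shows "bounded_by D h \<Longrightarrow> L k (\<lambda>x. (exp 1 - (exp 1 - 1) * k x) * h x - (\<integral>y. h y \<partial>K x)) = 0"
    and "L k (\<lambda>_. 1) = 1"
proof -
  have "L k (\<lambda>x. (exp 1 - (exp 1 - 1) * k x) * f x - (\<integral>y. f y \<partial>K x)) = L k (\<lambda>x. 0 * 1 + 0 * 1)"
    by (rule L_cong) (simp add: eigen)
  also have "\<dots> = 0" by (subst L_lin[OF k bounded_by_const bounded_by_const]) simp
  finally have "\<epsilon> * (\<integral>x. exp 1 * f x - (\<integral>y. f y \<partial>K x) \<partial>\<nu>) * (1 - L k k) = 0"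
    using L_range[OF k f] by simp
  moreover have "(\<integral>x. exp 1 * f x - (\<integral>y. f y \<partial>K x) \<partial>\<nu>) = (\<integral>x. (exp 1 - 1) * (k x * f x) \<partial>\<nu>)"
    by (intro Bochner_Integration.integral_cong refl) (simp add: eigen algebra_simps)
  ultimately have L1: "L k k = 1" using norm eps_pos by simp
  show "bounded_by D h \<Longrightarrow> L k (\<lambda>x. (exp 1 - (exp 1 - 1) * k x) * h x - (\<integral>y. h y \<partial>K x)) = 0"
    by (simp add: L_range[OF k] L1)
  have one: "bounded_by 1 (\<lambda>_. 1)" using bounded_by_const[of 1] by simp
  have "L k (kQ k (\<lambda>_. 1)) = L k (\<lambda>x. (1 - \<epsilon>) * k x + 0 * k x)"
    by (rule L_cong) (simp add: kQ_def Q_one)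
  also have "\<dots> = 1 - \<epsilon>" by (subst L_lin[OF k k k]) (simp add: L1)
  finally show "L k (\<lambda>_. 1) = 1"
    using L_rec[OF k one] prob_space.prob_space[OF prob_space_nu] by simp
qed

text \<open>Every term of the Neumann series converges, and all series share one geometric majorant.\<close>

lemma tendsto_L:
  assumes G: "G \<noteq> bot"
    and k: "eventually (\<lambda>j. bounded_by \<kappa> (kk j)) G" "bounded_by \<kappa> k" "uniform_limit (space M) kk k G"
    and g: "eventually (\<lambda>j. bounded_by C (gg j)) G" "bounded_by C g" "uniform_limit (space M) gg g G"
  shows "((\<lambda>j. L (kk j) (gg j)) \<longlongrightarrow> L k g) G"
proof -
  have u: "uniform_limit (space M) (\<lambda>j. (kQ (kk j) ^^ n) (gg j)) ((kQ k ^^ n) g) G" for n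
  proof (induction n)
    case (Suc n)
    have "eventually (\<lambda>j. \<exists>C. bounded_by C ((kQ (kk j) ^^ n) (gg j))) G"
      using k(1) g(1) by eventually_elim (auto intro: bounded_by_kQ_pow)
    from uniform_limit_Q[OF Suc this bounded_by_kQ_pow[OF k(2) g(2)]]
    have "uniform_limit (space M) (\<lambda>j. Q ((kQ (kk j) ^^ n) (gg j))) (Q ((kQ k ^^ n) g)) G" .
    from uniform_lim_mult[OF k(3) this bounded_by_image[OF k(2)] bounded_by_image[OF bounded_by_Q[OF bounded_by_kQ_pow[OF k(2) g(2)]]]]
    show ?case by (simp add: kQ_def[abs_def])
  qed (use g(3) in simp)
  have "((\<lambda>j. \<Sum>n. \<epsilon> * (\<integral>x. (kQ (kk j) ^^ n) (gg j) x \<partial>\<nu>)) \<longlongrightarrow> (\<Sum>n. \<epsilon> * (\<integral>x. (kQ k ^^ n) g x \<partial>\<nu>))) G"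
  proof (rule tannerys_theorem[THEN conjunct2, THEN conjunct2, OF _ _ _ G])
    show "((\<lambda>j. \<epsilon> * (\<integral>x. (kQ (kk j) ^^ n) (gg j) x \<partial>\<nu>)) \<longlongrightarrow> \<epsilon> * (\<integral>x. (kQ k ^^ n) g x \<partial>\<nu>)) G" for n
    proof (intro tendsto_mult tendsto_const tendsto_integral_nu[OF u _ bounded_by_kQ_pow[OF k(2) g(2)]])
      show "eventually (\<lambda>j. \<exists>C. bounded_by C ((kQ (kk j) ^^ n) (gg j))) G"
        using k(1) g(1) by eventually_elim (auto intro: bounded_by_kQ_pow)
    qed
    show "summable (\<lambda>n. \<epsilon> * (((1 - \<epsilon>) * \<kappa>) ^ n * C))"
      using \<theta>_nonneg \<kappa> by (intro summable_mult summable_mult2 summable_geometric) auto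
    have "eventually (\<lambda>j. \<forall>n. norm (\<epsilon> * (\<integral>x. (kQ (kk j) ^^ n) (gg j) x \<partial>\<nu>)) \<le> \<epsilon> * (((1 - \<epsilon>) * \<kappa>) ^ n * C)) G"
      using k(1) g(1)
    proof eventually_elim
      case (elim j)
      then show ?case
        using eps_pos abs_integral_nu_le[OF bounded_by_kQ_pow[OF elim]] by (simp add: abs_mult)
    qed
    from eventually_compose_filterlim[OF this filterlim_snd]
    show "eventually (\<lambda>(n, j). norm (\<epsilon> * (\<integral>x. (kQ (kk j) ^^ n) (gg j) x \<partial>\<nu>)) \<le> \<epsilon> * (((1 - \<epsilon>) * \<kappa>) ^ n * C)) (at_top \<times>\<^sub>F G)"
      by (rule eventually_mono) auto
  qed
  then show ?thesis unfolding L_def .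
qed

end

end


section \<open>Supersolutions and the growth rate\<close>

context doeblin_functional
begin

lemma abs_F_le: "x \<in> space M \<Longrightarrow> \<bar>F x\<bar> \<le> 1"
  using F_bounded[of x] by auto

lemma pi_prob: "\<pi> \<in> space (prob_algebra M)"
  using invariant unfolding invariant_prob_def by simp

lemma prob_space_pi: "prob_space \<pi>" and sets_pi [simp]: "sets \<pi> = sets M"
  using pi_prob by (auto simp: space_prob_algebra)

lemma space_pi [simp]: "space \<pi> = space M"
  by (rule sets_eq_imp_space_eq[OF sets_pi])

lemma integrable_pi:
  assumes "bounded_by C g"
  shows "integrable \<pi> g"
proof (rule prob_space.abs_integral_le(1)[OF prob_space_pi])
  show "g \<in> borel_measurable \<pi>"
    unfolding measurable_cong_sets[OF sets_pi refl] by (rule bounded_byD(1)[OF assms])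
  show "\<And>y. y \<in> space \<pi> \<Longrightarrow> \<bar>g y\<bar> \<le> C"
    using bounded_byD(2)[OF assms] by simp
qed

lemma integral_pi_K:
  assumes "bounded_by C h"
  shows "(\<integral>x. (\<integral>y. h y \<partial>K x) \<partial>\<pi>) = (\<integral>x. h x \<partial>\<pi>)"
proof -
  have "(\<integral>x. h x \<partial>(\<pi> \<bind> K)) = (\<integral>x. (\<integral>y. h y \<partial>K x) \<partial>\<pi>)"
  proof (rule integral_bind[where B=C and B'=1])
    show "h \<in> borel_measurable M" by (rule bounded_byD(1)[OF assms])
    show "\<And>x. x \<in> space M \<Longrightarrow> \<bar>h x\<bar> \<le> C" by (rule bounded_byD(2)[OF assms])
    show "K \<in> \<pi> \<rightarrow>\<^sub>M subprob_algebra M"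
      unfolding measurable_cong_sets[OF sets_pi refl] by (rule measurable_K_subprob)
    show "finite_measure \<pi>" using prob_space_pi by (rule prob_space.finite_measure)
    show "AE x in \<pi>. emeasure (K x) (space (K x)) \<le> ennreal 1"
    proof (rule AE_I2)
      fix x assume "x \<in> space \<pi>"
      then have "prob_space (K x)" using prob_space_K by simp
      then show "emeasure (K x) (space (K x)) \<le> ennreal 1" by (simp add: prob_space.emeasure_space_1)
    qed
  qed
  moreover have "\<pi> \<bind> K = \<pi>" using invariant unfolding invariant_prob_def by (rule conjunct2)
  ultimately show ?thesis by simp
qed

text \<open>The equation \<open>P g = l e\<^sup>-\<^sup>a\<^sup>F g\<close> says that \<open>g\<close> is an eigenfunction of
  \<open>e\<^sup>a\<^sup>F P\<close> with eigenvalue \<open>l\<close>.\<close>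

definition weight :: "real \<Rightarrow> real \<Rightarrow> 'a \<Rightarrow> real" where
  "weight a l x = l * exp (- a * F x)"

definition supersolution :: "real \<Rightarrow> real \<Rightarrow> real \<Rightarrow> ('a \<Rightarrow> real) \<Rightarrow> bool" where
  "supersolution a l C g \<longleftrightarrow> bounded_by C g \<and>
     (\<forall>x\<in>space M. 0 \<le> g x \<and> (\<integral>y. g y \<partial>K x) + 1 \<le> weight a l x * g x)"

text \<open>A supersolution with parameter \<open>l\<close> bounds the growth of \<open>(e\<^sup>a\<^sup>F P)\<^sup>n\<close> by a multiple of \<open>l\<^sup>n\<close>. Taking
  the infimum of such \<open>l\<close> as the growth rate postpones all questions of existence of limits.\<close>

definition radius :: "real \<Rightarrow> real" where
  "radius a = Inf {l. \<exists>C g. supersolution a l C g}"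

lemma exp_F_bounds:
  assumes "x \<in> space M"
  shows "exp (- \<bar>a\<bar>) \<le> exp (- a * F x)" "exp (- a * F x) \<le> exp \<bar>a\<bar>"
proof -
  have "\<bar>a * F x\<bar> \<le> \<bar>a\<bar> * 1" unfolding abs_mult using abs_F_le[OF assms] by (intro mult_left_mono) auto
  then have "- \<bar>a\<bar> \<le> - a * F x" "- a * F x \<le> \<bar>a\<bar>" unfolding abs_le_iff by simp_all
  then show "exp (- \<bar>a\<bar>) \<le> exp (- a * F x)" "exp (- a * F x) \<le> exp \<bar>a\<bar>"
    by (simp_all only: exp_le_cancel_iff)
qed

lemma bounded_by_exp_F: "bounded_by (exp \<bar>a\<bar>) (\<lambda>x. exp (- a * F x))"
proof (rule bounded_byI)
  show "(\<lambda>x. exp (- a * F x)) \<in> borel_measurable M" using F_measurable by measurable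
  show "\<bar>exp (- a * F x)\<bar> \<le> exp \<bar>a\<bar>" if "x \<in> space M" for x
    using exp_F_bounds(2)[OF that, of a] by simp
qed

lemma bounded_by_weight: "bounded_by (\<bar>l\<bar> * exp \<bar>a\<bar>) (weight a l)"
  unfolding weight_def[abs_def] by (rule bounded_by_cmult[OF bounded_by_exp_F])

lemma supersolutionD:
  assumes "supersolution a l C g" "x \<in> space M"
  shows "0 \<le> g x" "(\<integral>y. g y \<partial>K x) + 1 \<le> weight a l x * g x" "g x \<le> C" "0 \<le> (\<integral>y. g y \<partial>K x)"
    "1 \<le> weight a l x * g x"
proof -
  show *: "0 \<le> g x" "(\<integral>y. g y \<partial>K x) + 1 \<le> weight a l x * g x"
    using assms unfolding supersolution_def by auto
  show "g x \<le> C" using bounded_byD(2)[of C g x] assms unfolding supersolution_def by auto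
  show "0 \<le> (\<integral>y. g y \<partial>K x)"
  proof (rule Bochner_Integration.integral_nonneg)
    fix y assume "y \<in> space (K x)"
    then have "y \<in> space M" using assms(2) by (simp add: space_K)
    then show "0 \<le> g y" using assms(1) unfolding supersolution_def by blast
  qed
  with * show "1 \<le> weight a l x * g x" by simp
qed

lemma supersolution_pos:
  assumes "supersolution a l C g"
  shows "0 < l" and "x \<in> space M \<Longrightarrow> exp (- \<bar>a\<bar>) / l \<le> g x"
proof -
  obtain z where z: "z \<in> space M" using space_nonempty by auto
  have "0 < weight a l z * g z" using supersolutionD(5)[OF assms z] by simp
  with supersolutionD(1)[OF assms z] have "0 < weight a l z"
    using mult_nonpos_nonneg[of "weight a l z" "g z"] by (cases "weight a l z \<le> 0") auto
  then show l: "0 < l" unfolding weight_def by (simp add: zero_less_mult_iff)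
  show "exp (- \<bar>a\<bar>) / l \<le> g x" if x: "x \<in> space M"
  proof -
    have "1 \<le> weight a l x * g x" by (rule supersolutionD(5)[OF assms x])
    also have "\<dots> \<le> l * exp \<bar>a\<bar> * g x"
      unfolding weight_def using exp_F_bounds(2)[OF x, of a] l supersolutionD(1)[OF assms x]
      by (intro mult_right_mono mult_left_mono) auto
    finally show ?thesis using l by (simp add: exp_minus field_simps)
  qed
qed

text \<open>Jensen's inequality for the logarithm of a supersolution, integrated against the invariant
  law.\<close>

lemma supersolution_ge_1:
  assumes g: "supersolution a l C g"
  shows "1 \<le> l"
proof -
  interpret pi: prob_space \<pi> by (rule prob_space_pi)
  define d where "d = exp (- \<bar>a\<bar>) / l"
  have l: "0 < l" by (rule supersolution_pos(1)[OF g])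
  then have d: "0 < d" unfolding d_def by simp
  have bg: "bounded_by C g" using g unfolding supersolution_def by simp
  have gd: "d \<le> g x" and gC: "g x \<le> C" if "x \<in> space M" for x
    using supersolution_pos(2)[OF g that] supersolutionD(3)[OF g that] unfolding d_def by auto
  let ?h = "\<lambda>x. ln (g x)"
  have bh: "bounded_by (\<bar>ln d\<bar> + \<bar>ln C\<bar>) ?h"
  proof (rule bounded_byI)
    show "?h \<in> borel_measurable M" using bounded_byD(1)[OF bg] by measurable
    fix x assume x: "x \<in> space M"
    have "ln d \<le> ln (g x)" "ln (g x) \<le> ln C" using gd[OF x] gC[OF x] d by auto
    then show "\<bar>?h x\<bar> \<le> \<bar>ln d\<bar> + \<bar>ln C\<bar>" by linarith
  qed
  have main: "(\<integral>y. ?h y \<partial>K x) \<le> ln l + (- a * F x + ?h x)" if x: "x \<in> space M" for x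
  proof -
    interpret Kx: prob_space "K x" by (rule prob_space_K[OF x])
    define c where "c = (\<integral>y. g y \<partial>K x)"
    have "(\<integral>y. d \<partial>K x) \<le> c" unfolding c_def
      using integrable_K[OF bg x] gd by (intro integral_mono) (auto simp: space_K[OF x])
    then have c: "0 < c" using d by (simp add: Kx.prob_space)
    have "(\<integral>y. ?h y \<partial>K x) \<le> (\<integral>y. ln c + (g y / c - 1) \<partial>K x)"
    proof (rule integral_mono)
      fix y assume "y \<in> space (K x)"
      then have y: "0 < g y" using gd[of y] d by (auto simp: space_K[OF x])
      have "ln (g y / c) \<le> g y / c - 1" using y c by (intro ln_le_minus_one) auto
      then show "ln (g y) \<le> ln c + (g y / c - 1)" using y c by (simp add: ln_div)
    qed (use integrable_K[OF bh x] integrable_K[OF bg x] in auto)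
    also have "\<dots> = ln c" using integrable_K[OF bg x] c by (simp add: Kx.prob_space c_def[symmetric])
    also have "\<dots> \<le> ln (weight a l x * g x)"
      using c supersolutionD(2)[OF g x] unfolding c_def by (intro ln_mono) auto
    also have "\<dots> = ln l + (- a * F x + ?h x)"
      using l gd[OF x] d unfolding weight_def by (simp add: ln_mult)
    finally show ?thesis .
  qed
  have bF: "bounded_by 1 F" using abs_F_le F_measurable by (intro bounded_byI) auto
  have "(\<integral>x. ?h x \<partial>\<pi>) = (\<integral>x. (\<integral>y. ?h y \<partial>K x) \<partial>\<pi>)" by (rule integral_pi_K[OF bh, symmetric])
  also have "\<dots> \<le> (\<integral>x. ln l + (- a * F x + ?h x) \<partial>\<pi>)"
    using integrable_pi[OF bounded_by_K[OF bh]] integrable_pi[OF bh] integrable_pi[OF bF] main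
    by (intro integral_mono) auto
  also have "\<dots> = ln l + (\<integral>x. ?h x \<partial>\<pi>)"
    using integrable_pi[OF bh] integrable_pi[OF bF] pi.prob_space by (simp add: F_mean)
  finally have "0 \<le> ln l" by simp
  then show ?thesis using l by simp
qed

lemma supersolution_mono:
  assumes "supersolution a l C g" "l \<le> l'"
  shows "supersolution a l' C g"
  unfolding supersolution_def
proof (intro conjI ballI)
  fix x assume x: "x \<in> space M"
  have "weight a l x * g x \<le> weight a l' x * g x"
    using assms(2) supersolutionD(1)[OF assms(1) x] unfolding weight_def by (intro mult_right_mono) auto
  then show "(\<integral>y. g y \<partial>K x) + 1 \<le> weight a l' x * g x"
    using supersolutionD(2)[OF assms(1) x] by simp
  show "0 \<le> g x" by (rule supersolutionD(1)[OF assms(1) x])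
qed (use assms(1) in \<open>simp add: supersolution_def\<close>)

lemma supersolution_shift:
  assumes g: "supersolution a l C g"
  shows "supersolution a' (exp \<bar>a' - a\<bar> * l) C g"
  unfolding supersolution_def
proof (intro conjI ballI)
  fix x assume x: "x \<in> space M"
  have "- a * F x \<le> \<bar>a' - a\<bar> + - a' * F x"
  proof -
    have "(a' - a) * F x \<le> \<bar>(a' - a) * F x\<bar>" by simp
    also have "\<dots> \<le> \<bar>a' - a\<bar> * 1" unfolding abs_mult using abs_F_le[OF x] by (intro mult_left_mono) auto
    finally show ?thesis by (simp add: algebra_simps)
  qed
  then have "exp (- a * F x) \<le> exp \<bar>a' - a\<bar> * exp (- a' * F x)" by (simp add: exp_add[symmetric])
  then have "l * exp (- a * F x) \<le> l * (exp \<bar>a' - a\<bar> * exp (- a' * F x))"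
    using supersolution_pos(1)[OF g] by (intro mult_left_mono) auto
  then have "weight a l x \<le> weight a' (exp \<bar>a' - a\<bar> * l) x"
    unfolding weight_def by (simp add: mult_ac)
  then have "weight a l x * g x \<le> weight a' (exp \<bar>a' - a\<bar> * l) x * g x"
    using supersolutionD(1)[OF g x] by (intro mult_right_mono)
  then show "(\<integral>y. g y \<partial>K x) + 1 \<le> weight a' (exp \<bar>a' - a\<bar> * l) x * g x"
    using supersolutionD(2)[OF g x] by simp
  show "0 \<le> g x" by (rule supersolutionD(1)[OF g x])
qed (use g in \<open>simp add: supersolution_def\<close>)

lemma supersolution_const:
  assumes l: "exp \<bar>a\<bar> < l"
  shows "\<exists>C g. supersolution a l C g"
proof -
  define q where "q = l * exp (- \<bar>a\<bar>)"
  have "exp \<bar>a\<bar> * exp (- \<bar>a\<bar>) < l * exp (- \<bar>a\<bar>)" using l by (intro mult_strict_right_mono) auto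
  then have q: "1 < q" by (simp add: q_def exp_minus)
  define c where "c = 1 / (q - 1)"
  have c: "0 < c" "c + 1 = q * c" using q by (auto simp: c_def field_simps)
  have "0 < l" using l by (smt (verit) exp_gt_zero)
  have "supersolution a l \<bar>c\<bar> (\<lambda>_. c)"
    unfolding supersolution_def
  proof (intro conjI ballI bounded_by_const)
    fix x assume x: "x \<in> space M"
    have "q * c \<le> weight a l x * c"
      unfolding q_def weight_def using exp_F_bounds(1)[OF x, of a] c \<open>0 < l\<close> by (intro mult_right_mono mult_left_mono) auto
    then show "(\<integral>y. c \<partial>K x) + 1 \<le> weight a l x * c"
      using prob_space.prob_space[OF prob_space_K[OF x]] c by simp
    show "0 \<le> c" using c by simp
  qed
  then show ?thesis by blast
qed

text \<open>The defect \<open>1\<close> in the inequality leaves room to lower the parameter.\<close>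

lemma supersolution_improve:
  assumes g: "supersolution a l C g" and C: "0 < C"
  shows "supersolution a (l - exp (- \<bar>a\<bar>) / (2 * C)) (2 * C) (\<lambda>x. 2 * g x)"
  unfolding supersolution_def
proof (intro conjI ballI)
  show "bounded_by (2 * C) (\<lambda>x. 2 * g x)"
    using bounded_by_cmult[of C g 2] g unfolding supersolution_def by simp
  fix x assume x: "x \<in> space M"
  have "exp (- \<bar>a\<bar>) / (2 * C) * exp (- a * F x) * (2 * g x) \<le> exp (- \<bar>a\<bar>) / (2 * C) * exp \<bar>a\<bar> * (2 * C)"
    using exp_F_bounds(2)[OF x, of a] supersolutionD(1,3)[OF g x] C
    by (intro mult_mono mult_left_mono) auto
  also have "\<dots> = 1" using C by (simp add: exp_minus)
  finally have "exp (- \<bar>a\<bar>) / (2 * C) * exp (- a * F x) * (2 * g x) \<le> 1" .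
  moreover have "weight a (l - exp (- \<bar>a\<bar>) / (2 * C)) x * (2 * g x) =
      2 * (weight a l x * g x) - exp (- \<bar>a\<bar>) / (2 * C) * exp (- a * F x) * (2 * g x)"
    unfolding weight_def by (simp add: algebra_simps)
  ultimately show "(\<integral>y. 2 * g y \<partial>K x) + 1 \<le> weight a (l - exp (- \<bar>a\<bar>) / (2 * C)) x * (2 * g x)"
    using supersolutionD(2)[OF g x] by simp
  show "0 \<le> 2 * g x" using supersolutionD(1)[OF g x] by simp
qed

lemma supersolutions_bdd: "bdd_below {l. \<exists>C g. supersolution a l C g}"
  using supersolution_ge_1 by (intro bdd_belowI[of _ 1]) auto

lemma supersolutions_nonempty: "{l. \<exists>C g. supersolution a l C g} \<noteq> {}"
  using supersolution_const[of a "exp \<bar>a\<bar> + 1"] by auto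

lemma radius_le: "supersolution a l C g \<Longrightarrow> radius a \<le> l"
  unfolding radius_def by (rule cInf_lower[OF _ supersolutions_bdd]) auto

lemma radius_ge_1: "1 \<le> radius a"
  unfolding radius_def using supersolution_ge_1 by (intro cInf_greatest[OF supersolutions_nonempty]) auto

lemma supersolution_exists:
  assumes "radius a < l"
  shows "\<exists>C g. supersolution a l C g"
proof -
  obtain l' where "\<exists>C g. supersolution a l' C g" "l' < l"
    using cInf_lessD[OF supersolutions_nonempty assms[unfolded radius_def]] by auto
  then show ?thesis using supersolution_mono[of a l' _ _ l] by fastforce
qed

lemma radius_le_exp: "radius a \<le> exp \<bar>a\<bar>"
proof (rule dense_ge)
  fix l assume "exp \<bar>a\<bar> < l"
  then show "radius a \<le> l" using supersolution_const radius_le by blast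
qed

lemma radius_shift: "radius a' \<le> exp \<bar>a' - a\<bar> * radius a"
proof -
  have "radius a' / exp \<bar>a' - a\<bar> \<le> radius a"
  proof (rule dense_ge)
    fix l assume "radius a < l"
    then obtain C g where "supersolution a l C g" using supersolution_exists by blast
    from radius_le[OF supersolution_shift[OF this, of a']]
    show "radius a' / exp \<bar>a' - a\<bar> \<le> l" by (simp add: field_simps)
  qed
  then show ?thesis by (simp add: field_simps)
qed

lemma radius_0: "radius 0 = 1"
  using radius_ge_1[of 0] radius_le_exp[of 0] by simp

lemma continuous_radius: "(radius \<longlongrightarrow> radius a) (at a)"
proof (rule tendsto_sandwich)
  show "eventually (\<lambda>a'. exp (- \<bar>a' - a\<bar>) * radius a \<le> radius a') (at a)"
  proof (rule always_eventually, rule allI)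
    fix a' show "exp (- \<bar>a' - a\<bar>) * radius a \<le> radius a'"
      using radius_shift[of a a'] by (simp add: exp_minus field_simps abs_minus_commute)
  qed
  show "eventually (\<lambda>a'. radius a' \<le> exp \<bar>a' - a\<bar> * radius a) (at a)"
    using radius_shift by simp
  show "((\<lambda>a'. exp (- \<bar>a' - a\<bar>) * radius a) \<longlongrightarrow> radius a) (at a)"
    by (auto intro!: tendsto_eq_intros)
  show "((\<lambda>a'. exp \<bar>a' - a\<bar> * radius a) \<longlongrightarrow> radius a) (at a)"
    by (auto intro!: tendsto_eq_intros)
qed

text \<open>Above the growth rate, monotone iteration from \<open>0\<close> turns the inequality into an equation and
  produces the least of all supersolutions.\<close>

lemma minimal_solution:
  assumes "radius a < l"
  obtains C g where "supersolution a l C g"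
    "\<And>x. x \<in> space M \<Longrightarrow> (\<integral>y. g y \<partial>K x) + 1 = weight a l x * g x"
    "\<And>C' g' x. supersolution a l C' g' \<Longrightarrow> x \<in> space M \<Longrightarrow> g x \<le> g' x"
proof -
  obtain C s where s: "supersolution a l C s" using supersolution_exists[OF assms] by blast
  have l: "0 < l" by (rule supersolution_pos(1)[OF s])
  have w: "0 < weight a l x" for x using l unfolding weight_def by simp
  have mw: "weight a l \<in> borel_measurable M" by (rule bounded_byD(1)[OF bounded_by_weight])
  define T where "T h x = ((\<integral>y. h y \<partial>K x) + 1) / weight a l x" for h x
  define G where "G n = (T ^^ n) (\<lambda>_. 0)" for n
  have G0: "G 0 x = 0" and GS: "G (Suc n) x = ((\<integral>y. G n y \<partial>K x) + 1) / weight a l x" for n x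
    unfolding G_def by (auto simp: T_def)
  have mG: "G n \<in> borel_measurable M" for n
  proof (induction n)
    case (Suc n)
    have "G (Suc n) = (\<lambda>x. ((\<integral>y. G n y \<partial>K x) + 1) / weight a l x)" by (simp add: fun_eq_iff GS)
    then show ?case using Suc mw by simp
  qed (simp add: G_def)
  have G_nonneg: "0 \<le> G n x" if "x \<in> space M" for n x
    using that
  proof (induction n arbitrary: x)
    case (Suc n)
    then have "0 \<le> (\<integral>y. G n y \<partial>K x)" by (intro Bochner_Integration.integral_nonneg) (auto simp: space_K)
    then show ?case using w[of x] by (simp add: GS)
  qed (simp add: G0)
  have G_le: "G n x \<le> g' x" if g': "supersolution a l C' g'" and "x \<in> space M" for C' g' n x
    using that(2)
  proof (induction n arbitrary: x)
    case 0 then show ?case using supersolutionD(1)[OF g'] by (simp add: G0)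
  next
    case (Suc n)
    have b: "bounded_by C' g'" using g' unfolding supersolution_def by simp
    have "(\<integral>y. G n y \<partial>K x) \<le> (\<integral>y. g' y \<partial>K x)"
    proof (rule integral_mono)
      show "integrable (K x) g'" by (rule integrable_K[OF b Suc.prems])
      show "integrable (K x) (G n)"
      proof (rule integrable_K[OF _ Suc.prems])
        show "bounded_by C' (G n)"
        proof (rule bounded_byI[OF mG])
          show "\<bar>G n y\<bar> \<le> C'" if "y \<in> space M" for y
            using Suc.IH[OF that] G_nonneg[OF that, of n] supersolutionD(3)[OF g' that] by linarith
        qed
      qed
    qed (use Suc in \<open>auto simp: space_K\<close>)
    then show ?case using supersolutionD(2)[OF g' Suc.prems] w[of x] by (simp add: GS field_simps)
  qed
  have bG: "bounded_by C (G n)" for n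
  proof (rule bounded_byI[OF mG])
    show "\<bar>G n y\<bar> \<le> C" if "y \<in> space M" for y
      using G_le[OF s that, of n] G_nonneg[OF that, of n] supersolutionD(3)[OF s that] by linarith
  qed
  have G_mono: "G n x \<le> G (Suc n) x" if "x \<in> space M" for n x
    using that
  proof (induction n arbitrary: x)
    case 0 then show ?case using G_nonneg[OF 0, of 1] by (simp add: G0)
  next
    case (Suc n)
    have "(\<integral>y. G n y \<partial>K x) \<le> (\<integral>y. G (Suc n) y \<partial>K x)"
      using Suc by (intro integral_mono integrable_K[OF bG]) (auto simp: space_K)
    then show ?case using w[of x] GS[of n x] GS[of "Suc n" x] by (simp add: divide_right_mono)
  qed
  define g where "g x = lim (\<lambda>n. G n x)" for x
  have lim: "(\<lambda>n. G n x) \<longlonglongrightarrow> g x" if x: "x \<in> space M" for x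
  proof -
    have "incseq (\<lambda>n. G n x)" by (rule incseq_SucI) (rule G_mono[OF x])
    moreover have "G n x \<le> C" for n using bounded_byD(2)[OF bG x, of n] by simp
    ultimately have "convergent (\<lambda>n. G n x)"
      by (metis convergentI incseq_convergent)
    then show ?thesis unfolding g_def by (simp add: convergent_LIMSEQ_iff)
  qed
  have bg: "bounded_by C g"
  proof (rule bounded_byI)
    show "g \<in> borel_measurable M" using lim mG by (rule borel_measurable_LIMSEQ_real)
    fix x assume x: "x \<in> space M"
    show "\<bar>g x\<bar> \<le> C"
      by (rule tendsto_upperbound[OF tendsto_rabs[OF lim[OF x]]]) (use bounded_byD(2)[OF bG x] in auto)
  qed
  have eq: "(\<integral>y. g y \<partial>K x) + 1 = weight a l x * g x" if x: "x \<in> space M" for x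
  proof -
    have "(\<lambda>n. \<integral>y. G n y \<partial>K x) \<longlonglongrightarrow> (\<integral>y. g y \<partial>K x)"
      by (rule tendsto_integral_K[OF lim bG bg x])
    then have "(\<lambda>n. G (Suc n) x) \<longlonglongrightarrow> ((\<integral>y. g y \<partial>K x) + 1) / weight a l x"
      unfolding GS using w[of x] by (intro tendsto_intros) auto
    with LIMSEQ_Suc[OF lim[OF x]] have "g x = ((\<integral>y. g y \<partial>K x) + 1) / weight a l x"
      by (rule LIMSEQ_unique)
    then show ?thesis using w[of x] by (simp add: field_simps)
  qed
  have nonneg: "0 \<le> g x" if x: "x \<in> space M" for x
    by (rule tendsto_lowerbound[OF lim[OF x]]) (use G_nonneg[OF x] in auto)
  show ?thesis
  proof (rule that)
    show "supersolution a l C g" unfolding supersolution_def using bg eq nonneg by simp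
    show "g x \<le> g' x" if "supersolution a l C' g'" "x \<in> space M" for C' g' x
      by (rule tendsto_upperbound[OF lim[OF that(2)]]) (use G_le[OF that] in auto)
  qed (rule eq)
qed

end


section \<open>The principal eigenfunction\<close>

context doeblin_functional
begin

text \<open>The minorisation spreads the mass of a nonnegative eigenfunction over the whole space. A
  truncation of the geometric series is required because \<open>P\<close> may multiply \<open>\<phi>\<close> by more than
  \<open>e\<close>.\<close>

lemma eigenfunction_lower_bound:
  assumes \<phi>: "bounded_by B \<phi>" and nonneg: "\<And>x. x \<in> space M \<Longrightarrow> 0 \<le> \<phi> x"
    and sub: "\<And>x. x \<in> space M \<Longrightarrow> (\<integral>y. \<phi> y \<partial>K x) \<le> W * \<phi> x" and W: "0 \<le> W"
    and pos: "0 < (\<integral>y. \<phi> y \<partial>\<nu>)"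
  shows "\<exists>c>0. \<forall>x\<in>space M. c \<le> \<phi> x"
proof -
  obtain z where z: "z \<in> space M" using space_nonempty by auto
  have B: "0 \<le> B" using bounded_byD(2)[OF \<phi> z] by linarith
  have iter: "(\<integral>y. \<phi> y \<partial>iterate_kernel M K n x) \<le> W ^ n * \<phi> x" if x: "x \<in> space M" for n x
  proof (induction n)
    case 0
    have "(\<integral>y. \<phi> y \<partial>iterate_kernel M K 0 x) = \<phi> x"
      using bounded_byD(1)[OF \<phi>] x by (simp add: integral_return)
    then show ?case by simp
  next
    case (Suc n)
    have "(\<integral>y. \<phi> y \<partial>iterate_kernel M K (Suc n) x) = (\<integral>z. (\<integral>y. \<phi> y \<partial>K z) \<partial>iterate_kernel M K n x)"
      by (rule integral_iterate_Suc[OF bounded_byD[OF \<phi>] x])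
    also have "\<dots> \<le> (\<integral>z. W * \<phi> z \<partial>iterate_kernel M K n x)"
    proof (rule integral_mono)
      show "integrable (iterate_kernel M K n x) (\<lambda>z. \<integral>y. \<phi> y \<partial>K z)"
        by (rule integral_iterate_bound(1)[OF bounded_byD[OF bounded_by_K[OF \<phi>]] x])
      show "integrable (iterate_kernel M K n x) (\<lambda>z. W * \<phi> z)"
        using integral_iterate_bound(1)[OF bounded_byD[OF \<phi>] x] by simp
      fix y assume "y \<in> space (iterate_kernel M K n x)"
      then show "(\<integral>z. \<phi> z \<partial>K y) \<le> W * \<phi> y" by (intro sub) (simp add: iterate_kernel_props(3)[OF x])
    qed
    also have "\<dots> \<le> W * (W ^ n * \<phi> x)" using Suc W by (simp add: mult_left_mono)
    finally show ?case by (simp add: mult.assoc)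
  qed
  define d where "d = \<epsilon> * (\<integral>y. \<phi> y \<partial>\<nu>)"
  have d: "0 < d" unfolding d_def using pos eps_pos by simp
  \<comment> \<open>the tail of the geometric series beyond \<open>N\<close> carries at most half of \<open>\<epsilon> \<nu>(\<phi>)\<close>\<close>
  have "(\<lambda>N. B * exp (-1) ^ N) \<longlonglongrightarrow> B * 0"
    by (intro tendsto_intros LIMSEQ_power_zero) simp
  then have "eventually (\<lambda>N. B * exp (-1) ^ N < d / 2) sequentially"
    using d by (intro order_tendstoD(2)) auto
  then obtain N where N: "B * exp (-1) ^ N < d / 2" by (auto simp: eventually_sequentially)
  define S where "S = (\<Sum>n<N. W ^ n) + 1"
  have S: "0 < S" unfolding S_def using W by (intro add_nonneg_pos sum_nonneg) auto
  have "d / 2 / S \<le> \<phi> x" if x: "x \<in> space M" for x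
  proof -
    interpret R: prob_space "Res x" by (rule prob_space_Res[OF x])
    let ?p = "\<lambda>n. (1 - exp (-1)) * exp (- real n)"
    have p: "0 \<le> ?p n" "?p n \<le> 1" for n by (auto intro!: mult_le_one)
    have "exp (- real n) = exp (-1) ^ n" for n by (simp add: exp_of_nat_mult[symmetric])
    then have psum: "(\<Sum>n<N. ?p n) = 1 - exp (-1) ^ N" for N
      by (induction N) (simp_all add: algebra_simps)
    have I: "(\<integral>y. B - \<phi> y \<partial>iterate_kernel M K n x) = B - (\<integral>y. \<phi> y \<partial>iterate_kernel M K n x)" for n
    proof -
      interpret It: prob_space "iterate_kernel M K n x" by (rule iterate_kernel_props(1)[OF x])
      show ?thesis
        using integral_iterate_bound(1)[OF bounded_byD[OF \<phi>] x, of n] It.prob_space by simp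
    qed
    have "(\<lambda>n. ?p n * (\<integral>y. B - \<phi> y \<partial>iterate_kernel M K n x)) sums (\<integral>y. B - \<phi> y \<partial>Res x)"
    proof (rule integral_Res_sums[OF _ _ x])
      show "(\<lambda>y. B - \<phi> y) \<in> borel_measurable M" using bounded_byD(1)[OF \<phi>] by simp
      show "\<bar>B - \<phi> y\<bar> \<le> 2 * B" if "y \<in> space M" for y using bounded_byD(2)[OF \<phi> that] by linarith
    qed
    then have sums: "(\<lambda>n. ?p n * (B - (\<integral>y. \<phi> y \<partial>iterate_kernel M K n x))) sums (\<integral>y. B - \<phi> y \<partial>Res x)"
      unfolding I .
    have "(\<Sum>n<N. ?p n * (B - (\<integral>y. \<phi> y \<partial>iterate_kernel M K n x))) \<le> (\<integral>y. B - \<phi> y \<partial>Res x)"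
      unfolding sums_unique[OF sums]
    proof (rule sum_le_suminf[OF sums_summable[OF sums]])
      show "0 \<le> ?p n * (B - (\<integral>y. \<phi> y \<partial>iterate_kernel M K n x))" for n
      proof (rule mult_nonneg_nonneg[OF p(1)])
        have "\<bar>\<integral>y. \<phi> y \<partial>iterate_kernel M K n x\<bar> \<le> B"
          by (rule integral_iterate_bound(2)[OF bounded_byD[OF \<phi>] x])
        then show "0 \<le> B - (\<integral>y. \<phi> y \<partial>iterate_kernel M K n x)" by simp
      qed
    qed simp
    also have "\<dots> = B - (\<integral>y. \<phi> y \<partial>Res x)"
      using integral_Res_bound(1)[OF bounded_byD[OF \<phi>] x] R.prob_space by simp
    also have "\<dots> \<le> B - d"
      using minorised_integral[OF bounded_byD[OF \<phi>] nonneg x] unfolding d_def by simp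
    finally have "B * (\<Sum>n<N. ?p n) - (\<Sum>n<N. ?p n * (\<integral>y. \<phi> y \<partial>iterate_kernel M K n x)) \<le> B - d"
      by (simp add: right_diff_distrib sum_subtractf sum_distrib_left mult_ac)
    then have "d - B * exp (-1) ^ N \<le> (\<Sum>n<N. ?p n * (\<integral>y. \<phi> y \<partial>iterate_kernel M K n x))"
      unfolding psum by (simp add: algebra_simps)
    also have "\<dots> \<le> (\<Sum>n<N. 1 * (W ^ n * \<phi> x))"
      using p iter[OF x] W nonneg[OF x] by (intro sum_mono mult_mono') (auto intro!: Bochner_Integration.integral_nonneg simp: iterate_kernel_props(3)[OF x] nonneg)
    also have "\<dots> = (\<Sum>n<N. W ^ n) * \<phi> x" by (simp add: sum_distrib_right)
    also have "\<dots> \<le> S * \<phi> x" unfolding S_def using nonneg[OF x] by (intro mult_right_mono) auto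
    finally show ?thesis using N S by (simp add: field_simps)
  qed
  then show ?thesis using d S by (intro exI[of _ "d / 2 / S"]) auto
qed

text \<open>With \<open>k = ratio a l\<close> the eigenvalue equation \<open>P f = weight a l f\<close> reads
  \<open>(e - P) f = (e - 1) k f\<close>, that is \<open>f = R (k f)\<close>. Unlike the weight, \<open>k\<close> may change sign.\<close>

definition ratio :: "real \<Rightarrow> real \<Rightarrow> 'a \<Rightarrow> real" where
  "ratio a l x = (exp 1 - weight a l x) / (exp 1 - 1)"

lemma weight_ratio: "exp 1 - (exp 1 - 1) * ratio a l x = weight a l x"
  unfolding ratio_def by (simp add: field_simps)

definition ratio_bound :: "real \<Rightarrow> real" where
  "ratio_bound b = max (exp 1 - exp (- b)) (exp (2 * b) - exp 1) / (exp 1 - 1)"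

lemma e_gt_1: "1 < exp (1::real)"
  by simp

lemma ratio_bound_nonneg: "0 \<le> b \<Longrightarrow> 0 \<le> ratio_bound b"
  unfolding ratio_bound_def using e_gt_1 by (intro divide_nonneg_pos max.coboundedI1) auto

lemma bounded_by_ratio:
  assumes "\<bar>a\<bar> \<le> b" "1 \<le> l" "l \<le> exp b"
  shows "bounded_by (ratio_bound b) (ratio a l)"
proof (rule bounded_byI)
  show "ratio a l \<in> borel_measurable M"
    unfolding ratio_def[abs_def] using bounded_byD(1)[OF bounded_by_weight] by simp
  fix x assume x: "x \<in> space M"
  have "1 * exp (- b) \<le> weight a l x"
    unfolding weight_def using exp_F_bounds(1)[OF x, of a] assms
    by (intro mult_mono) (auto intro: order_trans[of "exp (-b)" "exp (-\<bar>a\<bar>)"])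
  moreover have "weight a l x \<le> exp b * exp b"
    unfolding weight_def using exp_F_bounds(2)[OF x, of a] assms
    by (intro mult_mono) (auto intro: order_trans[of _ "exp \<bar>a\<bar>" "exp b"])
  ultimately have "\<bar>exp 1 - weight a l x\<bar> \<le> max (exp 1 - exp (- b)) (exp (2 * b) - exp 1)"
    by (auto simp: exp_add[symmetric] abs_le_iff le_max_iff_disj)
  then show "\<bar>ratio a l x\<bar> \<le> ratio_bound b"
    unfolding ratio_def ratio_bound_def using e_gt_1 by (simp add: divide_right_mono)
qed

lemma ratio_diff:
  "bounded_by (\<bar>l - l'\<bar> * exp \<bar>a\<bar> / (exp 1 - 1)) (\<lambda>x. ratio a l x - ratio a l' x)"
proof -
  have "ratio a l x - ratio a l' x = ((l' - l) / (exp 1 - 1)) * exp (- a * F x)" for x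
    unfolding ratio_def weight_def by (simp add: diff_divide_distrib[symmetric] algebra_simps)
  then show ?thesis
    using bounded_by_cmult[OF bounded_by_exp_F, of "(l' - l) / (exp 1 - 1)" a] e_gt_1
    by (simp add: abs_minus_commute)
qed

lemma radius_le_b: "\<bar>a\<bar> < b \<Longrightarrow> radius a < exp b"
  using radius_le_exp[of a] by (smt (verit) exp_less_cancel_iff)

text \<open>Above the growth rate the minimal solution \<open>g\<close> is a multiple of a solution \<open>h\<close> of the
  fixed-point equation \<open>h = 1 + Q (k h)\<close>, a contraction, so \<open>h\<close> stays bounded; the normalisation
  \<open>\<sigma>\<close> has to blow up because a bounded \<open>g\<close> would allow \<open>l\<close> to be lowered past the growth
  rate.\<close>

lemma normalised_solution:
  assumes b: "(1 - \<epsilon>) * ratio_bound b < 1" and a: "\<bar>a\<bar> < b" and l: "radius a < l" "l \<le> exp b"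
  defines "\<theta> \<equiv> (1 - \<epsilon>) * ratio_bound b"
  obtains h \<sigma> where "\<sigma> \<noteq> 0" "bounded_by (1 / (1 - \<theta>)) h"
    "\<And>x. x \<in> space M \<Longrightarrow> h x = 1 + Q (\<lambda>y. ratio a l y * h y) x"
    "\<epsilon> * (\<integral>y. ratio a l y * h y \<partial>\<nu>) = 1 - 1 / ((exp 1 - 1) * \<sigma>)"
    "\<bar>1 / \<sigma>\<bar> \<le> 2 * exp \<bar>a\<bar> * (l - radius a) / (1 - \<theta>)"
    "\<And>x. x \<in> space M \<Longrightarrow> (\<integral>y. h y \<partial>K x) + 1 / \<sigma> = weight a l x * h x"
    "\<And>x. x \<in> space M \<Longrightarrow> 0 \<le> \<sigma> * h x"
    "\<And>C' g' x. supersolution a l C' g' \<Longrightarrow> x \<in> space M \<Longrightarrow> \<sigma> * h x \<le> g' x"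
proof -
  obtain C g where g: "supersolution a l C g"
    and eq: "\<And>x. x \<in> space M \<Longrightarrow> (\<integral>y. g y \<partial>K x) + 1 = weight a l x * g x"
    and min: "\<And>C' g' x. supersolution a l C' g' \<Longrightarrow> x \<in> space M \<Longrightarrow> g x \<le> g' x"
    using minimal_solution[OF l(1)] by blast
  have bg: "bounded_by C g" using g unfolding supersolution_def by simp
  let ?k = "ratio a l" and ?m = "exp 1 - 1 :: real"
  have m: "0 < ?m" using e_gt_1 by simp
  have bk: "bounded_by (ratio_bound b) ?k"
    using a l radius_ge_1[of a] by (intro bounded_by_ratio) auto
  have b0: "0 \<le> ratio_bound b" using a by (intro ratio_bound_nonneg) simp
  have \<theta>: "\<theta> < 1" using b unfolding \<theta>_def .
  note bkg = bounded_by_mult[OF bk bg]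
  define \<sigma> where "\<sigma> = 1 / ?m + \<epsilon> * (\<integral>y. ?k y * g y \<partial>\<nu>)"
  have gQ: "g x = Q (\<lambda>y. ?k y * g y) x + \<sigma>" if x: "x \<in> space M" for x
  proof -
    interpret R: prob_space "Res x" by (rule prob_space_Res[OF x])
    have "?m * g x = (\<integral>y. exp 1 * g y - (\<integral>z. g z \<partial>K y) \<partial>Res x)"
      by (rule resolvent_equation[OF bounded_byD[OF bg] x, symmetric])
    also have "\<dots> = (\<integral>y. ?m * (?k y * g y) + 1 \<partial>Res x)"
    proof (rule Bochner_Integration.integral_cong[OF refl])
      fix y assume "y \<in> space (Res x)"
      then have "(\<integral>z. g z \<partial>K y) + 1 = weight a l y * g y" using eq[of y] x by simp
      then show "exp 1 * g y - (\<integral>z. g z \<partial>K y) = ?m * (?k y * g y) + 1"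
        unfolding weight_ratio[symmetric] by (simp add: algebra_simps)
    qed
    also have "\<dots> = ?m * (\<integral>y. ?k y * g y \<partial>Res x) + 1"
      using integral_Res_bound(1)[OF bounded_byD[OF bkg] x] R.prob_space by simp
    finally show ?thesis using m unfolding Q_def \<sigma>_def by (simp add: field_simps)
  qed
  have bg\<sigma>: "bounded_by (\<bar>\<sigma>\<bar> / (1 - \<theta>)) g"
  proof (rule bounded_by_contraction[OF bg \<theta>])
    fix D :: real assume D: "0 \<le> D" "bounded_by D g"
    show "bounded_by (\<theta> * D + \<bar>\<sigma>\<bar>) g"
    proof (rule bounded_byI[OF bounded_byD(1)[OF bg]])
      fix x assume x: "x \<in> space M"
      have "\<bar>g x\<bar> \<le> \<bar>Q (\<lambda>y. ?k y * g y) x\<bar> + \<bar>\<sigma>\<bar>" unfolding gQ[OF x] by (rule abs_triangle_ineq)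
      also have "\<bar>Q (\<lambda>y. ?k y * g y) x\<bar> \<le> (1 - \<epsilon>) * (ratio_bound b * D)"
        by (rule bounded_byD(2)[OF bounded_by_Q[OF bounded_by_mult[OF bk D(2)]] x])
      finally show "\<bar>g x\<bar> \<le> \<theta> * D + \<bar>\<sigma>\<bar>" unfolding \<theta>_def by (simp add: mult.assoc)
    qed
  qed
  obtain z where z: "z \<in> space M" using space_nonempty by auto
  have gz: "g z \<noteq> 0" using supersolutionD(5)[OF g z] by auto
  have \<sigma>: "\<sigma> \<noteq> 0"
  proof
    assume "\<sigma> = 0"
    then show False using bounded_byD(2)[OF bg\<sigma> z] gz by simp
  qed
  define C' where "C' = \<bar>\<sigma>\<bar> / (1 - \<theta>)"
  have C': "0 < C'" unfolding C'_def using \<sigma> \<theta> by simp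
  have "supersolution a l C' g" using g bg\<sigma> unfolding supersolution_def C'_def by simp
  from radius_le[OF supersolution_improve[OF this C']]
  have "exp (- \<bar>a\<bar>) / (2 * C') \<le> l - radius a" by simp
  then have "1 / C' \<le> 2 * exp \<bar>a\<bar> * (l - radius a)" using C' by (simp add: exp_minus field_simps)
  then have \<sigma>b: "\<bar>1 / \<sigma>\<bar> \<le> 2 * exp \<bar>a\<bar> * (l - radius a) / (1 - \<theta>)"
    unfolding C'_def using \<theta> by (simp add: field_simps)
  define h where "h x = g x / \<sigma>" for x
  have gh: "g x = \<sigma> * h x" for x unfolding h_def using \<sigma> by simp
  have hg: "h = (\<lambda>x. (1 / \<sigma>) * g x)" unfolding h_def by auto
  show ?thesis
  proof (rule that[OF \<sigma>])
    show "bounded_by (1 / (1 - \<theta>)) h"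
      unfolding hg using bounded_by_cmult[OF bg\<sigma>, of "1 / \<sigma>"] \<sigma> by (simp add: abs_divide)
    show "h x = 1 + Q (\<lambda>y. ?k y * h y) x" if x: "x \<in> space M" for x
    proof -
      have "Q (\<lambda>y. ?k y * h y) x = Q (\<lambda>y. (1 / \<sigma>) * (?k y * g y) + 0 * (?k y * g y)) x"
        by (rule Q_cong) (auto simp: h_def x)
      also have "\<dots> = Q (\<lambda>y. ?k y * g y) x / \<sigma>" by (subst Q_lin[OF bkg bkg x]) simp
      finally show ?thesis using gQ[OF x] \<sigma> unfolding h_def by (simp add: field_simps)
    qed
    have "(\<integral>y. ?k y * h y \<partial>\<nu>) = (\<integral>y. ?k y * g y \<partial>\<nu>) / \<sigma>" unfolding h_def by simp
    then have "\<epsilon> * (\<integral>y. ?k y * h y \<partial>\<nu>) = (\<sigma> - 1 / ?m) / \<sigma>" by (simp add: \<sigma>_def)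
    then show "\<epsilon> * (\<integral>y. ?k y * h y \<partial>\<nu>) = 1 - 1 / (?m * \<sigma>)"
      using \<sigma> by (simp add: diff_divide_distrib)
    show "(\<integral>y. h y \<partial>K x) + 1 / \<sigma> = weight a l x * h x" if x: "x \<in> space M" for x
      using eq[OF x] \<sigma> unfolding h_def by (simp add: field_simps)
    show "0 \<le> \<sigma> * h x" if x: "x \<in> space M" for x
      using supersolutionD(1)[OF g x] unfolding gh .
    show "\<sigma> * h x \<le> g' x" if "supersolution a l C' g'" "x \<in> space M" for C' g' x
      using min[OF that] unfolding gh .
  qed (rule \<sigma>b)
qed

text \<open>The difference of two solutions solves the first equation with the source
  \<open>Q ((k - k') h')\<close> in place of \<open>1\<close>.\<close>

lemma fixed_point_diff:
  assumes b: "(1 - \<epsilon>) * \<kappa> < 1" "0 \<le> \<kappa>" and \<delta>: "0 \<le> \<delta>"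
    and k: "bounded_by \<kappa> k" "bounded_by \<kappa> k'" "bounded_by \<delta> (\<lambda>x. k x - k' x)"
    and h: "bounded_by B h" "bounded_by B h'"
      "\<And>x. x \<in> space M \<Longrightarrow> h x = 1 + Q (\<lambda>y. k y * h y) x"
      "\<And>x. x \<in> space M \<Longrightarrow> h' x = 1 + Q (\<lambda>y. k' y * h' y) x"
  shows "bounded_by ((1 - \<epsilon>) * (\<delta> * B) / (1 - (1 - \<epsilon>) * \<kappa>)) (\<lambda>x. h x - h' x)"
proof (rule bounded_by_contraction[OF bounded_by_diff[OF h(1,2)] b(1)])
  fix C :: real assume C: "0 \<le> C" "bounded_by C (\<lambda>x. h x - h' x)"
  have bd: "bounded_by (\<kappa> * C + \<delta> * B) (\<lambda>y. k y * (h y - h' y) + (k y - k' y) * h' y)"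
    by (intro bounded_by_add bounded_by_mult k C h)
  have "h x - h' x = Q (\<lambda>y. k y * (h y - h' y) + (k y - k' y) * h' y) x" if x: "x \<in> space M" for x
  proof -
    have "Q (\<lambda>y. k y * (h y - h' y) + (k y - k' y) * h' y) x = Q (\<lambda>y. 1 * (k y * h y) + (-1) * (k' y * h' y)) x"
      by (rule Q_cong) (auto simp: algebra_simps x)
    also have "\<dots> = Q (\<lambda>y. k y * h y) x - Q (\<lambda>y. k' y * h' y) x"
      by (subst Q_lin[OF bounded_by_mult[OF k(1) h(1)] bounded_by_mult[OF k(2) h(2)] x]) simp
    finally show ?thesis using h(3)[OF x] h(4)[OF x] by simp
  qed
  then have "bounded_by ((1 - \<epsilon>) * (\<kappa> * C + \<delta> * B)) (\<lambda>x. h x - h' x)"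
    using bounded_by_Q[OF bd] bounded_byD(1)[OF C(2)] unfolding bounded_by_def by simp
  then show "bounded_by ((1 - \<epsilon>) * \<kappa> * C + (1 - \<epsilon>) * (\<delta> * B)) (\<lambda>x. h x - h' x)"
    by (simp add: algebra_simps)
qed

end


context doeblin_functional
begin

lemma uniform_limit_of_bound:
  fixes u :: "'c \<Rightarrow> 'a \<Rightarrow> real"
  assumes "eventually (\<lambda>j. \<forall>x\<in>X. \<bar>u j x - v x\<bar> \<le> e j) G" "(e \<longlongrightarrow> 0) G"
  shows "uniform_limit X u v G"
proof (rule uniform_limitI)
  fix d :: real assume "0 < d"
  then have "eventually (\<lambda>j. e j < d) G" using assms(2) by (intro order_tendstoD(2)) auto
  with assms(1) show "eventually (\<lambda>j. \<forall>x\<in>X. dist (u j x) (v x) < d) G"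
    by eventually_elim (force simp: dist_real_def)
qed

text \<open>The solutions \<open>h\<close> converge uniformly as \<open>l\<close> decreases to the growth rate, and since
  \<open>1 / \<sigma> \<longlonglongrightarrow> 0\<close> the limit is an eigenfunction. It has one sign because all the
  \<open>h\<close> do. The weighted functional \<open>L (e\<^sup>-\<^sup>a\<^sup>F f)\<close> is nonzero because the growth rate is a simple
  pole: applying \<open>L\<close> to \<open>(w - P) g = 1 - (l - r) e\<^sup>-\<^sup>a\<^sup>F g\<close> gives
  \<open>1 = (l - r) L (e\<^sup>-\<^sup>a\<^sup>F g)\<close>, while \<open>(l - r) g\<close> stays bounded by comparison with the
  supersolution \<open>f / (l - r)\<close>.\<close>

proposition principal_eigenfunction:
  assumes b: "(1 - \<epsilon>) * ratio_bound b < 1" and a: "\<bar>a\<bar> < b"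
  obtains f B c where "bounded_by B f" "0 < c" "\<And>x. x \<in> space M \<Longrightarrow> c \<le> f x"
    "\<And>x. x \<in> space M \<Longrightarrow> (\<integral>y. f y \<partial>K x) = weight a (radius a) x * f x"
    "(\<integral>y. ratio a (radius a) y * f y \<partial>\<nu>) \<noteq> 0"
    "L (ratio a (radius a)) (\<lambda>x. exp (- a * F x) * f x) \<noteq> 0"
proof -
  define r where "r = radius a"
  define \<theta> where "\<theta> = (1 - \<epsilon>) * ratio_bound b"
  define \<kappa> where "\<kappa> = ratio_bound b"
  let ?m = "exp 1 - 1 :: real"
  have m: "0 < ?m" using e_gt_1 by simp
  have \<theta>: "\<theta> < 1" using b unfolding \<theta>_def .
  have \<kappa>0: "0 \<le> \<kappa>" unfolding \<kappa>_def using a by (intro ratio_bound_nonneg) simp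
  have \<kappa>1: "(1 - \<epsilon>) * \<kappa> < 1" using b unfolding \<kappa>_def .
  have r1: "1 \<le> r" unfolding r_def by (rule radius_ge_1)
  have rb: "r < exp b" unfolding r_def by (rule radius_le_b[OF a])
  define l where "l n = r + (exp b - r) / real (Suc n)" for n
  have l: "r < l n" "l n \<le> exp b" for n
  proof -
    show "r < l n" unfolding l_def using rb by simp
    have "(exp b - r) / real (Suc n) \<le> (exp b - r) / 1" using rb by (intro divide_left_mono) auto
    then show "l n \<le> exp b" unfolding l_def by simp
  qed
  have "(\<lambda>n. (exp b - r) * inverse (real (Suc n))) \<longlonglongrightarrow> (exp b - r) * 0"
    by (intro tendsto_intros LIMSEQ_inverse_real_of_nat)
  then have "(\<lambda>n. r + (exp b - r) / real (Suc n)) \<longlonglongrightarrow> r + 0"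
    by (intro tendsto_add tendsto_const) (simp add: divide_inverse)
  then have l_lim: "l \<longlonglongrightarrow> r" unfolding l_def by simp
  define k where "k n = ratio a (l n)" for n
  define k0 where "k0 = ratio a r"
  have bk: "bounded_by \<kappa> (k n)" for n
    unfolding k_def \<kappa>_def using l[of n] r1 a by (intro bounded_by_ratio) auto
  have bk0: "bounded_by \<kappa> k0"
    unfolding k0_def \<kappa>_def using r1 rb a by (intro bounded_by_ratio) auto
  define good where "good n h \<sigma> \<longleftrightarrow> \<sigma> \<noteq> 0 \<and> bounded_by (1 / (1 - \<theta>)) h \<and>
    (\<forall>x\<in>space M. h x = 1 + Q (\<lambda>y. k n y * h y) x) \<and>
    \<epsilon> * (\<integral>y. k n y * h y \<partial>\<nu>) = 1 - 1 / (?m * \<sigma>) \<and>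
    \<bar>1 / \<sigma>\<bar> \<le> 2 * exp \<bar>a\<bar> * (l n - r) / (1 - \<theta>) \<and>
    (\<forall>x\<in>space M. (\<integral>y. h y \<partial>K x) + 1 / \<sigma> = weight a (l n) x * h x) \<and>
    (\<forall>x\<in>space M. 0 \<le> \<sigma> * h x) \<and>
    (\<forall>C' g' x. supersolution a (l n) C' g' \<longrightarrow> x \<in> space M \<longrightarrow> \<sigma> * h x \<le> g' x)" for n h \<sigma>
  have "\<exists>h \<sigma>. good n h \<sigma>" for n
  proof (rule normalised_solution[OF b a l(1)[of n, unfolded r_def] l(2)[of n]], fold k_def r_def \<theta>_def)
    fix \<sigma> h
    assume "\<sigma> \<noteq> 0" "bounded_by (1 / (1 - \<theta>)) h"
      "\<And>x. x \<in> space M \<Longrightarrow> h x = 1 + Q (\<lambda>y. k n y * h y) x"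
      "\<epsilon> * (\<integral>y. k n y * h y \<partial>\<nu>) = 1 - 1 / (?m * \<sigma>)"
      "\<bar>1 / \<sigma>\<bar> \<le> 2 * exp \<bar>a\<bar> * (l n - r) / (1 - \<theta>)"
      "\<And>x. x \<in> space M \<Longrightarrow> (\<integral>y. h y \<partial>K x) + 1 / \<sigma> = weight a (l n) x * h x"
      "\<And>x. x \<in> space M \<Longrightarrow> 0 \<le> \<sigma> * h x"
      "\<And>C' g' x. supersolution a (l n) C' g' \<Longrightarrow> x \<in> space M \<Longrightarrow> \<sigma> * h x \<le> g' x"
    then have "good n h \<sigma>"
      unfolding good_def by (intro conjI ballI allI impI)
    then show ?thesis by blast
  qed
  then obtain h \<sigma> where good: "\<And>n. good n (h n) (\<sigma> n)" by metis
  have \<sigma>: "\<And>n. \<sigma> n \<noteq> 0" and bh: "\<And>n. bounded_by (1 / (1 - \<theta>)) (h n)"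
    and hQ: "\<And>n x. x \<in> space M \<Longrightarrow> h n x = 1 + Q (\<lambda>y. k n y * h n y) x"
    and h\<nu>: "\<And>n. \<epsilon> * (\<integral>y. k n y * h n y \<partial>\<nu>) = 1 - 1 / (?m * \<sigma> n)"
    and \<sigma>b: "\<And>n. \<bar>1 / \<sigma> n\<bar> \<le> 2 * exp \<bar>a\<bar> * (l n - r) / (1 - \<theta>)"
    and hK: "\<And>n x. x \<in> space M \<Longrightarrow> (\<integral>y. h n y \<partial>K x) + 1 / \<sigma> n = weight a (l n) x * h n x"
    and h_sign: "\<And>n x. x \<in> space M \<Longrightarrow> 0 \<le> \<sigma> n * h n x"
    and h_min: "\<And>n C' g' x. supersolution a (l n) C' g' \<Longrightarrow> x \<in> space M \<Longrightarrow> \<sigma> n * h n x \<le> g' x"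
    using good unfolding good_def by blast+
  define B where "B = 1 / (1 - \<theta>)"
  note bh = bh[folded B_def]
  have B0: "0 < B" unfolding B_def using \<theta> by simp

  have \<sigma>_lim: "(\<lambda>n. 1 / \<sigma> n) \<longlonglongrightarrow> 0"
  proof (rule Lim_null_comparison)
    show "eventually (\<lambda>n. norm (1 / \<sigma> n) \<le> 2 * exp \<bar>a\<bar> * (l n - r) / (1 - \<theta>)) sequentially"
      using \<sigma>b by simp
    have "(\<lambda>n. 2 * exp \<bar>a\<bar> * (l n - r) / (1 - \<theta>)) \<longlonglongrightarrow> 2 * exp \<bar>a\<bar> * (r - r) / (1 - \<theta>)"
      using \<theta> by (intro tendsto_intros l_lim) auto
    then show "(\<lambda>n. 2 * exp \<bar>a\<bar> * (l n - r) / (1 - \<theta>)) \<longlonglongrightarrow> 0" by simp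
  qed

  define E where "E = (1 - \<epsilon>) * (exp \<bar>a\<bar> / ?m * B) / (1 - (1 - \<epsilon>) * \<kappa>)"
  have E0: "0 \<le> E"
    unfolding E_def using eps_le_1 \<kappa>1 B0 m by (intro divide_nonneg_pos mult_nonneg_nonneg) auto
  have cauchy: "bounded_by (\<bar>l i - l j\<bar> * E) (\<lambda>x. h i x - h j x)" for i j
  proof -
    have "bounded_by ((1 - \<epsilon>) * (\<bar>l i - l j\<bar> * exp \<bar>a\<bar> / ?m * B) / (1 - (1 - \<epsilon>) * \<kappa>)) (\<lambda>x. h i x - h j x)"
    proof (rule fixed_point_diff[OF \<kappa>1 \<kappa>0 _ bk bk _ bh bh hQ hQ])
      show "0 \<le> \<bar>l i - l j\<bar> * exp \<bar>a\<bar> / ?m" using m by simp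
      show "bounded_by (\<bar>l i - l j\<bar> * exp \<bar>a\<bar> / ?m) (\<lambda>x. k i x - k j x)"
        unfolding k_def by (rule ratio_diff)
    qed
    then show ?thesis unfolding E_def by (simp add: mult_ac)
  qed
  have "uniformly_Cauchy_on (space M) h"
    unfolding uniformly_Cauchy_on_def
  proof (intro allI impI)
    fix d :: real assume d: "0 < d"
    have "Cauchy l" using l_lim by (rule LIMSEQ_imp_Cauchy)
    then obtain N where N: "\<And>i j. N \<le> i \<Longrightarrow> N \<le> j \<Longrightarrow> dist (l i) (l j) < d / (E + 1)"
      using d E0 unfolding Cauchy_def by (meson add_nonneg_pos divide_pos_pos zero_less_one)
    have "dist (h i x) (h j x) < d" if "x \<in> space M" "N \<le> i" "N \<le> j" for x i j
    proof -
      have "dist (h i x) (h j x) \<le> \<bar>l i - l j\<bar> * E"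
        using bounded_byD(2)[OF cauchy that(1), of i j] by (simp add: dist_real_def)
      also have "\<dots> \<le> \<bar>l i - l j\<bar> * (E + 1)" by (intro mult_left_mono) auto
      also have "\<dots> < d" using N[OF that(2,3)] E0 by (simp add: dist_real_def field_simps)
      finally show ?thesis .
    qed
    then show "\<exists>N. \<forall>x\<in>space M. \<forall>i\<ge>N. \<forall>j\<ge>N. dist (h i x) (h j x) < d" by blast
  qed
  then obtain f0 where f0: "uniform_limit (space M) h f0 sequentially"
    using Cauchy_uniformly_convergent unfolding uniformly_convergent_on_def by blast
  have h_lim: "(\<lambda>n. h n x) \<longlonglongrightarrow> f0 x" if "x \<in> space M" for x
    by (rule tendsto_uniform_limitI[OF f0 that])
  have bf0: "bounded_by B f0" by (rule bounded_by_uniform_limit[OF f0 bh])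
  have k_lim: "uniform_limit (space M) k k0 sequentially"
  proof (rule uniform_limit_of_bound[OF always_eventually])
    show "\<forall>n. \<forall>x\<in>space M. \<bar>k n x - k0 x\<bar> \<le> \<bar>l n - r\<bar> * exp \<bar>a\<bar> / ?m"
      unfolding k_def k0_def using bounded_byD(2)[OF ratio_diff] by simp
    have "(\<lambda>n. \<bar>l n - r\<bar> * exp \<bar>a\<bar> / ?m) \<longlonglongrightarrow> \<bar>r - r\<bar> * exp \<bar>a\<bar> / ?m"
      using m by (intro tendsto_intros l_lim) auto
    then show "(\<lambda>n. \<bar>l n - r\<bar> * exp \<bar>a\<bar> / ?m) \<longlonglongrightarrow> 0" by simp
  qed
  have eig0: "(\<integral>y. f0 y \<partial>K x) = weight a r x * f0 x" if x: "x \<in> space M" for x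
  proof -
    have "(\<lambda>n. (\<integral>y. h n y \<partial>K x) + 1 / \<sigma> n) \<longlonglongrightarrow> (\<integral>y. f0 y \<partial>K x) + 0"
      by (intro tendsto_add \<sigma>_lim tendsto_integral_K[OF h_lim bh bf0 x])
    moreover have "(\<lambda>n. weight a (l n) x * h n x) \<longlonglongrightarrow> weight a r x * f0 x"
      unfolding weight_def by (intro tendsto_intros l_lim h_lim[OF x])
    ultimately show ?thesis unfolding hK[OF x] using LIMSEQ_unique by fastforce
  qed
  have norm0: "\<epsilon> * (\<integral>y. k0 y * f0 y \<partial>\<nu>) = 1"
  proof -
    have "uniform_limit (space M) (\<lambda>n x. k n x * h n x) (\<lambda>x. k0 x * f0 x) sequentially"
      by (rule uniform_lim_mult[OF k_lim f0 bounded_by_image[OF bk0] bounded_by_image[OF bf0]])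
    then have "(\<lambda>n. \<epsilon> * (\<integral>y. k n y * h n y \<partial>\<nu>)) \<longlonglongrightarrow> \<epsilon> * (\<integral>y. k0 y * f0 y \<partial>\<nu>)"
      by (intro tendsto_mult tendsto_const tendsto_integral_nu[OF _ _ bounded_by_mult[OF bk0 bf0]])
         (use bounded_by_mult[OF bk bh] in \<open>auto intro!: always_eventually\<close>)
    moreover have "(\<lambda>n. \<epsilon> * (\<integral>y. k n y * h n y \<partial>\<nu>)) \<longlonglongrightarrow> 1 - 0 / ?m"
    proof -
      have "1 - 1 / (?m * \<sigma> n) = 1 - (1 / \<sigma> n) / ?m" for n by simp
      then show ?thesis unfolding h\<nu> using m by (simp only:) (intro tendsto_intros \<sigma>_lim, simp)
    qed
    ultimately show ?thesis using LIMSEQ_unique by fastforce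
  qed
  have same_sign: "0 \<le> f0 x * f0 y" if "x \<in> space M" "y \<in> space M" for x y
  proof (rule tendsto_lowerbound)
    show "(\<lambda>n. h n x * h n y) \<longlonglongrightarrow> f0 x * f0 y" by (intro tendsto_mult h_lim that)
    have "0 \<le> h n x * h n y" for n
    proof -
      have "0 \<le> (\<sigma> n * h n x) * (\<sigma> n * h n y)" by (intro mult_nonneg_nonneg h_sign that)
      also have "\<dots> = (\<sigma> n)\<^sup>2 * (h n x * h n y)" by (simp add: power2_eq_square)
      finally show ?thesis using \<sigma>[of n] by (simp add: zero_le_mult_iff)
    qed
    then show "eventually (\<lambda>n. 0 \<le> h n x * h n y) sequentially" by simp
  qed simp
  define s :: real where "s = (if \<exists>x\<in>space M. 0 < f0 x then 1 else -1)"
  have s: "s \<noteq> 0" "\<bar>s\<bar> = 1" unfolding s_def by auto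
  define f where "f x = s * f0 x" for x
  have f_nonneg: "0 \<le> f x" if x: "x \<in> space M" for x
  proof (cases "\<exists>z\<in>space M. 0 < f0 z")
    case True
    then obtain z where z: "z \<in> space M" "0 < f0 z" by auto
    then show ?thesis using same_sign[OF x z(1)] True unfolding f_def s_def
      by (simp add: zero_le_mult_iff)
  next
    case False
    then have "s = - 1" unfolding s_def by simp
    moreover have "f0 x \<le> 0" using False x by (meson not_le)
    ultimately show ?thesis unfolding f_def by simp
  qed
  have bf: "bounded_by B f"
    unfolding f_def[abs_def] using bounded_by_cmult[OF bf0, of s] s by simp
  have eig: "(\<integral>y. f y \<partial>K x) = weight a r x * f x" if x: "x \<in> space M" for x
    unfolding f_def using eig0[OF x] by simp
  have normf: "(\<integral>y. k0 y * f y \<partial>\<nu>) \<noteq> 0"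
  proof -
    have "(\<integral>y. k0 y * f y \<partial>\<nu>) = s * (\<integral>y. k0 y * f0 y \<partial>\<nu>)"
      unfolding f_def by (simp add: mult.left_commute)
    then show ?thesis using norm0 s by auto
  qed
  have "0 < (\<integral>y. f y \<partial>\<nu>)"
  proof (rule ccontr)
    have "0 \<le> (\<integral>y. f y \<partial>\<nu>)" using f_nonneg by (intro Bochner_Integration.integral_nonneg) simp
    moreover assume "\<not> 0 < (\<integral>y. f y \<partial>\<nu>)"
    ultimately have z: "(\<integral>y. f y \<partial>\<nu>) = 0" by simp
    have "\<bar>\<integral>y. k0 y * f y \<partial>\<nu>\<bar> \<le> (\<integral>y. \<bar>k0 y * f y\<bar> \<partial>\<nu>)" by (rule integral_abs_bound)
    also have "\<dots> \<le> (\<integral>y. \<kappa> * f y \<partial>\<nu>)"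
    proof (rule integral_mono)
      show "integrable \<nu> (\<lambda>y. \<bar>k0 y * f y\<bar>)" by (intro integrable_abs integrable_nu[OF bounded_by_mult[OF bk0 bf]])
      show "integrable \<nu> (\<lambda>y. \<kappa> * f y)" using integrable_nu[OF bf] by simp
      fix y assume "y \<in> space \<nu>"
      then have y: "y \<in> space M" by simp
      show "\<bar>k0 y * f y\<bar> \<le> \<kappa> * f y"
        unfolding abs_mult using f_nonneg[OF y] bounded_byD(2)[OF bk0 y] by (intro mult_mono) auto
    qed
    finally show False using normf z by simp
  qed
  moreover have "(\<integral>y. f y \<partial>K x) \<le> (\<bar>r\<bar> * exp \<bar>a\<bar>) * f x" if x: "x \<in> space M" for x
    unfolding eig[OF x] using bounded_byD(2)[OF bounded_by_weight x, of a r] f_nonneg[OF x]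
    by (intro mult_right_mono) auto
  ultimately obtain c where c: "0 < c" "\<And>x. x \<in> space M \<Longrightarrow> c \<le> f x"
    using eigenfunction_lower_bound[OF bf f_nonneg, of "\<bar>r\<bar> * exp \<bar>a\<bar>"] by auto

  obtain z where z: "z \<in> space M" using space_nonempty by auto
  have fz: "0 < f z" "\<bar>f0 z\<bar> = f z"
    using c(1) c(2)[OF z] s f_nonneg[OF z] unfolding f_def by (auto simp: abs_mult s_def split: if_splits)
  have f0z: "f0 z \<noteq> 0" using fz by auto
  have eigk: "(\<integral>y. f y \<partial>K x) = (exp 1 - (exp 1 - 1) * k0 x) * f x" if "x \<in> space M" for x
    unfolding k0_def weight_ratio using eig[OF that] .
  have L_kills: "L k0 (\<lambda>x. (exp 1 - (exp 1 - 1) * k0 x) * g x - (\<integral>y. g y \<partial>K x)) = 0" if "bounded_by D g" for D g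
    by (rule L_eigen(1)[OF \<kappa>1 \<kappa>0 bk0 bf eigk normf that])
  have L_one: "L k0 (\<lambda>_. 1) = 1"
    by (rule L_eigen(2)[OF \<kappa>1 \<kappa>0 bk0 bf eigk normf])
  let ?e = "\<lambda>x. exp (- a * F x)"
  have be: "bounded_by (exp \<bar>a\<bar> * B) (\<lambda>x. ?e x * h n x)" for n
    by (intro bounded_by_mult bounded_by_exp_F bh)
  have beh0: "bounded_by (exp \<bar>a\<bar> * B) (\<lambda>x. ?e x * f0 x)"
    by (intro bounded_by_mult bounded_by_exp_F bf0)
  have one: "bounded_by 1 (\<lambda>_. 1)" using bounded_by_const[of 1] by simp
  have pole: "(l n - r) * \<sigma> n * L k0 (\<lambda>x. ?e x * h n x) = 1" for n
  proof -
    have "0 = L k0 (\<lambda>x. (exp 1 - (exp 1 - 1) * k0 x) * h n x - (\<integral>y. h n y \<partial>K x))"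
      by (rule L_kills[OF bh, symmetric])
    also have "\<dots> = L k0 (\<lambda>x. (1 / \<sigma> n) * 1 + (- (l n - r)) * (?e x * h n x))"
    proof (rule L_cong[OF \<kappa>1 \<kappa>0])
      fix x assume x: "x \<in> space M"
      have "(\<integral>y. h n y \<partial>K x) = weight a (l n) x * h n x - 1 / \<sigma> n" using hK[OF x, of n] by linarith
      then show "(exp 1 - (exp 1 - 1) * k0 x) * h n x - (\<integral>y. h n y \<partial>K x) =
          (1 / \<sigma> n) * 1 + (- (l n - r)) * (?e x * h n x)"
        unfolding k0_def weight_ratio by (simp add: weight_def algebra_simps)
    qed
    also have "\<dots> = 1 / \<sigma> n - (l n - r) * L k0 (\<lambda>x. ?e x * h n x)"
      by (simp only: L_lin[OF \<kappa>1 \<kappa>0 bk0 one be] L_one)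
    finally show ?thesis using \<sigma>[of n] by (simp add: field_simps)
  qed
  have L_lim: "(\<lambda>n. L k0 (\<lambda>x. ?e x * h n x)) \<longlonglongrightarrow> L k0 (\<lambda>x. ?e x * f0 x)"
  proof (rule tendsto_L[OF \<kappa>1 \<kappa>0 _ _ bk0 _ _ beh0])
    show "uniform_limit (space M) (\<lambda>n x. ?e x * h n x) (\<lambda>x. ?e x * f0 x) sequentially"
      by (rule uniform_lim_mult[OF uniform_limit_const f0 bounded_by_image[OF bounded_by_exp_F] bounded_by_image[OF bf0]])
  qed (use bk0 be in \<open>auto intro: uniform_limit_const\<close>)
  define D where "D = f z * exp \<bar>a\<bar> / c"
  have D: "0 < D" unfolding D_def using fz c by simp
  have bound: "\<bar>h n z\<bar> \<le> D * \<bar>L k0 (\<lambda>x. ?e x * h n x)\<bar>" for n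
  proof -
    define t where "t = (l n - r) * exp (- \<bar>a\<bar>) * c"
    have t: "0 < t" unfolding t_def using l(1)[of n] c by simp
    have "supersolution a (l n) (\<bar>1 / t\<bar> * B) (\<lambda>x. (1 / t) * f x)"
      unfolding supersolution_def
    proof (intro conjI ballI)
      show "bounded_by (\<bar>1 / t\<bar> * B) (\<lambda>x. (1 / t) * f x)" by (rule bounded_by_cmult[OF bf])
      fix x assume x: "x \<in> space M"
      show "0 \<le> (1 / t) * f x" using t f_nonneg[OF x] by simp
      have "t \<le> (l n - r) * ?e x * f x"
        unfolding t_def using l(1)[of n] exp_F_bounds(1)[OF x, of a] c(1) c(2)[OF x] by (intro mult_mono) auto
      then have room: "1 \<le> (l n - r) * ?e x * ((1 / t) * f x)" using t by (simp add: field_simps)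
      have Pf: "(\<integral>y. (1 / t) * f y \<partial>K x) = weight a r x * ((1 / t) * f x)" using eig[OF x] by simp
      have w: "weight a (l n) x = weight a r x + (l n - r) * ?e x"
        unfolding weight_def by (simp add: algebra_simps)
      show "(\<integral>y. (1 / t) * f y \<partial>K x) + 1 \<le> weight a (l n) x * ((1 / t) * f x)"
        unfolding Pf w distrib_right by (rule add_left_mono[OF room])
    qed
    from h_min[OF this z] h_sign[OF z, of n]
    have "\<bar>\<sigma> n\<bar> * \<bar>h n z\<bar> \<le> f z / t" by (simp add: abs_mult[symmetric])
    then have "(l n - r) * (\<bar>\<sigma> n\<bar> * \<bar>h n z\<bar>) \<le> (l n - r) * (f z / t)" using l(1)[of n] by (intro mult_left_mono) auto
    also have "\<dots> = D" unfolding D_def t_def using l(1)[of n] c by (simp add: exp_minus field_simps)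
    finally have *: "(l n - r) * (\<bar>\<sigma> n\<bar> * \<bar>h n z\<bar>) \<le> D" .
    have "\<bar>(l n - r) * \<sigma> n * L k0 (\<lambda>x. ?e x * h n x)\<bar> = 1" unfolding pole by simp
    then have "\<bar>h n z\<bar> = (l n - r) * (\<bar>\<sigma> n\<bar> * \<bar>h n z\<bar>) * \<bar>L k0 (\<lambda>x. ?e x * h n x)\<bar>"
      using l(1)[of n] by (simp add: abs_mult mult_ac)
    also have "\<dots> \<le> D * \<bar>L k0 (\<lambda>x. ?e x * h n x)\<bar>" using * by (intro mult_right_mono) auto
    finally show ?thesis .
  qed
  have "\<bar>f0 z\<bar> \<le> D * \<bar>L k0 (\<lambda>x. ?e x * f0 x)\<bar>"
    by (rule LIMSEQ_le[OF tendsto_rabs[OF h_lim[OF z]] tendsto_mult[OF tendsto_const tendsto_rabs[OF L_lim]]])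
       (use bound in auto)
  then have L0: "L k0 (\<lambda>x. ?e x * f0 x) \<noteq> 0" using f0z by auto
  have "L k0 (\<lambda>x. ?e x * f x) = L k0 (\<lambda>x. s * (?e x * f0 x) + 0 * (?e x * f0 x))"
    unfolding f_def by (simp add: mult_ac)
  also have "\<dots> = s * L k0 (\<lambda>x. ?e x * f0 x)" by (subst L_lin[OF \<kappa>1 \<kappa>0 bk0 beh0 beh0]) simp
  finally have Lf: "L k0 (\<lambda>x. ?e x * f x) \<noteq> 0" using L0 s by simp
  show ?thesis
    by (rule that[OF bf c(1) c(2)]) (use eig normf Lf in \<open>simp_all add: k0_def r_def\<close>)
qed

end


section \<open>Differentiability of the growth rate\<close>

lemma abs_exp_minus_linear_le:
  fixes t :: real
  assumes "\<bar>t\<bar> \<le> 1"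
  shows "\<bar>exp t - 1 - t\<bar> \<le> t\<^sup>2"
proof (cases "0 \<le> t")
  case True
  then show ?thesis using exp_bound[of t, OF True] assms exp_ge_add_one_self[of t] zero_le_power2[of t] by linarith
next
  case False
  define u where "u = - t"
  have u: "0 \<le> u" "t = - u" using False unfolding u_def by auto
  have "1 \<le> (1 + u) * (1 - u + u\<^sup>2)" using u by (simp add: algebra_simps power2_eq_square)
  also have "\<dots> \<le> exp u * (1 - u + u\<^sup>2)"
  proof (rule mult_right_mono[OF exp_ge_add_one_self])
    show "0 \<le> 1 - u + u\<^sup>2" using assms u by simp
  qed
  finally have "exp (- u) * 1 \<le> exp (- u) * (exp u * (1 - u + u\<^sup>2))" by (intro mult_left_mono) auto
  also have "\<dots> = 1 + t + t\<^sup>2" unfolding u(2) mult.assoc[symmetric] exp_add[symmetric] by simp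
  finally have "exp t \<le> 1 + t + t\<^sup>2" unfolding u(2) by simp
  then show ?thesis using exp_ge_add_one_self[of t] zero_le_power2[of t] by linarith
qed

lemma abs_exp_minus_1_le:
  fixes t :: real
  assumes "\<bar>t\<bar> \<le> 1"
  shows "\<bar>exp t - 1\<bar> \<le> 2 * \<bar>t\<bar>"
proof -
  have "t\<^sup>2 = \<bar>t\<bar> * \<bar>t\<bar>" by (simp add: power2_eq_square)
  also have "\<dots> \<le> \<bar>t\<bar> * 1" using assms by (intro mult_left_mono) auto
  finally have "t\<^sup>2 \<le> \<bar>t\<bar>" by simp
  then show ?thesis using abs_exp_minus_linear_le[OF assms] by linarith
qed

context doeblin_functional
begin

lemma abs_mult_F_le: "x \<in> space M \<Longrightarrow> \<bar>h * F x\<bar> \<le> \<bar>h\<bar>"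
  unfolding abs_mult using mult_left_mono[OF abs_F_le, of x "\<bar>h\<bar>"] by simp

lemma exp_F_diff:
  assumes x: "x \<in> space M" and h: "\<bar>a - a0\<bar> \<le> 1"
  shows "\<bar>exp (- a * F x) - exp (- a0 * F x)\<bar> \<le> exp \<bar>a0\<bar> * (2 * \<bar>a - a0\<bar>)"
    and "\<bar>exp (- a * F x) - exp (- a0 * F x) + (a - a0) * (F x * exp (- a0 * F x))\<bar> \<le> exp \<bar>a0\<bar> * (a - a0)\<^sup>2"
proof -
  define t where "t = - (a - a0) * F x"
  have t: "\<bar>t\<bar> \<le> \<bar>a - a0\<bar>" unfolding t_def using abs_mult_F_le[OF x, of "- (a - a0)"] by simp
  then have t1: "\<bar>t\<bar> \<le> 1" using h by simp
  have e: "exp (- a * F x) = exp (- a0 * F x) * exp t" unfolding t_def exp_add[symmetric] by (simp add: algebra_simps)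
  have "exp (- a * F x) - exp (- a0 * F x) = exp (- a0 * F x) * (exp t - 1)" unfolding e by (simp add: algebra_simps)
  moreover have "\<bar>exp (- a0 * F x) * (exp t - 1)\<bar> \<le> exp \<bar>a0\<bar> * (2 * \<bar>a - a0\<bar>)"
    unfolding abs_mult using exp_F_bounds(2)[OF x, of a0] abs_exp_minus_1_le[OF t1] t by (intro mult_mono) auto
  ultimately show "\<bar>exp (- a * F x) - exp (- a0 * F x)\<bar> \<le> exp \<bar>a0\<bar> * (2 * \<bar>a - a0\<bar>)" by simp
  have "exp (- a * F x) - exp (- a0 * F x) + (a - a0) * (F x * exp (- a0 * F x)) = exp (- a0 * F x) * (exp t - 1 - t)"
    unfolding e t_def by (simp add: algebra_simps)
  moreover have "\<bar>exp (- a0 * F x) * (exp t - 1 - t)\<bar> \<le> exp \<bar>a0\<bar> * (a - a0)\<^sup>2"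
  proof -
    have "t\<^sup>2 \<le> (a - a0)\<^sup>2" using t by (simp add: abs_le_square_iff)
    then have "\<bar>exp t - 1 - t\<bar> \<le> (a - a0)\<^sup>2" using abs_exp_minus_linear_le[OF t1] by simp
    then show ?thesis unfolding abs_mult using exp_F_bounds(2)[OF x, of a0] by (intro mult_mono) auto
  qed
  ultimately show "\<bar>exp (- a * F x) - exp (- a0 * F x) + (a - a0) * (F x * exp (- a0 * F x))\<bar> \<le> exp \<bar>a0\<bar> * (a - a0)\<^sup>2"
    by simp
qed

text \<open>Apply the left eigenfunctional at \<open>a\<close> to \<open>(w_a - P) f\<close>, where \<open>f\<close> is the eigenfunction at
  \<open>a0\<close>: this vanishes, and so does \<open>(w_a0 - P) f\<close>; hence \<open>L_a ((w_a - w_a0) f) = 0\<close>, an exact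
  relation between the increments of the growth rate and of \<open>a\<close>.\<close>

proposition radius_differentiable:
  assumes b: "(1 - \<epsilon>) * ratio_bound b < 1" and a0: "\<bar>a0\<bar> < b"
  shows "\<exists>D. (radius has_real_derivative D) (at a0)"
proof -
  define \<kappa> where "\<kappa> = ratio_bound b"
  have \<kappa>0: "0 \<le> \<kappa>" unfolding \<kappa>_def using a0 by (intro ratio_bound_nonneg) simp
  have \<kappa>1: "(1 - \<epsilon>) * \<kappa> < 1" using b unfolding \<kappa>_def .
  define k where "k a = ratio a (radius a)" for a
  define w where "w a = weight a (radius a)" for a
  have bk: "bounded_by \<kappa> (k a)" if "\<bar>a\<bar> < b" for a
    unfolding k_def \<kappa>_def using that radius_ge_1[of a] radius_le_b[OF that] by (intro bounded_by_ratio) auto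
  have kills: "L (k a) (\<lambda>x. w a x * g x - (\<integral>y. g y \<partial>K x)) = 0" if "\<bar>a\<bar> < b" "bounded_by C g" for a C g
  proof (rule principal_eigenfunction[OF b that(1)])
    fix f B c
    assume f: "bounded_by B f" "\<And>x. x \<in> space M \<Longrightarrow> (\<integral>y. f y \<partial>K x) = weight a (radius a) x * f x"
      "(\<integral>y. ratio a (radius a) y * f y \<partial>\<nu>) \<noteq> 0"
    have e: "(\<integral>y. f y \<partial>K x) = (exp 1 - (exp 1 - 1) * k a x) * f x" if "x \<in> space M" for x
      unfolding k_def weight_ratio by (rule f(2)[OF that])
    have "L (k a) (\<lambda>x. (exp 1 - (exp 1 - 1) * k a x) * g x - (\<integral>y. g y \<partial>K x)) = 0"
      by (rule L_eigen(1)[OF \<kappa>1 \<kappa>0 bk[OF that(1)] f(1) e f(3)[folded k_def] that(2)])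
    then show ?thesis unfolding k_def weight_ratio w_def .
  qed
  obtain f B where f: "bounded_by B f" "\<And>x. x \<in> space M \<Longrightarrow> (\<integral>y. f y \<partial>K x) = w a0 x * f x"
    and L0: "L (k a0) (\<lambda>x. exp (- a0 * F x) * f x) \<noteq> 0"
  proof (rule principal_eigenfunction[OF b a0], fold w_def k_def)
    fix f B c
    assume "bounded_by B f" "\<And>x. x \<in> space M \<Longrightarrow> (\<integral>y. f y \<partial>K x) = w a0 x * f x"
      "L (k a0) (\<lambda>x. exp (- a0 * F x) * f x) \<noteq> 0"
    then show thesis by (rule that)
  qed
  define d where "d a x = (exp (- a * F x) - exp (- a0 * F x)) / (a - a0)" for a x
  define X where "X a = L (k a) (\<lambda>x. exp (- a * F x) * f x)" for a
  define Y where "Y a = L (k a) (\<lambda>x. d a x * f x)" for a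
  let ?d0 = "\<lambda>x. - (F x * exp (- a0 * F x))"
  have near: "eventually (\<lambda>a. \<bar>a\<bar> < b \<and> \<bar>a - a0\<bar> \<le> 1 \<and> a \<noteq> a0) (at a0)"
  proof -
    have "eventually (\<lambda>a. \<bar>a\<bar> < b) (at a0)"
      by (rule order_tendstoD(2)[OF tendsto_rabs[OF tendsto_ident_at] a0])
    moreover have "eventually (\<lambda>a. \<bar>a - a0\<bar> < 1) (at a0)"
    proof (rule order_tendstoD(2))
      show "((\<lambda>a. \<bar>a - a0\<bar>) \<longlongrightarrow> \<bar>a0 - a0\<bar>) (at a0)" by (intro tendsto_intros)
    qed simp
    moreover have "eventually (\<lambda>a. a \<noteq> a0) (at a0)" by (rule eventually_neq_at_within)
    ultimately show ?thesis by eventually_elim auto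
  qed
  have mF: "(\<lambda>x. exp (- a * F x)) \<in> borel_measurable M" for a
    by (rule bounded_byD(1)[OF bounded_by_exp_F])
  have bFe: "bounded_by (1 * exp \<bar>a0\<bar>) (\<lambda>x. F x * exp (- a0 * F x))"
    by (intro bounded_by_mult bounded_by_exp_F bounded_byI) (use F_measurable abs_F_le in auto)
  have bd0: "bounded_by (2 * exp \<bar>a0\<bar>) ?d0"
    by (rule bounded_by_mono[where C="\<bar>-1\<bar> * (1 * exp \<bar>a0\<bar>)"]) (use bounded_by_cmult[OF bFe, of "-1"] in auto)
  have d_err: "\<bar>d a x - ?d0 x\<bar> \<le> exp \<bar>a0\<bar> * \<bar>a - a0\<bar>"
    if a: "\<bar>a - a0\<bar> \<le> 1" "a \<noteq> a0" and x: "x \<in> space M" for a x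
  proof -
    have "d a x - ?d0 x = (exp (- a * F x) - exp (- a0 * F x) + (a - a0) * (F x * exp (- a0 * F x))) / (a - a0)"
      unfolding d_def using a(2) by (simp add: add_divide_distrib)
    then have "\<bar>d a x - ?d0 x\<bar> \<le> exp \<bar>a0\<bar> * (a - a0)\<^sup>2 / \<bar>a - a0\<bar>"
      using exp_F_diff(2)[OF x a(1)] by (simp add: abs_divide divide_right_mono)
    also have "\<dots> = exp \<bar>a0\<bar> * (\<bar>a - a0\<bar>\<^sup>2 / \<bar>a - a0\<bar>)" by simp
    also have "\<bar>a - a0\<bar>\<^sup>2 / \<bar>a - a0\<bar> = \<bar>a - a0\<bar>"
      unfolding power2_eq_square using a(2) by (intro nonzero_mult_div_cancel_right) simp
    finally show ?thesis .
  qed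
  have bd: "bounded_by (2 * exp \<bar>a0\<bar>) (d a)" if a: "\<bar>a - a0\<bar> \<le> 1" "a \<noteq> a0" for a
  proof (rule bounded_byI)
    show "d a \<in> borel_measurable M" unfolding d_def[abs_def] by (intro borel_measurable_divide borel_measurable_diff mF borel_measurable_const)
    fix x assume x: "x \<in> space M"
    have "\<bar>a - a0\<bar> > 0" using a by simp
    then show "\<bar>d a x\<bar> \<le> 2 * exp \<bar>a0\<bar>"
      using exp_F_diff(1)[OF x a(1)] unfolding d_def by (simp add: abs_divide pos_divide_le_eq mult_ac)
  qed
  have rel: "(radius a - radius a0) / (a - a0) * X a = - radius a0 * Y a"
    if a: "\<bar>a\<bar> < b" "\<bar>a - a0\<bar> \<le> 1" "a \<noteq> a0" for a
  proof -
    have be: "bounded_by (exp \<bar>a\<bar> * B) (\<lambda>x. exp (- a * F x) * f x)" by (intro bounded_by_mult bounded_by_exp_F f)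
    have bdf: "bounded_by (2 * exp \<bar>a0\<bar> * B) (\<lambda>x. d a x * f x)" by (intro bounded_by_mult bd a f)
    have "0 = L (k a) (\<lambda>x. w a x * f x - (\<integral>y. f y \<partial>K x))" by (rule kills[OF a(1) f(1), symmetric])
    also have "\<dots> = L (k a) (\<lambda>x. (radius a - radius a0) * (exp (- a * F x) * f x) + (radius a0 * (a - a0)) * (d a x * f x))"
    proof (rule L_cong[OF \<kappa>1 \<kappa>0])
      fix x assume x: "x \<in> space M"
      have "(a - a0) * d a x = exp (- a * F x) - exp (- a0 * F x)" unfolding d_def using a(3) by simp
      then have dd: "(radius a0 * (a - a0)) * (d a x * f x) = radius a0 * (exp (- a * F x) - exp (- a0 * F x)) * f x"
        by (metis mult.assoc)
      show "w a x * f x - (\<integral>y. f y \<partial>K x) = (radius a - radius a0) * (exp (- a * F x) * f x) + (radius a0 * (a - a0)) * (d a x * f x)"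
        unfolding dd f(2)[OF x] w_def weight_def by (simp add: algebra_simps)
    qed
    also have "\<dots> = (radius a - radius a0) * X a + (radius a0 * (a - a0)) * Y a"
      unfolding X_def Y_def by (rule L_lin[OF \<kappa>1 \<kappa>0 bk[OF a(1)] be bdf])
    finally have "(radius a - radius a0) * X a = (a - a0) * (- radius a0 * Y a)" by (simp add: algebra_simps)
    then show ?thesis using a(3) by (simp add: field_simps)
  qed
  have e_lim: "uniform_limit (space M) (\<lambda>a x. exp (- a * F x)) (\<lambda>x. exp (- a0 * F x)) (at a0)"
  proof (rule uniform_limit_of_bound)
    show "eventually (\<lambda>a. \<forall>x\<in>space M. \<bar>exp (- a * F x) - exp (- a0 * F x)\<bar> \<le> exp \<bar>a0\<bar> * (2 * \<bar>a - a0\<bar>)) (at a0)"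
      using near by eventually_elim (use exp_F_diff(1) in blast)
    have "((\<lambda>a. exp \<bar>a0\<bar> * (2 * \<bar>a - a0\<bar>)) \<longlongrightarrow> exp \<bar>a0\<bar> * (2 * \<bar>a0 - a0\<bar>)) (at a0)" by (intro tendsto_intros)
    then show "((\<lambda>a. exp \<bar>a0\<bar> * (2 * \<bar>a - a0\<bar>)) \<longlongrightarrow> 0) (at a0)" by simp
  qed
  have d_lim: "uniform_limit (space M) d ?d0 (at a0)"
  proof (rule uniform_limit_of_bound)
    show "eventually (\<lambda>a. \<forall>x\<in>space M. \<bar>d a x - ?d0 x\<bar> \<le> exp \<bar>a0\<bar> * \<bar>a - a0\<bar>) (at a0)"
      using near by eventually_elim (use d_err in blast)
    have "((\<lambda>a. exp \<bar>a0\<bar> * \<bar>a - a0\<bar>) \<longlongrightarrow> exp \<bar>a0\<bar> * \<bar>a0 - a0\<bar>) (at a0)" by (intro tendsto_intros)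
    then show "((\<lambda>a. exp \<bar>a0\<bar> * \<bar>a - a0\<bar>) \<longlongrightarrow> 0) (at a0)" by simp
  qed
  have k_lim: "uniform_limit (space M) k (k a0) (at a0)"
  proof (rule uniform_limit_of_bound)
    let ?E = "\<lambda>a. (\<bar>radius a\<bar> * (exp \<bar>a0\<bar> * (2 * \<bar>a - a0\<bar>)) + \<bar>radius a - radius a0\<bar> * exp \<bar>a0\<bar>) / (exp 1 - 1)"
    have err: "\<bar>k a x - k a0 x\<bar> \<le> ?E a" if a: "\<bar>a - a0\<bar> \<le> 1" and x: "x \<in> space M" for a x
    proof -
      have "k a0 x - k a x = (radius a * (exp (- a * F x) - exp (- a0 * F x)) + (radius a - radius a0) * exp (- a0 * F x)) / (exp 1 - 1)"
        unfolding k_def ratio_def weight_def by (simp add: diff_divide_distrib[symmetric] algebra_simps)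
      moreover have "\<bar>radius a * (exp (- a * F x) - exp (- a0 * F x)) + (radius a - radius a0) * exp (- a0 * F x)\<bar>
         \<le> \<bar>radius a\<bar> * (exp \<bar>a0\<bar> * (2 * \<bar>a - a0\<bar>)) + \<bar>radius a - radius a0\<bar> * exp \<bar>a0\<bar>"
        using exp_F_diff(1)[OF x a] exp_F_bounds(2)[OF x, of a0]
        by (intro order_trans[OF abs_triangle_ineq] add_mono) (auto simp: abs_mult intro!: mult_left_mono)
      ultimately show ?thesis
        unfolding abs_minus_commute[of "k a x"] using e_gt_1 by (simp add: abs_divide divide_right_mono)
    qed
    show "eventually (\<lambda>a. \<forall>x\<in>space M. \<bar>k a x - k a0 x\<bar> \<le> ?E a) (at a0)"
      using near by eventually_elim (use err in blast)
    have "(?E \<longlongrightarrow> (\<bar>radius a0\<bar> * (exp \<bar>a0\<bar> * (2 * \<bar>a0 - a0\<bar>)) + \<bar>radius a0 - radius a0\<bar> * exp \<bar>a0\<bar>) / (exp 1 - 1)) (at a0)"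
      using e_gt_1 by (intro tendsto_intros continuous_radius) auto
    then show "(?E \<longlongrightarrow> 0) (at a0)" by simp
  qed
  have bk_ev: "eventually (\<lambda>a. bounded_by \<kappa> (k a)) (at a0)"
    using near by eventually_elim (use bk in blast)
  have X_lim: "(X \<longlongrightarrow> X a0) (at a0)"
    unfolding X_def[abs_def]
  proof (rule tendsto_L[OF \<kappa>1 \<kappa>0 at_neq_bot bk_ev bk[OF a0] k_lim])
    show "bounded_by (exp b * B) (\<lambda>x. exp (- a0 * F x) * f x)"
      by (intro bounded_by_mult f bounded_by_mono[OF bounded_by_exp_F]) (use a0 in auto)
    show "eventually (\<lambda>a. bounded_by (exp b * B) (\<lambda>x. exp (- a * F x) * f x)) (at a0)"
      using near by eventually_elim (intro bounded_by_mult f bounded_by_mono[OF bounded_by_exp_F], auto)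
    show "uniform_limit (space M) (\<lambda>a x. exp (- a * F x) * f x) (\<lambda>x. exp (- a0 * F x) * f x) (at a0)"
      by (rule uniform_lim_mult[OF e_lim uniform_limit_const bounded_by_image[OF bounded_by_exp_F] bounded_by_image[OF f(1)]])
  qed
  have Y_lim: "(Y \<longlongrightarrow> L (k a0) (\<lambda>x. ?d0 x * f x)) (at a0)"
    unfolding Y_def[abs_def]
  proof (rule tendsto_L[OF \<kappa>1 \<kappa>0 at_neq_bot bk_ev bk[OF a0] k_lim])
    show "bounded_by (2 * exp \<bar>a0\<bar> * B) (\<lambda>x. ?d0 x * f x)" by (intro bounded_by_mult bd0 f)
    show "eventually (\<lambda>a. bounded_by (2 * exp \<bar>a0\<bar> * B) (\<lambda>x. d a x * f x)) (at a0)"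
      using near by eventually_elim (intro bounded_by_mult f bd, auto)
    show "uniform_limit (space M) (\<lambda>a x. d a x * f x) (\<lambda>x. ?d0 x * f x) (at a0)"
      by (rule uniform_lim_mult[OF d_lim uniform_limit_const bounded_by_image[OF bd0] bounded_by_image[OF f(1)]])
  qed
  have X0: "X a0 \<noteq> 0" using L0 unfolding X_def .
  have X_ev: "eventually (\<lambda>a. X a \<noteq> 0) (at a0)"
    by (rule tendsto_imp_eventually_ne[OF X_lim X0])
  have "((\<lambda>a. (- radius a0 * Y a) / X a) \<longlongrightarrow> (- radius a0 * L (k a0) (\<lambda>x. ?d0 x * f x)) / X a0) (at a0)"
    by (intro tendsto_intros Y_lim X_lim X0)
  moreover have "eventually (\<lambda>a. (- radius a0 * Y a) / X a = (radius a - radius a0) / (a - a0)) (at a0)"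
    using near X_ev
  proof eventually_elim
    case (elim a)
    then have "(radius a - radius a0) / (a - a0) * X a = - radius a0 * Y a" by (intro rel) auto
    then show ?case using elim(2) by (metis nonzero_mult_div_cancel_right)
  qed
  ultimately have "((\<lambda>a. (radius a - radius a0) / (a - a0)) \<longlongrightarrow> (- radius a0 * L (k a0) (\<lambda>x. ?d0 x * f x)) / X a0) (at a0)"
    by (rule Lim_transform_eventually)
  then show ?thesis unfolding has_field_derivative_iff by blast
qed

end


section \<open>Half-line large deviations from exponential moments\<close>

context prob_space
begin

lemma integrable_exp_bounded:
  assumes "X \<in> borel_measurable M" "\<And>\<omega>. \<omega> \<in> space M \<Longrightarrow> \<bar>X \<omega>\<bar> \<le> B"
  shows "integrable M (\<lambda>\<omega>. exp (a * X \<omega> :: real))"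
proof (rule integrable_const_bound[where B="exp (\<bar>a\<bar> * B)"])
  show "AE \<omega> in M. norm (exp (a * X \<omega>)) \<le> exp (\<bar>a\<bar> * B)"
  proof (rule AE_I2)
    fix \<omega> assume "\<omega> \<in> space M"
    then have "\<bar>a\<bar> * \<bar>X \<omega>\<bar> \<le> \<bar>a\<bar> * B" using assms(2) by (intro mult_left_mono) auto
    then have "a * X \<omega> \<le> \<bar>a\<bar> * B" by (metis abs_le_D1 abs_mult)
    then show "norm (exp (a * X \<omega>)) \<le> exp (\<bar>a\<bar> * B)" by simp
  qed
qed (use assms(1) in measurable)

text \<open>An elementary form of the tilting argument: where \<open>X\<close> leaves \<open>[u, v]\<close>, the
  weight \<open>e\<^sup>a\<^sup>X\<close> is dominated by a weight tilted slightly further towards the side on which it leaves.\<close>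

lemma tilting_inequality:
  fixes X :: "'a \<Rightarrow> real"
  assumes X: "X \<in> borel_measurable M" "\<And>\<omega>. \<omega> \<in> space M \<Longrightarrow> \<bar>X \<omega>\<bar> \<le> B"
    and a: "0 \<le> a" and t: "0 \<le> t" "0 \<le> t'"
  shows "(\<integral>\<omega>. exp (a * X \<omega>) \<partial>M) \<le> exp (a * v) * \<P>(\<omega> in M. u \<le> X \<omega>)
     + exp (t * u) * (\<integral>\<omega>. exp ((a - t) * X \<omega>) \<partial>M) + exp (- t' * v) * (\<integral>\<omega>. exp ((a + t') * X \<omega>) \<partial>M)"
proof -
  note int = integrable_exp_bounded[OF X]
  let ?A = "{\<omega> \<in> space M. u \<le> X \<omega>}"
  have A: "?A \<in> sets M" using X(1) by measurable
  have intA: "integrable M (indicat_real ?A)"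
    by (rule integrable_const_bound[where B=1]) (use A in auto)
  have "(\<integral>\<omega>. exp (a * X \<omega>) \<partial>M) \<le> (\<integral>\<omega>. exp (a * v) * indicator ?A \<omega>
     + exp (t * u) * exp ((a - t) * X \<omega>) + exp (- t' * v) * exp ((a + t') * X \<omega>) \<partial>M)"
  proof (rule integral_mono)
    fix \<omega> assume \<omega>: "\<omega> \<in> space M"
    consider "X \<omega> < u" | "v < X \<omega>" | "u \<le> X \<omega>" "X \<omega> \<le> v" by linarith
    then show "exp (a * X \<omega>) \<le> exp (a * v) * indicator ?A \<omega>
       + exp (t * u) * exp ((a - t) * X \<omega>) + exp (- t' * v) * exp ((a + t') * X \<omega>)"
    proof cases
      case 1
      then have "t * X \<omega> \<le> t * u" using t by (intro mult_left_mono) auto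
      then have "exp (a * X \<omega>) \<le> exp (t * u) * exp ((a - t) * X \<omega>)"
        by (simp add: exp_add[symmetric] algebra_simps)
      moreover have "0 \<le> exp (a * v) * indicator ?A \<omega>" "0 \<le> exp (- t' * v) * exp ((a + t') * X \<omega>)" by simp_all
      ultimately show ?thesis by linarith
    next
      case 2
      then have "t' * v \<le> t' * X \<omega>" using t by (intro mult_left_mono) auto
      then have "exp (a * X \<omega>) \<le> exp (- t' * v) * exp ((a + t') * X \<omega>)"
        by (simp add: exp_add[symmetric] algebra_simps)
      moreover have "0 \<le> exp (a * v) * indicator ?A \<omega>" "0 \<le> exp (t * u) * exp ((a - t) * X \<omega>)" by simp_all
      ultimately show ?thesis by linarith
    next
      case 3
      then have "a * X \<omega> \<le> a * v" using a by (intro mult_left_mono) auto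
      then have "exp (a * X \<omega>) \<le> exp (a * v) * indicator ?A \<omega>" using 3 \<omega> by simp
      moreover have "0 \<le> exp (t * u) * exp ((a - t) * X \<omega>)" "0 \<le> exp (- t' * v) * exp ((a + t') * X \<omega>)" by simp_all
      ultimately show ?thesis by linarith
    qed
  qed (use int intA in \<open>auto intro!: Bochner_Integration.integrable_add\<close>)
  also have "\<dots> = exp (a * v) * prob ?A
     + exp (t * u) * (\<integral>\<omega>. exp ((a - t) * X \<omega>) \<partial>M) + exp (- t' * v) * (\<integral>\<omega>. exp ((a + t') * X \<omega>) \<partial>M)"
    using int A intA by simp
  finally show ?thesis .
qed

lemma chernoff_bound:
  fixes X :: "'a \<Rightarrow> real"
  assumes X: "X \<in> borel_measurable M" "\<And>\<omega>. \<omega> \<in> space M \<Longrightarrow> \<bar>X \<omega>\<bar> \<le> B" and a: "0 \<le> a"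
  shows "\<P>(\<omega> in M. u \<le> X \<omega>) \<le> exp (- a * u) * (\<integral>\<omega>. exp (a * X \<omega>) \<partial>M)"
proof -
  let ?A = "{\<omega> \<in> space M. u \<le> X \<omega>}"
  have A: "?A \<in> sets M" using X(1) by measurable
  have intA: "integrable M (indicat_real ?A)"
    by (rule integrable_const_bound[where B=1]) (use A in auto)
  have "prob ?A = (\<integral>\<omega>. indicator ?A \<omega> \<partial>M)" using A by simp
  also have "\<dots> \<le> (\<integral>\<omega>. exp (- a * u) * exp (a * X \<omega>) \<partial>M)"
  proof (rule integral_mono)
    fix \<omega> assume \<omega>: "\<omega> \<in> space M"
    show "indicator ?A \<omega> \<le> exp (- a * u) * exp (a * X \<omega>)"
    proof (cases "u \<le> X \<omega>")
      case True
      then have "a * u \<le> a * X \<omega>" using a by (intro mult_left_mono) auto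
      then show ?thesis using True \<omega> by (simp add: exp_add[symmetric])
    qed simp
  qed (use intA integrable_exp_bounded[OF X] in auto)
  finally show ?thesis by simp
qed

end

lemma eventually_exp_decay:
  fixes C1 C2 g1 g2 p :: real
  assumes "0 < g1" "0 < g2" "0 < p"
  shows "eventually (\<lambda>n. p / 2 \<le> p - C1 * exp (- real n * g1) - C2 * exp (- real n * g2)) sequentially"
proof -
  have e: "exp (- real n * g) = exp (- g) ^ n" for n g by (simp add: exp_of_nat_mult[symmetric])
  have "(\<lambda>n. p - C1 * exp (- g1) ^ n - C2 * exp (- g2) ^ n) \<longlonglongrightarrow> p - C1 * 0 - C2 * 0"
    using assms by (intro tendsto_intros LIMSEQ_power_zero) auto
  then have "eventually (\<lambda>n. p / 2 < p - C1 * exp (- g1) ^ n - C2 * exp (- g2) ^ n) sequentially"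
    using assms by (intro order_tendstoD(1)) auto
  then show ?thesis unfolding e by eventually_elim simp
qed

lemma small_increment:
  fixes f :: "real \<Rightarrow> real"
  assumes "(f has_real_derivative l) (at 0)" "l < 0" "0 < e"
  shows "\<exists>t>0. t < e \<and> f t < f 0"
proof -
  obtain d where d: "0 < d" "\<forall>h>0. h < d \<longrightarrow> f (0 + h) < f 0"
    using DERIV_neg_dec_right[OF assms(1,2)] by auto
  then show ?thesis using assms(3) by (intro exI[of _ "min d e / 2"]) (auto simp: min_def)
qed

text \<open>The maximiser of \<open>a c - \<Lambda> a\<close> is interior: \<open>\<Lambda>\<close> has its minimum at \<open>0\<close>, so the slope
  there is \<open>c > 0\<close>, and at the right end the slope is \<open>c - \<Lambda>' < 0\<close>.\<close>

lemma conjugate_maximiser: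
  fixes \<Lambda> :: "real \<Rightarrow> real"
  assumes r: "0 < r" and diff: "\<And>a. \<bar>a\<bar> \<le> r \<Longrightarrow> (\<Lambda> has_real_derivative \<Lambda>' a) (at a)"
    and nonneg: "\<And>a. \<bar>a\<bar> \<le> r \<Longrightarrow> 0 \<le> \<Lambda> a" and zero: "\<Lambda> 0 = 0"
    and c: "0 < c" "c < \<Lambda>' r"
  obtains a where "0 < a" "a < r" "\<Lambda>' a = c" "\<And>s. \<bar>s\<bar> \<le> r \<Longrightarrow> s * c - \<Lambda> s \<le> a * c - \<Lambda> a"
proof -
  define \<phi> where "\<phi> a = a * c - \<Lambda> a" for a
  have d\<phi>: "(\<phi> has_real_derivative c - \<Lambda>' a) (at a)" if "\<bar>a\<bar> \<le> r" for a
    unfolding \<phi>_def[abs_def] using diff[OF that] by (auto intro!: derivative_eq_intros)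
  have "continuous_on {0..r} \<phi>"
    by (intro continuous_at_imp_continuous_on ballI DERIV_isCont[OF d\<phi>]) auto
  then obtain a where a: "a \<in> {0..r}" "\<And>s. s \<in> {0..r} \<Longrightarrow> \<phi> s \<le> \<phi> a"
    using continuous_attains_sup[of "{0..r}" \<phi>] r by auto
  have \<Lambda>'0: "\<Lambda>' 0 = 0"
    by (rule DERIV_local_min[OF diff, of 0 r]) (use r nonneg zero in auto)
  have "a \<noteq> 0"
  proof
    assume "a = 0"
    obtain d where d: "0 < d" "\<forall>h>0. h < d \<longrightarrow> \<phi> 0 < \<phi> (0 + h)"
      using DERIV_pos_inc_right[OF d\<phi>[of 0]] \<Lambda>'0 c r by auto
    let ?h = "min d r / 2"
    have "0 < ?h" "?h < d" "?h \<le> r" using d r by (auto simp: min_def)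
    then show False using d(2) a(2)[of ?h] \<open>a = 0\<close> by fastforce
  qed
  moreover have "a \<noteq> r"
  proof
    assume "a = r"
    obtain d where d: "0 < d" "\<forall>h>0. h < d \<longrightarrow> \<phi> r < \<phi> (r - h)"
      using DERIV_neg_dec_left[OF d\<phi>[of r]] c r by auto
    let ?h = "min d r / 2"
    have "0 < ?h" "?h < d" "?h \<le> r" using d r by (auto simp: min_def)
    then show False using d(2) a(2)[of "r - ?h"] \<open>a = r\<close> by fastforce
  qed
  ultimately have a01: "0 < a" "a < r" using a(1) by auto
  have "c - \<Lambda>' a = 0"
  proof (rule DERIV_local_max[OF d\<phi>])
    show "0 < min a (r - a)" using a01 by simp
    show "\<forall>y. \<bar>a - y\<bar> < min a (r - a) \<longrightarrow> \<phi> y \<le> \<phi> a" by (intro allI impI a(2)) auto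
  qed (use a01 in auto)
  moreover have "s * c - \<Lambda> s \<le> a * c - \<Lambda> a" if "\<bar>s\<bar> \<le> r" for s
  proof (cases "0 \<le> s")
    case True
    then show ?thesis using a(2)[of s] that unfolding \<phi>_def by auto
  next
    case False
    then have "s * c \<le> 0" using c by (simp add: mult_nonpos_nonneg)
    then have "\<phi> s \<le> \<phi> 0" using nonneg[OF that] zero unfolding \<phi>_def by simp
    also have "\<dots> \<le> \<phi> a" using r by (intro a(2)) auto
    finally show ?thesis unfolding \<phi>_def .
  qed
  ultimately show ?thesis using a01 that by auto
qed

text \<open>The lower bound tilts to a level \<open>c + \<delta>\<close> slightly above \<open>c\<close>, so that the tilted law
  concentrates strictly inside the half-line, and lets \<open>\<delta>\<close> tend to \<open>0\<close>.\<close>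

theorem (in prob_space) half_line_large_deviations:
  fixes S :: "nat \<Rightarrow> 'a \<Rightarrow> real" and \<Lambda> :: "real \<Rightarrow> real"
  assumes S: "\<And>n. S n \<in> borel_measurable M" "\<And>n \<omega>. \<omega> \<in> space M \<Longrightarrow> \<bar>S n \<omega>\<bar> \<le> real n"
    and r: "0 < r" "r < b"
    and mgf: "\<And>a. \<bar>a\<bar> < b \<Longrightarrow> \<exists>C>0. \<forall>n. exp (real n * \<Lambda> a) / C \<le> (\<integral>\<omega>. exp (a * S n \<omega>) \<partial>M) \<and>
        (\<integral>\<omega>. exp (a * S n \<omega>) \<partial>M) \<le> C * exp (real n * \<Lambda> a)"
    and diff: "\<And>a. \<bar>a\<bar> < b \<Longrightarrow> (\<Lambda> has_real_derivative \<Lambda>' a) (at a)"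
    and nonneg: "\<And>a. \<bar>a\<bar> < b \<Longrightarrow> 0 \<le> \<Lambda> a" and zero: "\<Lambda> 0 = 0"
    and c: "0 < c" "c < \<Lambda>' r"
  shows "(\<lambda>n. elog (\<P>(\<omega> in M. real n * c \<le> S n \<omega>)) / ereal (real n)) \<longlonglongrightarrow> - restricted_conjugate r \<Lambda> c"
proof -
  define p where "p n = \<P>(\<omega> in M. real n * c \<le> S n \<omega>)" for n
  have max: "\<exists>a. 0 < a \<and> a < r \<and> \<Lambda>' a = c' \<and> (\<forall>s. \<bar>s\<bar> \<le> r \<longrightarrow> s * c' - \<Lambda> s \<le> a * c' - \<Lambda> a)"
    if "0 < c'" "c' < \<Lambda>' r" for c'
  proof (rule conjugate_maximiser[of r \<Lambda> \<Lambda>' c'])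
    fix a assume "0 < a" "a < r" "\<Lambda>' a = c'" "\<And>s. \<bar>s\<bar> \<le> r \<Longrightarrow> s * c' - \<Lambda> s \<le> a * c' - \<Lambda> a"
    then show ?thesis by (intro exI[of _ a]) blast
  qed (use r diff nonneg zero that in auto)
  obtain a where a: "0 < a" "a < r" "\<And>s. \<bar>s\<bar> \<le> r \<Longrightarrow> s * c - \<Lambda> s \<le> a * c - \<Lambda> a"
    using max[OF c] by blast
  define J where "J = a * c - \<Lambda> a"
  have J: "restricted_conjugate r \<Lambda> c = ereal J"
    unfolding restricted_conjugate_def
  proof (rule antisym)
    show "(SUP a\<in>{-r<..<r}. ereal (a * c - \<Lambda> a)) \<le> ereal J"
      unfolding J_def using a(3) by (intro SUP_least) auto
    show "ereal J \<le> (SUP a\<in>{-r<..<r}. ereal (a * c - \<Lambda> a))"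
      unfolding J_def using a by (intro SUP_upper) auto
  qed
  have upper: "\<exists>C>0. \<forall>n. p n \<le> C * exp (- real n * J)"
  proof -
    obtain C where C: "0 < C" "\<And>n. (\<integral>\<omega>. exp (a * S n \<omega>) \<partial>M) \<le> C * exp (real n * \<Lambda> a)"
      using mgf[of a] a r by auto
    have "p n \<le> C * exp (- real n * J)" for n
    proof -
      have "p n \<le> exp (- a * (real n * c)) * (\<integral>\<omega>. exp (a * S n \<omega>) \<partial>M)"
        unfolding p_def using a by (intro chernoff_bound[OF S]) auto
      also have "\<dots> \<le> exp (- a * (real n * c)) * (C * exp (real n * \<Lambda> a))"
        by (intro mult_left_mono C) auto
      also have "\<dots> = C * exp (- real n * J)" unfolding J_def by (simp add: exp_add[symmetric] algebra_simps)
      finally show ?thesis .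
    qed
    then show ?thesis using C(1) by blast
  qed
  have lower: "\<exists>C>0. eventually (\<lambda>n. exp (- real n * (J + 2 * r * \<delta>)) / C \<le> p n) sequentially"
    if \<delta>: "0 < \<delta>" "c + \<delta> < \<Lambda>' r" for \<delta>
  proof -
    obtain a2 where a2: "0 < a2" "a2 < r" "\<Lambda>' a2 = c + \<delta>" using max[of "c + \<delta>"] c \<delta> by auto
    \<comment> \<open>the tilted law sits at the slope \<open>c + \<delta>\<close>, strictly between \<open>c\<close> and \<open>v\<close>\<close>
    define v where "v = c + 2 * \<delta>"
    have a2b: "\<bar>a2\<bar> < b" using a2 r by simp
    have d2: "(\<Lambda> has_real_derivative c + \<delta>) (at a2)" using diff[OF a2b] a2 by simp
    have "((\<lambda>t. t * c + \<Lambda> (a2 - t)) has_real_derivative - \<delta>) (at 0)"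
    proof -
      have "((\<lambda>t. \<Lambda> (a2 - t)) has_real_derivative (c + \<delta>) * (-1)) (at 0)"
        by (rule DERIV_chain2[of \<Lambda>]) (use d2 in \<open>auto intro!: derivative_eq_intros\<close>)
      then have "((\<lambda>t. t * c + \<Lambda> (a2 - t)) has_real_derivative c + (c + \<delta>) * (-1)) (at 0)"
        by (intro DERIV_add) (auto intro!: derivative_eq_intros)
      then show ?thesis by simp
    qed
    from small_increment[OF this, of a2] obtain t where t: "0 < t" "t < a2" "t * c + \<Lambda> (a2 - t) < \<Lambda> a2"
      using \<delta> a2 by auto
    have "((\<lambda>t. \<Lambda> (a2 + t) - t * v) has_real_derivative - \<delta>) (at 0)"
    proof -
      have "((\<lambda>t. \<Lambda> (a2 + t)) has_real_derivative (c + \<delta>) * 1) (at 0)"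
        by (rule DERIV_chain2[of \<Lambda>]) (use d2 in \<open>auto intro!: derivative_eq_intros\<close>)
      then have "((\<lambda>t. \<Lambda> (a2 + t) - t * v) has_real_derivative (c + \<delta>) * 1 - v) (at 0)"
        by (intro DERIV_diff) (auto intro!: derivative_eq_intros)
      then show ?thesis unfolding v_def by simp
    qed
    from small_increment[OF this, of "r - a2"] obtain t' where t': "0 < t'" "t' < r - a2" "\<Lambda> (a2 + t') - t' * v < \<Lambda> a2"
      using \<delta> a2 by auto
    obtain C where C: "0 < C" "\<And>n. exp (real n * \<Lambda> a2) / C \<le> (\<integral>\<omega>. exp (a2 * S n \<omega>) \<partial>M)"
      using mgf[OF a2b] by auto
    obtain C1 where C1: "0 < C1" "\<And>n. (\<integral>\<omega>. exp ((a2 - t) * S n \<omega>) \<partial>M) \<le> C1 * exp (real n * \<Lambda> (a2 - t))"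
      using mgf[of "a2 - t"] a2 t r by auto
    obtain C2 where C2: "0 < C2" "\<And>n. (\<integral>\<omega>. exp ((a2 + t') * S n \<omega>) \<partial>M) \<le> C2 * exp (real n * \<Lambda> (a2 + t'))"
      using mgf[of "a2 + t'"] a2 t' r by auto
    define g1 where "g1 = \<Lambda> a2 - (t * c + \<Lambda> (a2 - t))"
    define g2 where "g2 = \<Lambda> a2 - (\<Lambda> (a2 + t') - t' * v)"
    have g: "0 < g1" "0 < g2" unfolding g1_def g2_def using t t' by auto
    have ineq: "exp (real n * (\<Lambda> a2 - a2 * v)) * (1 / C - C1 * exp (- real n * g1) - C2 * exp (- real n * g2)) \<le> p n" for n
    proof -
      have "exp (real n * \<Lambda> a2) / C \<le> (\<integral>\<omega>. exp (a2 * S n \<omega>) \<partial>M)" by (rule C(2))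
      also have "\<dots> \<le> exp (a2 * (real n * v)) * p n
         + exp (t * (real n * c)) * (\<integral>\<omega>. exp ((a2 - t) * S n \<omega>) \<partial>M)
         + exp (- t' * (real n * v)) * (\<integral>\<omega>. exp ((a2 + t') * S n \<omega>) \<partial>M)"
        unfolding p_def using a2 t t' by (intro tilting_inequality[OF S]) auto
      also have "\<dots> \<le> exp (a2 * (real n * v)) * p n
         + exp (t * (real n * c)) * (C1 * exp (real n * \<Lambda> (a2 - t)))
         + exp (- t' * (real n * v)) * (C2 * exp (real n * \<Lambda> (a2 + t')))"
        by (intro add_mono order_refl mult_left_mono C1 C2) auto
      also have "exp (t * (real n * c)) * (C1 * exp (real n * \<Lambda> (a2 - t))) = exp (real n * \<Lambda> a2) * (C1 * exp (- real n * g1))"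
        unfolding g1_def by (simp add: exp_add[symmetric] algebra_simps)
      also have "exp (- t' * (real n * v)) * (C2 * exp (real n * \<Lambda> (a2 + t'))) = exp (real n * \<Lambda> a2) * (C2 * exp (- real n * g2))"
        unfolding g2_def by (simp add: exp_add[symmetric] algebra_simps)
      finally have "exp (real n * \<Lambda> a2) * (1 / C - C1 * exp (- real n * g1) - C2 * exp (- real n * g2)) \<le> exp (a2 * (real n * v)) * p n"
        by (simp add: algebra_simps)
      then have "exp (- (a2 * (real n * v))) * (exp (real n * \<Lambda> a2) * (1 / C - C1 * exp (- real n * g1) - C2 * exp (- real n * g2)))
          \<le> exp (- (a2 * (real n * v))) * (exp (a2 * (real n * v)) * p n)"
        by (intro mult_left_mono) auto
      also have "\<dots> = p n" unfolding mult.assoc[symmetric] exp_add[symmetric] by simp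
      finally show ?thesis unfolding mult.assoc[symmetric] exp_add[symmetric] by (simp add: algebra_simps)
    qed
    have "eventually (\<lambda>n. (1 / C) / 2 \<le> 1 / C - C1 * exp (- real n * g1) - C2 * exp (- real n * g2)) sequentially"
      using C(1) by (intro eventually_exp_decay g) auto
    then have "eventually (\<lambda>n. exp (- real n * (J + 2 * r * \<delta>)) / (2 * C) \<le> p n) sequentially"
    proof eventually_elim
      case (elim n)
      have "a2 * v - \<Lambda> a2 = (a2 * c - \<Lambda> a2) + 2 * (a2 * \<delta>)" unfolding v_def by (simp add: algebra_simps)
      also have "\<dots> \<le> J + 2 * (r * \<delta>)"
        using a(3)[of a2] a2 \<delta> unfolding J_def by (intro add_mono mult_left_mono mult_right_mono) auto
      finally have *: "a2 * v - \<Lambda> a2 \<le> J + 2 * r * \<delta>" by simp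
      have "- real n * (J + 2 * r * \<delta>) \<le> real n * (\<Lambda> a2 - a2 * v)"
        using mult_left_mono[OF *, of "real n"] by (simp add: algebra_simps)
      then have "exp (- real n * (J + 2 * r * \<delta>)) * ((1 / C) / 2) \<le> exp (real n * (\<Lambda> a2 - a2 * v)) * (1 / C - C1 * exp (- real n * g1) - C2 * exp (- real n * g2))"
        using elim C(1) by (intro mult_mono) auto
      then show ?case using ineq[of n] by (simp add: field_simps)
    qed
    then show ?thesis using C(1) by (intro exI[of _ "2 * C"]) auto
  qed

  have lim: "eventually (\<lambda>n. 0 < p n \<and> dist (ln (p n) / real n) (- J) < e) sequentially" if e: "0 < e" for e
  proof -
    define \<delta> where "\<delta> = min ((\<Lambda>' r - c) / 2) (e / (8 * r))"
    have \<delta>: "0 < \<delta>" "c + \<delta> < \<Lambda>' r" unfolding \<delta>_def using c e r by (auto simp: min_def field_simps)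
    have "\<delta> \<le> e / (8 * r)" unfolding \<delta>_def by simp
    then have r\<delta>: "2 * r * \<delta> \<le> e / 4" using r by (simp add: field_simps)
    obtain C where C: "0 < C" "\<And>n. p n \<le> C * exp (- real n * J)" using upper by blast
    obtain C' where C': "0 < C'" "eventually (\<lambda>n. exp (- real n * (J + 2 * r * \<delta>)) / C' \<le> p n) sequentially"
      using lower[OF \<delta>] by blast
    have small: "eventually (\<lambda>n. \<bar>ln D\<bar> / real n < e / 4) sequentially" for D
    proof (rule order_tendstoD(2)[OF tendsto_divide_0[OF tendsto_const]])
      show "filterlim (\<lambda>n. real n) at_infinity sequentially"
        by (rule filterlim_at_top_imp_at_infinity[OF filterlim_real_sequentially])
    qed (use e in simp)
    show ?thesis
      using C'(2) small[of C] small[of C'] eventually_gt_at_top[of 0]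
    proof eventually_elim
      case (elim n)
      have pos: "0 < p n" by (rule less_le_trans[OF _ elim(1)]) (use C' in simp)
      have "ln (p n) \<le> ln (C * exp (- real n * J))" using C(2)[of n] pos by (intro ln_mono) auto
      also have "\<dots> = ln C - real n * J" using C(1) by (simp add: ln_mult)
      finally have "ln (p n) / real n \<le> (ln C - real n * J) / real n" using elim(4) by (intro divide_right_mono) auto
      then have up: "ln (p n) / real n \<le> ln C / real n - J" using elim(4) by (simp add: diff_divide_distrib)
      have "ln (exp (- real n * (J + 2 * r * \<delta>)) / C') \<le> ln (p n)" using elim(1) C'(1) by (intro ln_mono) auto
      then have "- real n * (J + 2 * r * \<delta>) - ln C' \<le> ln (p n)" using C'(1) by (simp add: ln_div)
      then have "(- real n * (J + 2 * r * \<delta>) - ln C') / real n \<le> ln (p n) / real n" using elim(4) by (intro divide_right_mono) auto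
      then have lo: "- (J + 2 * r * \<delta>) - ln C' / real n \<le> ln (p n) / real n" using elim(4) by (simp add: diff_divide_distrib)
      have "\<bar>ln C / real n\<bar> < e / 4" "\<bar>ln C' / real n\<bar> < e / 4" using elim(2,3) by (simp_all add: abs_divide)
      then have "\<bar>ln (p n) / real n - (- J)\<bar> < e" using up lo r\<delta> e by linarith
      then show ?case using pos by (simp add: dist_real_def)
    qed
  qed
  have "(\<lambda>n. ln (p n) / real n) \<longlonglongrightarrow> - J"
  proof (rule tendstoI)
    fix e :: real assume "0 < e"
    from lim[OF this] show "eventually (\<lambda>n. dist (ln (p n) / real n) (- J) < e) sequentially"
      by eventually_elim simp
  qed
  then have "(\<lambda>n. ereal (ln (p n) / real n)) \<longlonglongrightarrow> ereal (- J)" by simp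
  moreover have "eventually (\<lambda>n. ereal (ln (p n) / real n) = elog (p n) / ereal (real n)) sequentially"
    using lim[OF zero_less_one] eventually_gt_at_top[of 0] by eventually_elim (simp add: elog_def)
  ultimately have "(\<lambda>n. elog (p n) / ereal (real n)) \<longlonglongrightarrow> ereal (- J)"
    by (rule Lim_transform_eventually)
  then show ?thesis unfolding p_def J by simp
qed


section \<open>The range of parameters\<close>

lemma e_bounds: "2.71828 \<le> exp (1::real)" "exp (1::real) \<le> 2.71829"
proof -
  have "\<bar>exp 1 - 5837465777 / 2147483648\<bar> * 4294967296 \<le> (1::real)" using e_approx_32 by simp
  then show "2.71828 \<le> exp (1::real)" "exp (1::real) \<le> 2.71829"
    by (simp_all add: abs_if split: if_splits)
qed

lemma exp_2e_minus_3_less: "exp (2 * exp 1 - 3) < 4 * (exp 1 - 1 :: real)\<^sup>2"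
proof -
  note e = e_bounds
  \<comment> \<open>\<open>x\<close> exceeds \<open>2 e - 5\<close>, and \<open>(1 - x/8)\<^sup>8\<close> bounds \<open>e\<^sup>-\<^sup>x\<close> closely enough from below\<close>
  define x :: real where "x = 0.43658"
  have "(1 - x / real 8) ^ 8 \<le> exp (- x)"
    using exp_ge_one_minus_x_over_n_power_n[of x 8] unfolding x_def by simp
  moreover have "1 / 1.57 \<le> (1 - x / real 8) ^ 8" unfolding x_def by (simp add: power_divide)
  ultimately have "1 / 1.57 \<le> exp (- x)" by simp
  then have ex: "exp x \<le> 1.57" by (simp add: exp_minus field_simps)
  have "exp (2 * exp 1 - 3) \<le> exp (1 + 1 + x)" using e(2) unfolding x_def by simp
  also have "\<dots> = exp 1 * exp 1 * exp x" by (simp only: exp_add)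
  also have "\<dots> \<le> 2.71829 * 2.71829 * 1.57" using e(2) ex by (intro mult_mono) auto
  also have "\<dots> < 4 * (1.71828)\<^sup>2" by (simp add: power2_eq_square)
  also have "\<dots> \<le> 4 * (exp 1 - 1)\<^sup>2" using e(1) by (intro mult_left_mono power_mono) auto
  finally show ?thesis .
qed

context doeblin_chain
begin

definition abar :: real where
  "abar = (exp 1 - 1) / (2 - \<epsilon>) * \<epsilon>"

lemma abar_pos: "0 < abar"
  unfolding abar_def using eps_pos eps_le_1 by (intro mult_pos_pos divide_pos_pos) auto

text \<open>With \<open>m = e - 1\<close> and \<open>u = abar\<close>, the contraction factor is
  \<open>1 - \<epsilon> = (m - u) / (m + u)\<close>. The lower deviation is controlled by \<open>1 - e\<^sup>-\<^sup>u \<le> u\<close>; for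
  the upper one put \<open>y = m - u\<close> and use \<open>2 y \<le> e\<^sup>2\<^sup>y\<^sup>-\<^sup>1\<close>, which reduces it to the numerical
  inequality above.\<close>

lemma abar_gap:
  "(1 - \<epsilon>) * (exp 1 - exp (- abar)) < exp 1 - 1"
  "(1 - \<epsilon>) * (exp (2 * abar) - exp 1) < exp 1 - 1"
proof -
  define m :: real where "m = exp 1 - 1"
  define y where "y = m - abar"
  have m: "1 < m" using e_bounds(1) unfolding m_def by simp
  have eps2: "0 < 2 - \<epsilon>" using eps_le_1 by simp
  have u: "abar * (2 - \<epsilon>) = m * \<epsilon>" unfolding abar_def m_def using eps2 by simp
  have "abar \<le> m"
  proof -
    have "abar * (2 - \<epsilon>) \<le> m * (2 - \<epsilon>)" unfolding u using m eps_le_1 by (intro mult_left_mono) auto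
    then show ?thesis using eps2 by (rule mult_right_le_imp_le)
  qed
  then have y: "0 \<le> y" unfolding y_def by simp
  have s: "0 < m + abar" using m abar_pos by simp
  have ratio: "(1 - \<epsilon>) * (m + abar) = y"
    using u unfolding y_def by (simp add: algebra_simps)
  have *: "(1 - \<epsilon>) * z < m" if "y * z < m * (m + abar)" for z
  proof -
    have "(1 - \<epsilon>) * z * (m + abar) < m * (m + abar)" using that unfolding ratio[symmetric] by (simp add: mult_ac)
    then show ?thesis using s by (simp add: mult_less_cancel_right)
  qed
  have "y * (exp 1 - exp (- abar)) \<le> y * (m + abar)"
    using exp_ge_add_one_self[of "- abar"] y unfolding m_def by (intro mult_left_mono) auto
  also have "\<dots> < m * (m + abar)" using abar_pos s unfolding y_def by (intro mult_strict_right_mono) auto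
  finally show "(1 - \<epsilon>) * (exp 1 - exp (- abar)) < exp 1 - 1" using * unfolding m_def by blast
  have "2 * y * exp (2 * abar) \<le> exp (2 * y - 1) * exp (2 * abar)"
    using exp_ge_add_one_self[of "2 * y - 1"] by (intro mult_right_mono) auto
  also have "\<dots> = exp (2 * exp 1 - 3)" unfolding y_def m_def exp_add[symmetric] by (simp add: algebra_simps)
  also have "\<dots> < 4 * m\<^sup>2" using exp_2e_minus_3_less unfolding m_def .
  finally have "y * exp (2 * abar) < 2 * m\<^sup>2" by simp
  moreover have "y * (exp (2 * abar) - exp 1) = y * exp (2 * abar) - y * m - y" unfolding m_def by (simp add: algebra_simps)
  moreover have "m * (m + abar) = 2 * m\<^sup>2 - y * m" unfolding y_def by (simp add: algebra_simps power2_eq_square)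
  ultimately have "y * (exp (2 * abar) - exp 1) < m * (m + abar)" using y by linarith
  then show "(1 - \<epsilon>) * (exp (2 * abar) - exp 1) < exp 1 - 1" using * unfolding m_def by blast
qed

end

section \<open>Exponential moments and the half-line deviations\<close>

context doeblin_functional
begin

lemma ratio_bound_beyond_abar: "\<exists>b>abar. (1 - \<epsilon>) * ratio_bound b < 1"
proof -
  have "(1 - \<epsilon>) * ratio_bound abar < 1"
  proof -
    have "(1 - \<epsilon>) * max (exp 1 - exp (- abar)) (exp (2 * abar) - exp 1) < exp 1 - 1"
      using abar_gap by (simp add: max_def)
    then show ?thesis unfolding ratio_bound_def using e_gt_1 by (simp add: pos_divide_less_eq)
  qed
  moreover have "((\<lambda>b. (1 - \<epsilon>) * ratio_bound b) \<longlongrightarrow> (1 - \<epsilon>) * ratio_bound abar) (at_right abar)"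
    unfolding ratio_bound_def using e_gt_1 by (intro tendsto_intros) auto
  ultimately have "eventually (\<lambda>b. (1 - \<epsilon>) * ratio_bound b < 1) (at_right abar)"
    by (intro order_tendstoD(2)) auto
  then have "eventually (\<lambda>b. (1 - \<epsilon>) * ratio_bound b < 1 \<and> abar < b) (at_right abar)"
    using eventually_at_right_less by (rule eventually_conj)
  then show ?thesis by (metis (mono_tags, lifting) eventually_happens' trivial_limit_at_right_real)
qed

text \<open>Weighted by the eigenfunction, the exponential moment is exactly geometric:
  \<open>E (e\<^sup>a\<^sup>S f(\<Phi>(n))) = r\<^sup>n \<mu>(f)\<close> for \<open>S = S_n\<close>. Since \<open>f\<close> is bounded and bounded away from
  \<open>0\<close>, dropping it costs a constant factor.\<close>

lemma mgf_bounds: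
  assumes b: "(1 - \<epsilon>) * ratio_bound b < 1" and a: "\<bar>a\<bar> < b" and \<mu>: "\<mu> \<in> space (prob_algebra M)"
  shows "\<exists>C>0. \<forall>n. radius a ^ n / C \<le> (\<integral>\<omega>. exp (a * partial_sum F n \<omega>) \<partial>chain_law M K \<mu>) \<and>
     (\<integral>\<omega>. exp (a * partial_sum F n \<omega>) \<partial>chain_law M K \<mu>) \<le> C * radius a ^ n"
proof (rule principal_eigenfunction[OF b a])
  fix f B c
  assume f: "bounded_by B f" and c: "0 < c" "\<And>x. x \<in> space M \<Longrightarrow> c \<le> f x"
    and eig: "\<And>x. x \<in> space M \<Longrightarrow> (\<integral>y. f y \<partial>K x) = weight a (radius a) x * f x"
  interpret N: prob_space "chain_law M K \<mu>" by (rule prob_space_chain_law[OF \<mu>])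
  let ?E = "\<lambda>n. \<integral>\<omega>. exp (a * partial_sum F n \<omega>) \<partial>chain_law M K \<mu>"
  let ?f = "\<lambda>n. \<integral>\<omega>. exp (a * partial_sum F n \<omega>) * f (\<omega> n) \<partial>chain_law M K \<mu>"
  have space: "\<omega> i \<in> space M" if "\<omega> \<in> space (chain_law M K \<mu>)" for \<omega> i
    using that unfolding space_chain_law[OF \<mu>] by auto
  obtain z where z: "z \<in> space M" using space_nonempty by auto
  have B: "0 < B" using bounded_byD(2)[OF f z] c(1) c(2)[OF z] by linarith
  have mS: "partial_sum F n \<in> borel_measurable (chain_law M K \<mu>)" for n
    unfolding measurable_chain_law[OF \<mu>] by (rule measurable_partial_sum(2)[OF F_measurable order_refl])
  have mf: "(\<lambda>\<omega>. f (\<omega> n)) \<in> borel_measurable (chain_law M K \<mu>)" for n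
    unfolding measurable_chain_law[OF \<mu>]
    by (rule measurable_compose[OF measurable_component_singleton[where M="\<lambda>_. M"] bounded_byD(1)[OF f]]) simp
  have Sn: "\<bar>partial_sum F n \<omega>\<bar> \<le> real n" if "\<omega> \<in> space (chain_law M K \<mu>)" for n \<omega>
    by (rule abs_partial_sum_le[OF abs_F_le]) (use space[OF that] in auto)
  have intE: "integrable (chain_law M K \<mu>) (\<lambda>\<omega>. exp (a * partial_sum F n \<omega>))" for n
    by (rule N.integrable_exp_bounded[OF mS Sn])
  have intf: "integrable (chain_law M K \<mu>) (\<lambda>\<omega>. exp (a * partial_sum F n \<omega>) * f (\<omega> n))" for n
  proof (rule Bochner_Integration.integrable_bound[OF integrable_mult_left[OF intE, of n B]])
    show "(\<lambda>\<omega>. exp (a * partial_sum F n \<omega>) * f (\<omega> n)) \<in> borel_measurable (chain_law M K \<mu>)"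
      using mS[of n] mf[of n] by measurable
    show "AE \<omega> in chain_law M K \<mu>. norm (exp (a * partial_sum F n \<omega>) * f (\<omega> n)) \<le> norm (exp (a * partial_sum F n \<omega>) * B)"
      by (rule AE_I2) (use bounded_byD(2)[OF f] space B in \<open>auto simp: abs_mult\<close>)
  qed
  have power: "?f n = radius a ^ n * (\<integral>x. f x \<partial>\<mu>)" for n
  proof (induction n)
    case 0
    show ?case using integral_chain_law_0[OF \<mu> bounded_byD(1)[OF f]] by (simp add: partial_sum_def)
  next
    case (Suc n)
    have "?f (Suc n) = (\<integral>\<omega>. exp (a * partial_sum F (Suc n) \<omega>) * (\<integral>y. f y \<partial>K (\<omega> n)) \<partial>chain_law M K \<mu>)"
    proof (rule integral_chain_law_mult[OF \<mu> _ _ _ bounded_byD(1)[OF f] bounded_byD(2)[OF f]])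
      show "(\<lambda>\<omega>. exp (a * partial_sum F (Suc n) \<omega>)) \<in> borel_measurable (PiM {0..<Suc n} (\<lambda>_. M))"
        using measurable_partial_sum(1)[OF F_measurable order_refl] by measurable
      show "exp (a * partial_sum F (Suc n) (restrict \<omega> {0..<Suc n})) = exp (a * partial_sum F (Suc n) \<omega>)" for \<omega>
        by (simp only: partial_sum_restrict[OF order_refl])
      fix \<omega> assume "\<omega> \<in> space (PiM {0..<Suc n} (\<lambda>_. M))"
      then have "\<bar>partial_sum F (Suc n) \<omega>\<bar> \<le> real (Suc n)"
        by (intro abs_partial_sum_le abs_F_le) (auto simp: space_PiM PiE_iff)
      then have "\<bar>a\<bar> * \<bar>partial_sum F (Suc n) \<omega>\<bar> \<le> \<bar>a\<bar> * real (Suc n)" by (intro mult_left_mono) auto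
      then have "a * partial_sum F (Suc n) \<omega> \<le> \<bar>a\<bar> * real (Suc n)" by (metis abs_le_D1 abs_mult)
      then show "\<bar>exp (a * partial_sum F (Suc n) \<omega>)\<bar> \<le> exp (\<bar>a\<bar> * real (Suc n))" by simp
    qed
    also have "\<dots> = (\<integral>\<omega>. radius a * (exp (a * partial_sum F n \<omega>) * f (\<omega> n)) \<partial>chain_law M K \<mu>)"
    proof (rule Bochner_Integration.integral_cong[OF refl])
      fix \<omega> assume "\<omega> \<in> space (chain_law M K \<mu>)"
      from eig[OF space[OF this]]
      have "exp (a * partial_sum F (Suc n) \<omega>) * (\<integral>y. f y \<partial>K (\<omega> n)) =
          exp (a * partial_sum F n \<omega> + a * F (\<omega> n)) * (radius a * exp (- a * F (\<omega> n)) * f (\<omega> n))"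
        unfolding weight_def by (simp add: partial_sum_def distrib_left)
      also have "\<dots> = radius a * (exp (a * partial_sum F n \<omega>) * f (\<omega> n))"
        by (simp add: exp_add exp_minus)
      finally show "exp (a * partial_sum F (Suc n) \<omega>) * (\<integral>y. f y \<partial>K (\<omega> n)) = radius a * (exp (a * partial_sum F n \<omega>) * f (\<omega> n))" .
    qed
    finally show ?case using Suc by simp
  qed
  define I where "I = (\<integral>x. f x \<partial>\<mu>)"
  have I: "c \<le> I" "I \<le> B"
  proof -
    have sets: "sets \<mu> = sets M" and p: "prob_space \<mu>" using \<mu> by (auto simp: space_prob_algebra)
    have sp: "space \<mu> = space M" by (rule sets_eq_imp_space_eq[OF sets])
    have "I = ?f 0" using power[of 0] unfolding I_def by simp
    also have "\<dots> = (\<integral>\<omega>. f (\<omega> 0) \<partial>chain_law M K \<mu>)" by (simp add: partial_sum_def)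
    finally have I0: "I = (\<integral>\<omega>. f (\<omega> 0) \<partial>chain_law M K \<mu>)" .
    have i0: "integrable (chain_law M K \<mu>) (\<lambda>\<omega>. f (\<omega> 0))" using intf[of 0] by (simp add: partial_sum_def)
    have "(\<integral>\<omega>. c \<partial>chain_law M K \<mu>) \<le> I" unfolding I0 using i0 c(2) space by (intro integral_mono) auto
    then show "c \<le> I" using N.prob_space by simp
    have "I \<le> (\<integral>\<omega>. B \<partial>chain_law M K \<mu>)"
      unfolding I0 using i0 bounded_byD(2)[OF f] space by (intro integral_mono) (auto dest!: abs_le_D1)
    then show "I \<le> B" using N.prob_space by simp
  qed
  have r: "0 < radius a" using radius_ge_1[of a] by simp
  show ?thesis
  proof (intro exI[of _ "B / c"] conjI allI)
    show "0 < B / c" using B c by simp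
    fix n
    have "c * ?E n \<le> ?f n"
      unfolding integral_mult_right_zero[symmetric] 
      using intE[of n] intf[of n] c(2) space by (intro integral_mono) (auto simp: mult.commute[of c] intro!: mult_left_mono)
    also have "\<dots> \<le> radius a ^ n * B" unfolding power I_def[symmetric] using I r by (intro mult_left_mono) auto
    finally show "?E n \<le> B / c * radius a ^ n" using c by (simp add: field_simps)
    have "radius a ^ n * c \<le> ?f n" unfolding power I_def[symmetric] using I r by (intro mult_left_mono) auto
    also have "?f n \<le> B * ?E n"
      unfolding integral_mult_right_zero[symmetric]
      using intE[of n] intf[of n] bounded_byD(2)[OF f] space
      by (intro integral_mono) (auto simp: mult.commute[of B] intro!: mult_left_mono dest!: abs_le_D1)
    finally show "radius a ^ n / (B / c) \<le> ?E n" using B c by (simp add: field_simps)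
  qed
qed

lemma log_mgf_rate_eq:
  assumes b: "(1 - \<epsilon>) * ratio_bound b < 1" and a: "\<bar>a\<bar> < b" and x: "x \<in> space M"
  shows "log_mgf_rate M K F x a = ln (radius a)"
proof -
  let ?E = "\<lambda>n. \<integral>\<omega>. exp (a * partial_sum F n \<omega>) \<partial>chain_law M K (return M x)"
  have \<mu>: "return M x \<in> space (prob_algebra M)" using x by (simp add: space_prob_algebra prob_space_return)
  obtain C where C: "0 < C" "\<And>n. radius a ^ n / C \<le> ?E n" "\<And>n. ?E n \<le> C * radius a ^ n"
    using mgf_bounds[OF b a \<mu>] by blast
  have r: "0 < radius a" using radius_ge_1[of a] by simp
  have "(\<lambda>n. ln (?E n) / real n) \<longlonglongrightarrow> ln (radius a)"
  proof (rule tendsto_sandwich)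
    have lim: "(\<lambda>n. ln (radius a) + D / real n) \<longlonglongrightarrow> ln (radius a)" for D
    proof -
      have "(\<lambda>n. ln (radius a) + D / real n) \<longlonglongrightarrow> ln (radius a) + 0"
        by (intro tendsto_add tendsto_const tendsto_divide_0[OF tendsto_const]
            filterlim_at_top_imp_at_infinity[OF filterlim_real_sequentially])
      then show ?thesis by simp
    qed
    show "(\<lambda>n. ln (radius a) + (- ln C) / real n) \<longlonglongrightarrow> ln (radius a)" by (rule lim)
    show "(\<lambda>n. ln (radius a) + ln C / real n) \<longlonglongrightarrow> ln (radius a)" by (rule lim)
    show "eventually (\<lambda>n. ln (radius a) + (- ln C) / real n \<le> ln (?E n) / real n) sequentially"
      using eventually_gt_at_top[of 0]
    proof eventually_elim
      case (elim n)
      have "ln (radius a ^ n / C) \<le> ln (?E n)" using C(1) C(2)[of n] r by (intro ln_mono) auto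
      then have "real n * ln (radius a) - ln C \<le> ln (?E n)" using C(1) r by (simp add: ln_div ln_realpow)
      then have "(real n * ln (radius a) - ln C) / real n \<le> ln (?E n) / real n" using elim by (intro divide_right_mono) auto
      then show ?case using elim by (simp add: diff_divide_distrib)
    qed
    show "eventually (\<lambda>n. ln (?E n) / real n \<le> ln (radius a) + ln C / real n) sequentially"
      using eventually_gt_at_top[of 0]
    proof eventually_elim
      case (elim n)
      have pos: "0 < ?E n" by (rule less_le_trans[OF _ C(2)]) (use C(1) r in simp)
      have "ln (?E n) \<le> ln (C * radius a ^ n)" using pos C(3)[of n] by (intro ln_mono) auto
      then have "ln (?E n) \<le> real n * ln (radius a) + ln C" using C(1) r by (simp add: ln_mult ln_realpow)
      then have "ln (?E n) / real n \<le> (real n * ln (radius a) + ln C) / real n" using elim by (intro divide_right_mono) auto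
      then show ?case using elim by (simp add: add_divide_distrib)
    qed
  qed
  then show ?thesis unfolding log_mgf_rate_def by (rule limI)
qed

theorem local_large_deviations:
  assumes x: "x \<in> space M"
  defines "\<Lambda> \<equiv> log_mgf_rate M K F x"
  shows "c \<in> {0<..<deriv \<Lambda> abar} \<Longrightarrow>
      (\<lambda>n. elog (\<P>(\<omega> in chain_law M K \<pi>. real n * c \<le> partial_sum F n \<omega>)) / ereal (real n))
        \<longlonglongrightarrow> - restricted_conjugate abar \<Lambda> c"
    and "c \<in> {deriv \<Lambda> (-abar)<..<0} \<Longrightarrow>
      (\<lambda>n. elog (\<P>(\<omega> in chain_law M K \<pi>. partial_sum F n \<omega> \<le> real n * c)) / ereal (real n))
        \<longlonglongrightarrow> - restricted_conjugate abar \<Lambda> c"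
proof -
  obtain b where b: "abar < b" "(1 - \<epsilon>) * ratio_bound b < 1" using ratio_bound_beyond_abar by blast
  interpret N: prob_space "chain_law M K \<pi>" by (rule prob_space_chain_law[OF pi_prob])
  have r: "1 \<le> radius a" for a by (rule radius_ge_1)
  have \<Lambda>: "\<Lambda> a = ln (radius a)" if "\<bar>a\<bar> < b" for a
    unfolding \<Lambda>_def by (rule log_mgf_rate_eq[OF b(2) that x])
  have der: "(\<Lambda> has_real_derivative deriv \<Lambda> a) (at a)" if a: "\<bar>a\<bar> < b" for a
  proof -
    obtain D where D: "(radius has_real_derivative D) (at a)" using radius_differentiable[OF b(2) a] by blast
    have pos: "0 < radius a" using r[of a] by simp
    have "((\<lambda>a. ln (radius a)) has_real_derivative D / radius a) (at a)"
      by (rule derivative_eq_intros refl D pos)+ simp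
    moreover have "eventually (\<lambda>a. a \<in> {-b<..<b}) (nhds a)"
      using a by (intro eventually_nhds_in_open) auto
    ultimately have "(\<Lambda> has_real_derivative D / radius a) (at a)"
      by (subst DERIV_cong_ev[OF refl _ refl]) (auto elim!: eventually_mono simp: \<Lambda>)
    then show ?thesis by (simp add: DERIV_imp_deriv)
  qed
  have nonneg: "0 \<le> \<Lambda> a" if "\<bar>a\<bar> < b" for a using \<Lambda>[OF that] r[of a] by simp
  have b0: "\<bar>0\<bar> < b" using abar_pos b by simp
  have zero: "\<Lambda> 0 = 0" using \<Lambda>[OF b0] radius_0 by simp
  have exp\<Lambda>: "exp (real n * \<Lambda> a) = radius a ^ n" if "\<bar>a\<bar> < b" for n a
    using \<Lambda>[OF that] r[of a] by (simp add: exp_of_nat_mult)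
  have mS: "partial_sum F n \<in> borel_measurable (chain_law M K \<pi>)" for n
    unfolding measurable_chain_law[OF pi_prob] by (rule measurable_partial_sum(2)[OF F_measurable order_refl])
  have Sn: "\<bar>partial_sum F n \<omega>\<bar> \<le> real n" if "\<omega> \<in> space (chain_law M K \<pi>)" for n \<omega>
    using that unfolding space_chain_law[OF pi_prob] by (intro abs_partial_sum_le[OF abs_F_le]) auto
  have mgf: "\<exists>C>0. \<forall>n. exp (real n * \<Lambda> a) / C \<le> (\<integral>\<omega>. exp (a * partial_sum F n \<omega>) \<partial>chain_law M K \<pi>) \<and>
        (\<integral>\<omega>. exp (a * partial_sum F n \<omega>) \<partial>chain_law M K \<pi>) \<le> C * exp (real n * \<Lambda> a)" if "\<bar>a\<bar> < b" for a
    unfolding exp\<Lambda>[OF that] by (rule mgf_bounds[OF b(2) that pi_prob])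
  show "(\<lambda>n. elog (\<P>(\<omega> in chain_law M K \<pi>. real n * c \<le> partial_sum F n \<omega>)) / ereal (real n))
        \<longlonglongrightarrow> - restricted_conjugate abar \<Lambda> c" if "c \<in> {0<..<deriv \<Lambda> abar}"
    by (rule N.half_line_large_deviations[OF mS Sn abar_pos b(1) mgf der nonneg zero]) (use that in auto)
  \<comment> \<open>the lower half-line is the upper one for \<open>- S\<close> and the reflected rate\<close>
  show "(\<lambda>n. elog (\<P>(\<omega> in chain_law M K \<pi>. partial_sum F n \<omega> \<le> real n * c)) / ereal (real n))
        \<longlonglongrightarrow> - restricted_conjugate abar \<Lambda> c" if c: "c \<in> {deriv \<Lambda> (-abar)<..<0}"
  proof -
    have "(\<lambda>n. elog (\<P>(\<omega> in chain_law M K \<pi>. real n * (- c) \<le> - partial_sum F n \<omega>)) / ereal (real n))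
        \<longlonglongrightarrow> - restricted_conjugate abar (\<lambda>a. \<Lambda> (- a)) (- c)"
    proof (rule N.half_line_large_deviations[OF _ _ abar_pos b(1), where \<Lambda>'="\<lambda>a. - deriv \<Lambda> (- a)"])
      show "(\<lambda>\<omega>. - partial_sum F n \<omega>) \<in> borel_measurable (chain_law M K \<pi>)" for n using mS[of n] by simp
      show "\<bar>- partial_sum F n \<omega>\<bar> \<le> real n" if "\<omega> \<in> space (chain_law M K \<pi>)" for n \<omega> using Sn[OF that] by simp
      show "\<exists>C>0. \<forall>n. exp (real n * \<Lambda> (- a)) / C \<le> (\<integral>\<omega>. exp (a * - partial_sum F n \<omega>) \<partial>chain_law M K \<pi>) \<and>
        (\<integral>\<omega>. exp (a * - partial_sum F n \<omega>) \<partial>chain_law M K \<pi>) \<le> C * exp (real n * \<Lambda> (- a))" if "\<bar>a\<bar> < b" for a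
        using mgf[of "- a"] that by simp
      show "((\<lambda>a. \<Lambda> (- a)) has_real_derivative - deriv \<Lambda> (- a)) (at a)" if "\<bar>a\<bar> < b" for a
      proof -
        have "((\<lambda>a. \<Lambda> (- a)) has_real_derivative deriv \<Lambda> (- a) * (- 1)) (at a)"
          by (rule DERIV_chain2[of \<Lambda>]) (use der[of "- a"] that in \<open>auto intro!: derivative_eq_intros\<close>)
        then show ?thesis by simp
      qed
      show "0 \<le> \<Lambda> (- a)" if "\<bar>a\<bar> < b" for a using nonneg[of "- a"] that by simp
    qed (use c zero in auto)
    moreover have "restricted_conjugate abar (\<lambda>a. \<Lambda> (- a)) (- c) = restricted_conjugate abar \<Lambda> c"
    proof -
      have "{-abar<..<abar} = uminus ` {-abar<..<abar}" by simp
      then have "restricted_conjugate abar \<Lambda> c = (SUP a\<in>uminus ` {-abar<..<abar}. ereal (a * c - \<Lambda> a))"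
        unfolding restricted_conjugate_def by simp
      also have "\<dots> = (SUP a\<in>{-abar<..<abar}. ereal ((- a) * c - \<Lambda> (- a)))" by (simp only: image_image)
      finally show ?thesis unfolding restricted_conjugate_def by simp
    qed
    ultimately show ?thesis by simp
  qed
qed

end


section \<open>The ladder chain\<close>

text \<open>From \<open>x\<close> the chain climbs to \<open>x + 1\<close> or falls to \<open>0\<close>, with probability \<open>1/2\<close> each. All
  real numbers are admitted as states so that the state space is the Borel space; the naturals
  absorb the chain after its first fall.\<close>

definition ladder :: "real \<Rightarrow> real measure" where
  "ladder x = distr (measure_pmf (bernoulli_pmf (1/2))) borel (\<lambda>up. if up then x + 1 else 0)"

definition ladder_law :: "real measure" where
  "ladder_law = distr (measure_pmf (geometric_pmf (1/2))) borel real"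

lemma ladder_kernel [measurable]: "ladder \<in> borel \<rightarrow>\<^sub>M prob_algebra borel"
proof (rule measurable_prob_algebraI)
  show "prob_space (ladder x)" for x
    unfolding ladder_def by (rule prob_space.prob_space_distr[OF prob_space_measure_pmf]) simp
  show "ladder \<in> borel \<rightarrow>\<^sub>M subprob_algebra borel"
    unfolding ladder_def[abs_def]
  proof (rule measurable_distr2[where M="count_space UNIV"])
    have "(\<lambda>p. if snd p then fst p + 1 else 0 :: real) \<in> borel \<Otimes>\<^sub>M count_space (UNIV :: bool set) \<rightarrow>\<^sub>M borel"
      by measurable
    then show "(\<lambda>(x, up). if up then x + 1 else 0 :: real) \<in> borel \<Otimes>\<^sub>M count_space UNIV \<rightarrow>\<^sub>M borel"
      by (simp add: case_prod_unfold)
    show "(\<lambda>x. measure_pmf (bernoulli_pmf (1/2))) \<in> borel \<rightarrow>\<^sub>M subprob_algebra (count_space UNIV)"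
      by (rule measurable_const) (rule measure_pmf_in_subprob_algebra)
  qed
qed

lemma countably_generated_borel: "countably_generated (borel :: real measure)"
proof -
  obtain B :: "real set set" where B: "countable B" "topological_basis B"
    using ex_countable_basis by blast
  have "sets (borel :: real measure) = sigma_sets UNIV B"
    unfolding borel_eq_countable_basis[OF B] by simp
  then show ?thesis unfolding countably_generated_def using B(1) by (intro exI[of _ B]) auto
qed

interpretation ladder: markov_kernel borel ladder
  by unfold_locales (rule countably_generated_borel, rule ladder_kernel)

lemma nn_integral_ladder:
  "f \<in> borel_measurable borel \<Longrightarrow> (\<integral>\<^sup>+y. f y \<partial>ladder x) = f (x + 1) / 2 + f 0 / 2"
  unfolding ladder_def
  by (subst nn_integral_distr) (simp_all add: divide_ennreal_def)

lemma integral_ladder: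
  "f \<in> borel_measurable borel \<Longrightarrow> (\<integral>y. f y \<partial>ladder x) = (f (x + 1) + f 0 :: real) / 2"
  unfolding ladder_def by (subst integral_distr) simp_all

lemma ladder_law_prob: "ladder_law \<in> space (prob_algebra borel)"
  unfolding ladder_law_def space_prob_algebra
  by (auto intro!: prob_space.prob_space_distr[OF prob_space_measure_pmf])

lemma integral_ladder_law:
  fixes f :: "real \<Rightarrow> real"
  assumes "f \<in> borel_measurable borel" "\<And>y. \<bar>f y\<bar> \<le> C"
  shows "(\<lambda>n. (1/2) ^ Suc n * f (real n)) sums (\<integral>y. f y \<partial>ladder_law)"
proof -
  let ?q = "geometric_pmf (1/2)"
  have eq: "(\<integral>y. f y \<partial>ladder_law) = (\<integral>n. f (real n) \<partial>measure_pmf ?q)"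
    unfolding ladder_law_def using assms(1) by (subst integral_distr) simp_all
  have "integrable ?q (\<lambda>n. f (real n))"
    by (rule measure_pmf.integrable_const_bound[where B=C]) (use assms(2) in auto)
  then have i: "integrable (count_space UNIV) (\<lambda>n. pmf ?q n *\<^sub>R f (real n))"
    unfolding measure_pmf_eq_density by (subst (asm) integrable_density) auto
  have "(\<lambda>n. pmf ?q n *\<^sub>R f (real n)) sums (\<integral>n. pmf ?q n *\<^sub>R f (real n) \<partial>count_space UNIV)"
    by (rule sums_integral_count_space_nat[OF i])
  also have "(\<integral>n. pmf ?q n *\<^sub>R f (real n) \<partial>count_space UNIV) = (\<integral>n. f (real n) \<partial>measure_pmf ?q)"
    unfolding measure_pmf_eq_density by (subst integral_density) auto
  finally show ?thesis unfolding eq by (simp add: mult.commute mult.left_commute)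
qed

lemma ladder_law_invariant: "invariant_prob borel ladder ladder_law"
  unfolding invariant_prob_def
proof
  show "ladder_law \<in> space (prob_algebra borel)" by (rule ladder_law_prob)
  have s: "sets ladder_law = sets borel" unfolding ladder_law_def by simp
  have p: "prob_space ladder_law" using ladder_law_prob by (simp add: space_prob_algebra)
  have k: "ladder \<in> ladder_law \<rightarrow>\<^sub>M subprob_algebra borel"
    unfolding measurable_cong_sets[OF s refl] by (rule measurable_prob_algebraD[OF ladder_kernel])
  have "space ladder_law \<noteq> {}" using prob_space.not_empty[OF p] .
  then have sb: "sets (ladder_law \<bind> ladder) = sets borel"
    by (intro sets_bind) (auto simp: ladder_def)
  have pb: "prob_space (ladder_law \<bind> ladder)"
  proof (rule prob_space.prob_space_bind[OF p _ k])
    show "AE x in ladder_law. prob_space (ladder x)"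
      by (rule AE_I2) (use measurable_space[OF ladder_kernel] in \<open>simp add: space_prob_algebra\<close>)
  qed
  show "ladder_law \<bind> ladder = ladder_law"
  proof (rule measure_eqI)
    fix A assume "A \<in> sets (ladder_law \<bind> ladder)"
    then have A: "A \<in> sets borel" using sb by simp
    let ?f = "indicat_real A"
    have mf: "?f \<in> borel_measurable borel" using A by simp
    have "(\<integral>x. ?f x \<partial>(ladder_law \<bind> ladder)) = (\<integral>x. (\<integral>y. ?f y \<partial>ladder x) \<partial>ladder_law)"
    proof (rule integral_bind[OF mf _ k, where B=1 and B'=1])
      show "finite_measure ladder_law" using p by (rule prob_space.finite_measure)
      show "AE x in ladder_law. emeasure (ladder x) (space (ladder x)) \<le> ennreal 1"
      proof (rule AE_I2)
        fix x
        have "prob_space (ladder x)" using measurable_space[OF ladder_kernel, of x] by (simp add: space_prob_algebra)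
        then show "emeasure (ladder x) (space (ladder x)) \<le> ennreal 1" by (simp add: prob_space.emeasure_space_1)
      qed
    qed (simp add: indicator_def)
    also have "\<dots> = (\<integral>x. (?f (x + 1) + ?f 0) / 2 \<partial>ladder_law)" by (simp only: integral_ladder[OF mf])
    also have "\<dots> = (\<integral>x. ?f x \<partial>ladder_law)"
    proof (rule sums_unique2)
      show "(\<lambda>n. (1/2) ^ Suc n * ((?f (real n + 1) + ?f 0) / 2)) sums (\<integral>x. (?f (x + 1) + ?f 0) / 2 \<partial>ladder_law)"
      proof (rule integral_ladder_law[where C=1])
        show "(\<lambda>x. (?f (x + 1) + ?f 0) / 2) \<in> borel_measurable borel" using mf by measurable
      qed (auto simp: indicator_def)
      have "(\<lambda>n. (1/2) ^ Suc n * ?f (real n)) sums (\<integral>x. ?f x \<partial>ladder_law)"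
        by (rule integral_ladder_law[OF mf, where C=1]) (simp add: indicator_def)
      then have "(\<lambda>n. (1/2) ^ Suc (Suc n) * ?f (real (Suc n))) sums ((\<integral>x. ?f x \<partial>ladder_law) - (1/2) * ?f 0)"
        by (subst sums_Suc_iff) simp
      moreover have "(\<lambda>n. (1/2) ^ Suc n * (?f 0 / 2)) sums (1 * (?f 0 / 2))"
        by (rule sums_mult2[OF power_half_series])
      ultimately have "(\<lambda>n. (1/2) ^ Suc (Suc n) * ?f (real (Suc n)) + (1/2) ^ Suc n * (?f 0 / 2)) sums
          ((\<integral>x. ?f x \<partial>ladder_law) - (1/2) * ?f 0 + 1 * (?f 0 / 2))"
        by (rule sums_add)
      then show "(\<lambda>n. (1/2) ^ Suc n * ((?f (real n + 1) + ?f 0) / 2)) sums (\<integral>x. ?f x \<partial>ladder_law)"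
        by (simp add: algebra_simps add_divide_distrib)
    qed
    finally have "measure (ladder_law \<bind> ladder) A = measure ladder_law A"
      using A sb s by simp
    then show "emeasure (ladder_law \<bind> ladder) A = emeasure ladder_law A"
      using finite_measure.emeasure_eq_measure[OF prob_space.finite_measure[OF p]]
        finite_measure.emeasure_eq_measure[OF prob_space.finite_measure[OF pb]] by simp
  qed (simp add: sb s)
qed

lemma iterate_ladder_ge:
  assumes s: "s \<in> borel_measurable borel"
  shows "s 0 / 2 \<le> (\<integral>\<^sup>+y. s y \<partial>iterate_kernel borel ladder (Suc n) x)"
proof -
  have p: "prob_space (iterate_kernel borel ladder n x)" and st: "sets (iterate_kernel borel ladder n x) = sets borel"
    by (rule ladder.iterate_kernel_props; simp)+
  have k: "ladder \<in> iterate_kernel borel ladder n x \<rightarrow>\<^sub>M subprob_algebra borel"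
    unfolding measurable_cong_sets[OF st refl] by (rule measurable_prob_algebraD[OF ladder_kernel])
  have "s 0 / 2 = (\<integral>\<^sup>+z. s 0 / 2 \<partial>iterate_kernel borel ladder n x)"
    using prob_space.emeasure_space_1[OF p] by simp
  also have "\<dots> \<le> (\<integral>\<^sup>+z. (\<integral>\<^sup>+y. s y \<partial>ladder z) \<partial>iterate_kernel borel ladder n x)"
    by (rule nn_integral_mono) (simp add: nn_integral_ladder[OF s])
  also have "\<dots> = (\<integral>\<^sup>+y. s y \<partial>iterate_kernel borel ladder (Suc n) x)"
    by (simp add: nn_integral_bind[OF s k])
  finally show ?thesis .
qed

lemma resolvent_ladder_ge:
  assumes s: "s \<in> borel_measurable borel"
  shows "ennreal ((1 - exp (-1)) * exp (-1)) * (s 0 / 2) \<le> resolvent borel ladder 1 s x"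
proof -
  let ?a = "\<lambda>n. ennreal ((1 - exp (-1)) * exp (- 1 * real n)) * (\<integral>\<^sup>+y. s y \<partial>iterate_kernel borel ladder n x)"
  have "ennreal ((1 - exp (-1)) * exp (-1)) * (s 0 / 2) \<le> ?a 1"
    using mult_left_mono[OF iterate_ladder_ge[OF s, of 0 x], of "ennreal ((1 - exp (-1)) * exp (-1))"] by simp
  also have "\<dots> = (\<Sum>n\<in>{1::nat}. ?a n)" by simp
  also have "\<dots> \<le> (\<Sum>n. ?a n)" by (rule sum_le_suminf) auto
  finally show ?thesis unfolding resolvent_def by simp
qed

lemma ladder_irreducible: "psi_irreducible borel ladder (return borel 0)"
  unfolding psi_irreducible_def
proof (intro conjI exI[of _ 1] ballI impI)
  interpret prob_space "return borel (0::real)" by (rule prob_space_return) simp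
  show "sigma_finite_measure (return borel (0::real))" by unfold_locales
  show "emeasure (return borel (0::real)) (space borel) \<noteq> 0" by simp
  fix s :: "real \<Rightarrow> real" and x :: real
  assume s: "s \<in> borel_measurable borel" and pos: "0 < (\<integral>\<^sup>+y. ennreal (s y) \<partial>return borel 0)"
  have "0 < s 0" using pos s by (simp add: nn_integral_return)
  then have "0 < ennreal ((1 - exp (-1)) * exp (-1)) * (ennreal (s 0) / 2)"
    by (simp add: ennreal_zero_less_mult_iff ennreal_zero_less_divide)
  also have "\<dots> \<le> resolvent borel ladder 1 (\<lambda>y. ennreal (s y)) x"
    using resolvent_ladder_ge[of "\<lambda>y. ennreal (s y)"] s by simp
  finally show "0 < resolvent borel ladder 1 (\<lambda>y. ennreal (s y)) x" .
qed auto

lemma ladder_aperiodic: "psi_aperiodic borel ladder (return borel 0)"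
  unfolding psi_aperiodic_def
proof (intro ballI impI)
  fix s :: "real \<Rightarrow> real" and x :: real
  assume s: "s \<in> borel_measurable borel" and pos: "0 < (\<integral>\<^sup>+y. ennreal (s y) \<partial>return borel 0)"
  have s0: "0 < s 0" using pos s by (simp add: nn_integral_return)
  show "\<forall>\<^sub>F n in sequentially. 0 < (\<integral>\<^sup>+y. ennreal (s y) \<partial>iterate_kernel borel ladder n x)"
    using eventually_gt_at_top[of 0]
  proof eventually_elim
    case (elim n)
    then obtain m where n: "n = Suc m" using gr0_implies_Suc by blast
    have "0 < ennreal (s 0) / 2" using s0 by (simp add: ennreal_zero_less_divide)
    also have "\<dots> \<le> (\<integral>\<^sup>+y. ennreal (s y) \<partial>iterate_kernel borel ladder n x)"
      unfolding n using s by (intro iterate_ladder_ge) simp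
    finally show ?case .
  qed
qed

lemma ladder_doeblin:
  "doeblin_chain borel ladder ((1 - exp (-1)) * exp (-1) / 2) (return borel 0)"
proof unfold_locales
  show "\<exists>\<psi>. psi_irreducible borel ladder \<psi> \<and> psi_aperiodic borel ladder \<psi>"
    using ladder_irreducible ladder_aperiodic by blast
  show "0 < (1 - exp (-1)) * exp (-1) / (2::real)" by simp
  show "return borel 0 \<in> space (prob_algebra (borel :: real measure))"
    by (simp add: space_prob_algebra prob_space_return)
  fix x :: real and A :: "real set" assume A: "A \<in> sets borel"
  have "ennreal ((1 - exp (-1)) * exp (-1) / 2) * emeasure (return borel 0) A =
      ennreal ((1 - exp (-1)) * exp (-1)) * (indicator A (0::real) / 2)"
    using A by (simp add: divide_ennreal[symmetric] ennreal_divide_times divide_ennreal_def mult_ac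
        ennreal_mult' ennreal_divide_numeral[symmetric] split: split_indicator)
  also have "\<dots> \<le> resolvent borel ladder 1 (indicator A) x"
    using A by (intro resolvent_ladder_ge) simp
  finally show "ennreal ((1 - exp (-1)) * exp (-1) / 2) * emeasure (return borel 0) A \<le> resolvent borel ladder 1 (indicator A) x" .
qed


section \<open>Poisson's equation and the asymptotic variance of the ladder chain\<close>

text \<open>\<open>pot h\<close> solves Poisson's equation \<open>pot h - P (pot h) = h - mean\<close>; because it
  vanishes at \<open>0\<close>, the falls of the chain contribute nothing to \<open>P (pot h)\<close>.\<close>

definition pot :: "(real \<Rightarrow> real) \<Rightarrow> real \<Rightarrow> real" where
  "pot h y = (\<Sum>n. (1/2) ^ n * (h (y + real n) - (\<integral>z. h z \<partial>ladder_law)))"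

lemma bounded_square: "\<bar>x\<bar> \<le> B \<Longrightarrow> \<bar>x\<^sup>2\<bar> \<le> B\<^sup>2" for x B :: real
  using power_mono[of "\<bar>x\<bar>" B 2] by simp

lemma sums_half: "(\<lambda>n. (1/2::real) ^ n) sums 2"
  using geometric_sums[of "1/2::real"] by simp

context
  fixes h :: "real \<Rightarrow> real" and C :: real
  assumes h: "h \<in> borel_measurable borel" and C: "\<And>y. \<bar>h y\<bar> \<le> C"
begin

lemma abs_mean_le: "\<bar>\<integral>z. h z \<partial>ladder_law\<bar> \<le> C"
proof -
  have "h \<in> borel_measurable ladder_law" using h unfolding ladder_law_def by simp
  then show ?thesis
    using prob_space.abs_integral_le(2)[of ladder_law h C] ladder_law_prob C by (simp add: space_prob_algebra)
qed

lemma pot_term_le: "\<bar>(1/2) ^ n * (h (y + real n) - (\<integral>z. h z \<partial>ladder_law))\<bar> \<le> (1/2) ^ n * (2 * C)"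
  unfolding abs_mult using C[of "y + real n"] abs_mean_le by (intro mult_mono) auto

lemma pot_summable: "summable (\<lambda>n. (1/2) ^ n * (h (y + real n) - (\<integral>z. h z \<partial>ladder_law)))"
proof (rule summable_comparison_test')
  show "summable (\<lambda>n. (1/2) ^ n * (2 * C))" using sums_half by (intro summable_mult2) (rule sums_summable)
  show "norm ((1/2) ^ n * (h (y + real n) - (\<integral>z. h z \<partial>ladder_law))) \<le> (1/2) ^ n * (2 * C)" for n
    using pot_term_le by simp
qed

lemma pot_measurable: "pot h \<in> borel_measurable borel"
proof -
  have "(\<lambda>y. h (y + real n)) \<in> borel_measurable borel" for n
    by (rule measurable_compose[OF _ h]) measurable
  then show ?thesis unfolding pot_def[abs_def]
    by (intro borel_measurable_suminf borel_measurable_times borel_measurable_diff borel_measurable_const)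
qed

lemma pot_bound: "\<bar>pot h y\<bar> \<le> 4 * C"
proof -
  let ?t = "\<lambda>n. (1/2) ^ n * (h (y + real n) - (\<integral>z. h z \<partial>ladder_law))"
  have sC: "summable (\<lambda>n. (1/2) ^ n * (2 * C))" by (rule summable_mult2[OF sums_summable[OF sums_half]])
  have sn: "summable (\<lambda>n. norm (?t n))"
    by (rule summable_comparison_test'[OF sC]) (use pot_term_le in simp)
  have "norm (pot h y) \<le> (\<Sum>n. norm (?t n))" unfolding pot_def by (rule summable_norm[OF sn])
  also have "\<dots> \<le> (\<Sum>n. (1/2) ^ n * (2 * C))"
    by (rule suminf_le[OF _ sn sC]) (simp only: real_norm_def pot_term_le)
  also have "\<dots> = 2 * (2 * C)" by (rule sums_unique[OF sums_mult2[OF sums_half], symmetric])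
  finally show ?thesis by simp
qed

lemma pot_equation: "pot h y = h y - (\<integral>z. h z \<partial>ladder_law) + pot h (y + 1) / 2"
proof -
  let ?c = "\<integral>z. h z \<partial>ladder_law"
  have "pot h y = (1/2) ^ 0 * (h (y + real 0) - ?c) + (\<Sum>n. (1/2) ^ Suc n * (h (y + real (Suc n)) - ?c))"
    unfolding pot_def using suminf_split_head[OF pot_summable, of y] by simp
  also have "(\<Sum>n. (1/2) ^ Suc n * (h (y + real (Suc n)) - ?c)) = (\<Sum>n. (1/2) * ((1/2) ^ n * (h (y + 1 + real n) - ?c)))"
    by (simp add: mult_ac add_ac)
  also have "\<dots> = (1/2) * pot h (y + 1)" unfolding pot_def by (rule suminf_mult[OF pot_summable])
  finally show ?thesis by simp
qed

lemma pot_0: "pot h 0 = 0"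
proof -
  let ?c = "\<integral>z. h z \<partial>ladder_law"
  have "(\<lambda>n. 2 * ((1/2) ^ Suc n * h (real n)) - (1/2) ^ n * ?c) sums (2 * ?c - 2 * ?c)"
    by (intro sums_diff sums_mult integral_ladder_law[OF h C] sums_mult2[OF sums_half])
  then have "(\<lambda>n. (1/2) ^ n * (h (0 + real n) - ?c)) sums 0" by (simp add: algebra_simps)
  then show ?thesis unfolding pot_def by (rule sums_unique[symmetric])
qed

end

context
  fixes \<mu> :: "real measure"
  assumes \<mu>: "\<mu> \<in> space (prob_algebra borel)"
begin

abbreviation "path_law \<equiv> chain_law borel ladder \<mu>"

lemma prob_space_path_law: "prob_space path_law"
  by (rule ladder.prob_space_chain_law[OF \<mu>])

lemma integrable_path_law:
  assumes "f \<in> borel_measurable path_law" "\<And>\<omega>. \<bar>f \<omega>\<bar> \<le> (B::real)"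
  shows "integrable path_law f"
  by (rule finite_measure.integrable_const_bound[OF prob_space.finite_measure[OF prob_space_path_law], where B=B])
     (use assms in auto)

lemma measurable_coordinate:
  fixes f :: "real \<Rightarrow> real"
  assumes "f \<in> borel_measurable borel"
  shows "(\<lambda>\<omega>. f (\<omega> n)) \<in> borel_measurable path_law"
  unfolding ladder.measurable_chain_law[OF \<mu>]
  by (rule measurable_compose[OF measurable_component_singleton[where M="\<lambda>_. borel"] assms]) simp

lemma measurable_partial_sum_path_law: "F \<in> borel_measurable borel \<Longrightarrow> partial_sum F n \<in> borel_measurable path_law"
  unfolding ladder.measurable_chain_law[OF \<mu>] by (rule ladder.measurable_partial_sum(2)[OF _ order_refl])

lemma expectation_step:
  fixes f :: "real \<Rightarrow> real"
  assumes "G \<in> borel_measurable (PiM {0..<Suc n} (\<lambda>_. borel))"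
    and "\<And>\<omega>. G (restrict \<omega> {0..<Suc n}) = G \<omega>" and "\<And>\<omega>. \<bar>G \<omega>\<bar> \<le> B"
    and f: "f \<in> borel_measurable borel" "\<And>y. \<bar>f y\<bar> \<le> B'"
  shows "(\<integral>\<omega>. G \<omega> * f (\<omega> (Suc n)) \<partial>path_law) = (\<integral>\<omega>. G \<omega> * ((f (\<omega> n + 1) + f 0) / 2) \<partial>path_law)"
  using ladder.integral_chain_law_mult[OF \<mu> assms(1,2,3) f] unfolding integral_ladder[OF f(1)] by simp

lemma expectation_step1:
  fixes f :: "real \<Rightarrow> real"
  assumes f: "f \<in> borel_measurable borel" "\<And>y. \<bar>f y\<bar> \<le> B'"
  shows "(\<integral>\<omega>. f (\<omega> (Suc n)) \<partial>path_law) = (\<integral>\<omega>. (f (\<omega> n + 1) + f 0) / 2 \<partial>path_law)"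
  using expectation_step[where G="\<lambda>_. 1" and B=1, OF _ _ _ f] by simp

text \<open>Poisson's equation telescopes and leaves boundary terms that are bounded in \<open>n\<close>.\<close>

lemma expectation_sum:
  fixes h :: "real \<Rightarrow> real"
  assumes h: "h \<in> borel_measurable borel" "\<And>y. \<bar>h y\<bar> \<le> C"
  shows "(\<Sum>i<n. \<integral>\<omega>. h (\<omega> i) \<partial>path_law) =
    real n * (\<integral>z. h z \<partial>ladder_law) + (\<integral>\<omega>. pot h (\<omega> 0) \<partial>path_law) - (\<integral>\<omega>. pot h (\<omega> n) \<partial>path_law)"
proof (induction n)
  case (Suc n)
  interpret N: prob_space path_law by (rule prob_space_path_law)
  let ?c = "\<integral>z. h z \<partial>ladder_law"
  have ih: "integrable path_law (\<lambda>\<omega>. h (\<omega> n))" by (rule integrable_path_law[OF measurable_coordinate[OF h(1)] h(2)])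
  have ip: "integrable path_law (\<lambda>\<omega>. pot h (\<omega> n))"
    by (rule integrable_path_law[OF measurable_coordinate[OF pot_measurable[OF h]] pot_bound[OF h]])
  have "(\<integral>\<omega>. pot h (\<omega> (Suc n)) \<partial>path_law) = (\<integral>\<omega>. (pot h (\<omega> n + 1) + pot h 0) / 2 \<partial>path_law)"
    by (rule expectation_step1[OF pot_measurable[OF h] pot_bound[OF h]])
  also have "\<dots> = (\<integral>\<omega>. pot h (\<omega> n) - h (\<omega> n) + ?c \<partial>path_law)"
  proof (intro Bochner_Integration.integral_cong refl)
    show "(pot h (\<omega> n + 1) + pot h 0) / 2 = pot h (\<omega> n) - h (\<omega> n) + ?c" for \<omega> :: "nat \<Rightarrow> real"
      using pot_equation[OF h, of "\<omega> n"] pot_0[OF h] by simp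
  qed
  also have "\<dots> = (\<integral>\<omega>. pot h (\<omega> n) \<partial>path_law) - (\<integral>\<omega>. h (\<omega> n) \<partial>path_law) + ?c"
    using ih ip N.prob_space by simp
  finally show ?case using Suc by (simp add: algebra_simps)
qed simp

lemma abs_expectation_le:
  assumes "f \<in> borel_measurable path_law" "\<And>\<omega>. \<bar>f \<omega>\<bar> \<le> (B::real)"
  shows "\<bar>\<integral>\<omega>. f \<omega> \<partial>path_law\<bar> \<le> B"
  by (rule prob_space.abs_integral_le(2)[OF prob_space_path_law assms(1)]) (rule assms(2))

lemma time_average_tendsto:
  fixes h :: "real \<Rightarrow> real"
  assumes h: "h \<in> borel_measurable borel" "\<And>y. \<bar>h y\<bar> \<le> C"
  shows "(\<lambda>n. (\<Sum>i<n. \<integral>\<omega>. h (\<omega> i) \<partial>path_law) / real n) \<longlonglongrightarrow> (\<integral>z. h z \<partial>ladder_law)"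
proof -
  let ?c = "\<integral>z. h z \<partial>ladder_law" and ?D = "\<lambda>n. (\<integral>\<omega>. pot h (\<omega> 0) \<partial>path_law) - (\<integral>\<omega>. pot h (\<omega> n) \<partial>path_law)"
  have D: "\<bar>?D n\<bar> \<le> 8 * C" for n
    using abs_expectation_le[OF measurable_coordinate[OF pot_measurable[OF h]] pot_bound[OF h], of 0]
      abs_expectation_le[OF measurable_coordinate[OF pot_measurable[OF h]] pot_bound[OF h], of n] by linarith
  have "(\<lambda>n. ?D n / real n) \<longlonglongrightarrow> 0"
  proof (rule Lim_null_comparison)
    show "eventually (\<lambda>n. norm (?D n / real n) \<le> 8 * C / real n) sequentially"
      using D by (intro always_eventually allI) (simp add: abs_divide divide_right_mono)
    show "(\<lambda>n. 8 * C / real n) \<longlonglongrightarrow> 0"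
      by (rule tendsto_divide_0[OF tendsto_const filterlim_at_top_imp_at_infinity[OF filterlim_real_sequentially]])
  qed
  then have "(\<lambda>n. ?c + ?D n / real n) \<longlonglongrightarrow> ?c + 0" by (intro tendsto_add tendsto_const)
  moreover have "eventually (\<lambda>n. ?c + ?D n / real n = (\<Sum>i<n. \<integral>\<omega>. h (\<omega> i) \<partial>path_law) / real n) sequentially"
    using eventually_gt_at_top[of 0]
    by eventually_elim (simp add: expectation_sum[OF h] diff_divide_distrib add_divide_distrib)
  ultimately show ?thesis using Lim_transform_eventually by fastforce
qed

context
  fixes F :: "real \<Rightarrow> real"
  assumes F: "F \<in> borel_measurable borel" "\<And>y. \<bar>F y\<bar> \<le> 1" and mean: "(\<integral>z. F z \<partial>ladder_law) = 0"
begin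

lemma abs_S_le: "\<bar>partial_sum F n \<omega>\<bar> \<le> real n"
  by (rule ladder.abs_partial_sum_le) (use F in auto)

text \<open>\<open>S_n + pot F (\<Phi>(n))\<close> is a martingale; its squared increments have conditional mean
  \<open>(pot F (\<Phi>(n) + 1) / 2)\<^sup>2\<close>.\<close>

lemma martingale_square:
  "(\<integral>\<omega>. (partial_sum F (Suc n) \<omega> + pot F (\<omega> (Suc n)))\<^sup>2 \<partial>path_law) =
   (\<integral>\<omega>. (partial_sum F n \<omega> + pot F (\<omega> n))\<^sup>2 \<partial>path_law) + (\<integral>\<omega>. (pot F (\<omega> n + 1) / 2)\<^sup>2 \<partial>path_law)"
proof -
  let ?g = "pot F" and ?T = "partial_sum F (Suc n)"
  note mg = pot_measurable[OF F] and bg = pot_bound[OF F]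
  have mg1: "(\<lambda>y. ?g (y + 1)) \<in> borel_measurable borel" by (rule measurable_compose[OF _ mg]) measurable
  have mg2: "(\<lambda>y. (?g y)\<^sup>2) \<in> borel_measurable borel" using mg by measurable
  have bg2: "\<bar>(?g y)\<^sup>2\<bar> \<le> 16" for y using bounded_square[OF bg[of y]] by simp
  note mT = measurable_partial_sum_path_law[OF F(1), of "Suc n"]
  note m1 = measurable_coordinate[OF mg1, of n] and m' = measurable_coordinate[OF mg, of "Suc n"]
  have bT: "\<bar>?T \<omega>\<bar> \<le> real n + 1" for \<omega> using abs_S_le[of "Suc n" \<omega>] by simp
  have iT: "integrable path_law (\<lambda>\<omega>. (?T \<omega>)\<^sup>2)"
    by (rule integrable_path_law[where B="(real n + 1)\<^sup>2"]) (use mT bounded_square[OF bT] in auto)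
  have iTg: "integrable path_law (\<lambda>\<omega>. ?T \<omega> * ?g (\<omega> (Suc n)))"
  proof (rule integrable_path_law[where B="(real n + 1) * 4"])
    show "\<bar>?T \<omega> * ?g (\<omega> (Suc n))\<bar> \<le> (real n + 1) * 4" for \<omega>
      unfolding abs_mult using bT[of \<omega>] bg[of "\<omega> (Suc n)"] by (intro mult_mono) auto
  qed (use mT m' in auto)
  have iTg1: "integrable path_law (\<lambda>\<omega>. ?T \<omega> * ((?g (\<omega> n + 1) + ?g 0) / 2))"
  proof (rule integrable_path_law[where B="(real n + 1) * 4"])
    show "\<bar>?T \<omega> * ((?g (\<omega> n + 1) + ?g 0) / 2)\<bar> \<le> (real n + 1) * 4" for \<omega>
      unfolding abs_mult using bT[of \<omega>] bg[of "\<omega> n + 1"] by (intro mult_mono) (auto simp: pot_0[OF F])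
  qed (use mT m1 in auto)
  have ig: "integrable path_law (\<lambda>\<omega>. (?g (\<omega> (Suc n)))\<^sup>2)"
    by (rule integrable_path_law[where B=16]) (use m' bg2 in auto)
  have ig1: "integrable path_law (\<lambda>\<omega>. ((?g (\<omega> n + 1))\<^sup>2 + (?g 0)\<^sup>2) / 2)"
  proof (rule integrable_path_law[where B=16])
    show "\<bar>((?g (\<omega> n + 1))\<^sup>2 + (?g 0)\<^sup>2) / 2\<bar> \<le> 16" for \<omega>
      using bg2[of "\<omega> n + 1"] zero_le_power2[of "?g (\<omega> n + 1)"] pot_0[OF F] by simp
  qed (use m1 in auto)
  have iD: "integrable path_law (\<lambda>\<omega>. (partial_sum F n \<omega> + ?g (\<omega> n))\<^sup>2)"
  proof (rule integrable_path_law[where B="(real n + 4)\<^sup>2"])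
    show "\<bar>(partial_sum F n \<omega> + ?g (\<omega> n))\<^sup>2\<bar> \<le> (real n + 4)\<^sup>2" for \<omega>
      using abs_S_le[of n \<omega>] bg[of "\<omega> n"] by (intro bounded_square) linarith
  qed (use measurable_partial_sum_path_law[OF F(1), of n] measurable_coordinate[OF mg, of n] in auto)
  have iq: "integrable path_law (\<lambda>\<omega>. (?g (\<omega> n + 1) / 2)\<^sup>2)"
  proof (rule integrable_path_law[where B="2\<^sup>2"])
    show "\<bar>(?g (\<omega> n + 1) / 2)\<^sup>2\<bar> \<le> 2\<^sup>2" for \<omega>
      using bg[of "\<omega> n + 1"] by (intro bounded_square) simp
  qed (use m1 in auto)
  have "(\<integral>\<omega>. (?T \<omega> + ?g (\<omega> (Suc n)))\<^sup>2 \<partial>path_law) =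
     (\<integral>\<omega>. (?T \<omega>)\<^sup>2 + 2 * (?T \<omega> * ?g (\<omega> (Suc n))) + (?g (\<omega> (Suc n)))\<^sup>2 \<partial>path_law)"
    by (intro Bochner_Integration.integral_cong refl) (simp add: power2_sum)
  also have "\<dots> = (\<integral>\<omega>. (?T \<omega>)\<^sup>2 \<partial>path_law) + 2 * (\<integral>\<omega>. ?T \<omega> * ?g (\<omega> (Suc n)) \<partial>path_law) + (\<integral>\<omega>. (?g (\<omega> (Suc n)))\<^sup>2 \<partial>path_law)"
    using iT iTg ig by simp
  also have "(\<integral>\<omega>. ?T \<omega> * ?g (\<omega> (Suc n)) \<partial>path_law) = (\<integral>\<omega>. ?T \<omega> * ((?g (\<omega> n + 1) + ?g 0) / 2) \<partial>path_law)"
  proof (rule expectation_step[OF _ _ _ mg bg])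
    show "?T \<in> borel_measurable (PiM {0..<Suc n} (\<lambda>_. borel))"
      by (rule ladder.measurable_partial_sum(1)[OF F(1) order_refl])
    show "?T (restrict \<omega> {0..<Suc n}) = ?T \<omega>" for \<omega> by (rule ladder.partial_sum_restrict[OF order_refl])
    show "\<bar>?T \<omega>\<bar> \<le> real n + 1" for \<omega> by (rule bT)
  qed
  also have "(\<integral>\<omega>. (?g (\<omega> (Suc n)))\<^sup>2 \<partial>path_law) = (\<integral>\<omega>. ((?g (\<omega> n + 1))\<^sup>2 + (?g 0)\<^sup>2) / 2 \<partial>path_law)"
    by (rule expectation_step1[OF mg2 bg2])
  also have "(\<integral>\<omega>. (?T \<omega>)\<^sup>2 \<partial>path_law) + 2 * (\<integral>\<omega>. ?T \<omega> * ((?g (\<omega> n + 1) + ?g 0) / 2) \<partial>path_law) + (\<integral>\<omega>. ((?g (\<omega> n + 1))\<^sup>2 + (?g 0)\<^sup>2) / 2 \<partial>path_law)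
     = (\<integral>\<omega>. (?T \<omega>)\<^sup>2 + 2 * (?T \<omega> * ((?g (\<omega> n + 1) + ?g 0) / 2)) + ((?g (\<omega> n + 1))\<^sup>2 + (?g 0)\<^sup>2) / 2 \<partial>path_law)"
    using iT iTg1 ig1 by (simp del: times_divide_eq_right)
  also have "\<dots> = (\<integral>\<omega>. (partial_sum F n \<omega> + ?g (\<omega> n))\<^sup>2 + (?g (\<omega> n + 1) / 2)\<^sup>2 \<partial>path_law)"
  proof (intro Bochner_Integration.integral_cong refl)
    fix \<omega> :: "nat \<Rightarrow> real"
    have S: "partial_sum F n \<omega> + ?g (\<omega> n) = ?T \<omega> + ?g (\<omega> n + 1) / 2"
      using pot_equation[OF F, of "\<omega> n"] mean by (simp add: partial_sum_def)
    show "(?T \<omega>)\<^sup>2 + 2 * (?T \<omega> * ((?g (\<omega> n + 1) + ?g 0) / 2)) + ((?g (\<omega> n + 1))\<^sup>2 + (?g 0)\<^sup>2) / 2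
       = (partial_sum F n \<omega> + ?g (\<omega> n))\<^sup>2 + (?g (\<omega> n + 1) / 2)\<^sup>2"
      unfolding S pot_0[OF F] by (simp add: power2_eq_square field_simps)
  qed
  also have "\<dots> = (\<integral>\<omega>. (partial_sum F n \<omega> + ?g (\<omega> n))\<^sup>2 \<partial>path_law) + (\<integral>\<omega>. (?g (\<omega> n + 1) / 2)\<^sup>2 \<partial>path_law)"
    by (rule Bochner_Integration.integral_add[OF iD iq])
  finally show ?thesis .
qed

text \<open>The martingale and \<open>S_n\<close> differ by a bounded term, so their second moments differ by
  \<open>O(sqrt n)\<close>; the martingale's is a sum of expectations along the chain.\<close>

lemma variance_tendsto:
  "(\<lambda>n. prob_space.variance path_law (\<lambda>\<omega>. partial_sum F n \<omega> / sqrt (real n)))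
     \<longlonglongrightarrow> (\<integral>y. (pot F (y + 1) / 2)\<^sup>2 \<partial>ladder_law)"
proof -
  interpret N: prob_space path_law by (rule prob_space_path_law)
  let ?g = "pot F" and ?q = "\<lambda>y. (pot F (y + 1) / 2)\<^sup>2" and ?S = "partial_sum F"
  note mg = pot_measurable[OF F] and bg = pot_bound[OF F]
  have mq: "?q \<in> borel_measurable borel"
  proof -
    have "(\<lambda>y. ?g (y + 1)) \<in> borel_measurable borel" by (rule measurable_compose[OF _ mg]) measurable
    then show ?thesis by measurable
  qed
  have bq: "\<bar>?q y\<bar> \<le> 2\<^sup>2" for y using bg[of "y + 1"] by (intro bounded_square) simp
  define Z where "Z n \<omega> = ?S n \<omega> + ?g (\<omega> n)" for n \<omega>
  have mS: "?S n \<in> borel_measurable path_law" for n by (rule measurable_partial_sum_path_law[OF F(1)])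
  have mgn: "(\<lambda>\<omega>. ?g (\<omega> n)) \<in> borel_measurable path_law" for n by (rule measurable_coordinate[OF mg])
  have mZ: "Z n \<in> borel_measurable path_law" for n unfolding Z_def[abs_def] using mS mgn by measurable
  have bZ: "\<bar>Z n \<omega>\<bar> \<le> real n + 4" for n \<omega>
    unfolding Z_def using abs_S_le[of n \<omega>] bg[of "\<omega> n"] by linarith
  have iS: "integrable path_law (?S n)" for n by (rule integrable_path_law[OF mS abs_S_le])
  have iS2: "integrable path_law (\<lambda>\<omega>. (?S n \<omega>)\<^sup>2)" for n
    by (rule integrable_path_law[where B="(real n)\<^sup>2"]) (use mS bounded_square[OF abs_S_le] in auto)
  have iZ2: "integrable path_law (\<lambda>\<omega>. (Z n \<omega>)\<^sup>2)" for n
    by (rule integrable_path_law[where B="(real n + 4)\<^sup>2"]) (use mZ bounded_square[OF bZ] in auto)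
  have iZa: "integrable path_law (\<lambda>\<omega>. \<bar>Z n \<omega>\<bar>)" for n by (intro integrable_abs integrable_path_law[OF mZ bZ])
  have ES: "\<bar>\<integral>\<omega>. ?S n \<omega> \<partial>path_law\<bar> \<le> 8" for n
  proof -
    have "(\<integral>\<omega>. ?S n \<omega> \<partial>path_law) = (\<Sum>i<n. \<integral>\<omega>. F (\<omega> i) \<partial>path_law)"
      unfolding partial_sum_def by (intro Bochner_Integration.integral_sum integrable_path_law[OF measurable_coordinate[OF F(1)] F(2)])
    also have "\<dots> = (\<integral>\<omega>. ?g (\<omega> 0) \<partial>path_law) - (\<integral>\<omega>. ?g (\<omega> n) \<partial>path_law)" unfolding expectation_sum[OF F] mean by simp
    finally show ?thesis
      using abs_expectation_le[OF mgn bg, of 0] abs_expectation_le[OF mgn bg, of n] by linarith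
  qed
  define V where "V n = (\<integral>\<omega>. (Z n \<omega>)\<^sup>2 \<partial>path_law)" for n
  have V0: "0 \<le> V n" for n unfolding V_def by (intro Bochner_Integration.integral_nonneg) simp
  have V: "V n = V 0 + (\<Sum>i<n. \<integral>\<omega>. ?q (\<omega> i) \<partial>path_law)" for n
    unfolding V_def Z_def by (induction n) (simp_all add: martingale_square)
  have n_inf: "filterlim (\<lambda>n. real n) at_infinity sequentially"
    by (rule filterlim_at_top_imp_at_infinity[OF filterlim_real_sequentially])
  let ?c = "\<integral>y. ?q y \<partial>ladder_law"
  have Vlim: "(\<lambda>n. V n / real n) \<longlonglongrightarrow> ?c"
  proof -
    have "(\<lambda>n. V 0 / real n + (\<Sum>i<n. \<integral>\<omega>. ?q (\<omega> i) \<partial>path_law) / real n) \<longlonglongrightarrow> 0 + ?c"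
      by (intro tendsto_add tendsto_divide_0[OF tendsto_const n_inf] time_average_tendsto[OF mq bq])
    moreover have "V 0 / real n + (\<Sum>i<n. \<integral>\<omega>. ?q (\<omega> i) \<partial>path_law) / real n = V n / real n" for n
      unfolding add_divide_distrib[symmetric] V[of n, symmetric] ..
    ultimately show ?thesis by simp
  qed
  have EZ: "(\<integral>\<omega>. \<bar>Z n \<omega>\<bar> \<partial>path_law) \<le> sqrt (V n)" for n
  proof -
    have "0 \<le> N.variance (\<lambda>\<omega>. \<bar>Z n \<omega>\<bar>)" by (rule N.variance_positive)
    also have "\<dots> = V n - (\<integral>\<omega>. \<bar>Z n \<omega>\<bar> \<partial>path_law)\<^sup>2"
      unfolding V_def using iZa[of n] iZ2[of n] by (subst N.variance_eq) simp_all
    finally have "(\<integral>\<omega>. \<bar>Z n \<omega>\<bar> \<partial>path_law)\<^sup>2 \<le> V n" by simp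
    then show ?thesis by (rule real_le_rsqrt)
  qed
  have close: "\<bar>(\<integral>\<omega>. (?S n \<omega>)\<^sup>2 \<partial>path_law) - V n\<bar> \<le> 8 * sqrt (V n) + 16" for n
  proof -
    have "(\<integral>\<omega>. (?S n \<omega>)\<^sup>2 \<partial>path_law) - V n = (\<integral>\<omega>. (?S n \<omega>)\<^sup>2 - (Z n \<omega>)\<^sup>2 \<partial>path_law)"
      unfolding V_def using iS2 iZ2 by simp
    also have "\<bar>\<dots>\<bar> \<le> (\<integral>\<omega>. \<bar>(?S n \<omega>)\<^sup>2 - (Z n \<omega>)\<^sup>2\<bar> \<partial>path_law)" by (rule integral_abs_bound)
    also have "\<dots> \<le> (\<integral>\<omega>. 8 * \<bar>Z n \<omega>\<bar> + 16 \<partial>path_law)"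
    proof (rule integral_mono)
      show "integrable path_law (\<lambda>\<omega>. \<bar>(?S n \<omega>)\<^sup>2 - (Z n \<omega>)\<^sup>2\<bar>)" using iS2 iZ2 by simp
      show "integrable path_law (\<lambda>\<omega>. 8 * \<bar>Z n \<omega>\<bar> + 16)" using iZa by simp
      fix \<omega>
      have "(?S n \<omega>)\<^sup>2 - (Z n \<omega>)\<^sup>2 = ?g (\<omega> n) * (?g (\<omega> n) - 2 * Z n \<omega>)"
        unfolding Z_def by (simp add: power2_eq_square algebra_simps)
      also have "\<bar>\<dots>\<bar> \<le> 4 * (4 + 2 * \<bar>Z n \<omega>\<bar>)"
        unfolding abs_mult using bg[of "\<omega> n"] by (intro mult_mono) linarith+
      finally show "\<bar>(?S n \<omega>)\<^sup>2 - (Z n \<omega>)\<^sup>2\<bar> \<le> 8 * \<bar>Z n \<omega>\<bar> + 16" by simp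
    qed
    also have "\<dots> = 8 * (\<integral>\<omega>. \<bar>Z n \<omega>\<bar> \<partial>path_law) + 16" using iZa N.prob_space by simp
    finally show ?thesis using EZ[of n] by simp
  qed
  have var: "N.variance (\<lambda>\<omega>. ?S n \<omega> / sqrt (real n)) = (\<integral>\<omega>. (?S n \<omega>)\<^sup>2 \<partial>path_law) / real n - (\<integral>\<omega>. ?S n \<omega> \<partial>path_law)\<^sup>2 / real n" for n
    using iS[of n] iS2[of n] by (subst N.variance_eq) (simp_all add: power_divide)
  have err: "(\<lambda>n. N.variance (\<lambda>\<omega>. ?S n \<omega> / sqrt (real n)) - V n / real n) \<longlonglongrightarrow> 0"
  proof (rule Lim_null_comparison)
    show "eventually (\<lambda>n. norm (N.variance (\<lambda>\<omega>. ?S n \<omega> / sqrt (real n)) - V n / real n)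
        \<le> 8 * (sqrt (V n / real n) * (1 / sqrt (real n))) + 80 / real n) sequentially"
      using eventually_gt_at_top[of 0]
    proof eventually_elim
      case (elim n)
      let ?s = "\<integral>\<omega>. ?S n \<omega> \<partial>path_law" and ?t = "\<integral>\<omega>. (?S n \<omega>)\<^sup>2 \<partial>path_law"
      have sq: "?s\<^sup>2 \<le> 64" using bounded_square[OF ES[of n]] by simp
      have "N.variance (\<lambda>\<omega>. ?S n \<omega> / sqrt (real n)) - V n / real n = (?t - V n - ?s\<^sup>2) / real n"
        unfolding var by (simp add: diff_divide_distrib)
      moreover have "\<bar>?t - V n - ?s\<^sup>2\<bar> \<le> 8 * sqrt (V n) + 80" using close[of n] sq zero_le_power2[of ?s] by linarith
      ultimately have "norm (N.variance (\<lambda>\<omega>. ?S n \<omega> / sqrt (real n)) - V n / real n) \<le> (8 * sqrt (V n) + 80) / real n"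
        by (simp add: abs_divide divide_right_mono)
      also have "\<dots> = 8 * (sqrt (V n / real n) * (1 / sqrt (real n))) + 80 / real n"
        using elim by (simp add: real_sqrt_divide add_divide_distrib)
      finally show ?case .
    qed
    have s_inf: "filterlim (\<lambda>n. sqrt (real n)) at_infinity sequentially"
      by (rule filterlim_at_top_imp_at_infinity[OF filterlim_compose[OF sqrt_at_top filterlim_real_sequentially]])
    have "(\<lambda>n. 8 * (sqrt (V n / real n) * (1 / sqrt (real n))) + 80 / real n) \<longlonglongrightarrow> 8 * (sqrt ?c * 0) + 0"
      by (intro tendsto_add tendsto_mult tendsto_const tendsto_real_sqrt Vlim tendsto_divide_0[OF tendsto_const s_inf]
          tendsto_divide_0[OF tendsto_const n_inf])
    then show "(\<lambda>n. 8 * (sqrt (V n / real n) * (1 / sqrt (real n))) + 80 / real n) \<longlonglongrightarrow> 0" by simp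
  qed
  from tendsto_add[OF err Vlim] show ?thesis by simp
qed

end

end

text \<open>If the mean vanished, then \<open>pot F\<close> would vanish at every natural number, and so would
  \<open>F\<close> by Poisson's equation.\<close>

lemma mean_square_pos:
  assumes F: "F \<in> borel_measurable borel" "\<And>y. \<bar>F y\<bar> \<le> 1" and mean: "(\<integral>z. F z \<partial>ladder_law) = 0"
    and m: "F (real m) \<noteq> 0"
  shows "0 < (\<integral>y. (pot F (y + 1) / 2)\<^sup>2 \<partial>ladder_law)"
proof -
  let ?q = "\<lambda>y. (pot F (y + 1) / 2)\<^sup>2"
  have mq: "?q \<in> borel_measurable borel"
  proof -
    have "(\<lambda>y. pot F (y + 1)) \<in> borel_measurable borel" by (rule measurable_compose[OF _ pot_measurable[OF F]]) measurable
    then show ?thesis by measurable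
  qed
  have bq: "\<bar>?q y\<bar> \<le> 2\<^sup>2" for y using pot_bound[OF F, of "y + 1"] by (intro bounded_square) simp
  note sums = integral_ladder_law[OF mq bq]
  have "\<exists>n. pot F (real n + 1) \<noteq> 0"
  proof (rule ccontr)
    assume "\<not> (\<exists>n. pot F (real n + 1) \<noteq> 0)"
    then have z: "pot F (real n + 1) = 0" for n by simp
    have "pot F (real n) = 0" for n
    proof (cases n)
      case 0 then show ?thesis using pot_0[OF F] by simp
    next
      case (Suc k) then show ?thesis using z[of k] by (simp add: add.commute)
    qed
    then have "F (real m) = 0" using pot_equation[OF F, of "real m"] z[of m] mean by simp
    then show False using m by simp
  qed
  then obtain n where n: "pot F (real n + 1) \<noteq> 0" by blast
  have "0 < (\<Sum>n. (1/2) ^ Suc n * ?q (real n))"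
    by (rule suminf_pos2[OF sums_summable[OF sums], of n]) (use n in auto)
  then show ?thesis using sums_unique[OF sums] by simp
qed


section \<open>Sparse blocks destroy the large deviations principle\<close>

text \<open>The ratios \<open>block (j + 1) / block j\<close> tend to infinity, so at times comparable to
  \<open>block j\<close> the next block is out of reach except with superexponentially small probability.\<close>

definition block :: "nat \<Rightarrow> nat" where
  "block j = fact (j + 3)"

definition blocks :: "real set" where
  "blocks = (\<Union>j. {real (block j)..<real (2 * block j)})"

lemma block_Suc: "block (Suc j) = (j + 4) * block j"
proof -
  have "Suc j + 3 = Suc (j + 3)" by simp
  then show ?thesis unfolding block_def by (simp only: fact_Suc) simp
qed

lemma block_pos: "0 < block j"
  unfolding block_def by simp

lemma two_block_le: "2 * block j \<le> block (Suc j)"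
  unfolding block_Suc by (intro mult_right_mono) auto

lemma block_mono: "i \<le> j \<Longrightarrow> block i \<le> block j"
proof (rule lift_Suc_mono_le[of block])
  show "block n \<le> block (Suc n)" for n using two_block_le[of n] by linarith
qed

lemma le_block: "j \<le> block j"
proof (induction j)
  case (Suc j)
  then show ?case using two_block_le[of j] block_pos[of j] by linarith
qed simp

lemma nat_in_blocks: "real i \<in> blocks \<longleftrightarrow> (\<exists>j. block j \<le> i \<and> i < 2 * block j)"
  unfolding blocks_def by auto

lemma block_0_le:
  assumes "real i \<in> blocks"
  shows "block 0 \<le> i"
proof -
  obtain j where "block j \<le> i" using assms unfolding nat_in_blocks by blast
  then show ?thesis using block_mono[of 0 j] by simp
qed

lemma in_blocks_cases:
  assumes "real i \<in> blocks" "i < block (Suc j)"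
  shows "i < block j \<or> (block j \<le> i \<and> i < 2 * block j)"
proof -
  obtain k where k: "block k \<le> i" "i < 2 * block k" using assms(1) unfolding nat_in_blocks by blast
  have "k \<le> j"
  proof (rule ccontr)
    assume "\<not> k \<le> j"
    then have "block (Suc j) \<le> block k" by (intro block_mono) simp
    then show False using k assms(2) by simp
  qed
  show ?thesis
  proof (cases "k = j")
    case False
    then have "block (Suc k) \<le> block j" using \<open>k \<le> j\<close> by (intro block_mono) simp
    then show ?thesis using k two_block_le[of k] by simp
  qed (use k in simp)
qed

definition visits :: "nat \<Rightarrow> nat" where
  "visits h = card {i. i < h \<and> real i \<in> blocks}"

lemma visits_0: "visits 0 = 0"
  unfolding visits_def by simp

lemma visits_Suc: "visits (Suc h) = visits h + (if real h \<in> blocks then 1 else 0)"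
proof -
  have "{i. i < Suc h \<and> real i \<in> blocks} = {i. i < h \<and> real i \<in> blocks} \<union> (if real h \<in> blocks then {h} else {})"
    by (auto simp: less_Suc_eq)
  then show ?thesis unfolding visits_def by (simp add: card_insert_if)
qed

lemma visits_le:
  assumes "h \<le> block (Suc j)"
  shows "visits h \<le> visits (block j) + (min h (2 * block j) - block j)"
proof -
  have "{i. i < h \<and> real i \<in> blocks} \<subseteq> {i. i < block j \<and> real i \<in> blocks} \<union> {block j..<min h (2 * block j)}"
    using in_blocks_cases[of _ j] assms by fastforce
  then have "visits h \<le> card ({i. i < block j \<and> real i \<in> blocks} \<union> {block j..<min h (2 * block j)})"
    unfolding visits_def by (intro card_mono) auto
  also have "\<dots> \<le> card {i. i < block j \<and> real i \<in> blocks} + card {block j..<min h (2 * block j)}"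
    by (rule card_Un_le)
  finally show ?thesis unfolding visits_def by simp
qed

lemma visits_block: "3 * visits (block j) \<le> block j"
proof (induction j)
  case 0
  have e: "{i. i < block 0 \<and> real i \<in> blocks} = {}"
    by (auto dest: block_0_le)
  show ?case unfolding visits_def e by simp
next
  case (Suc j)
  have "visits (block (Suc j)) \<le> visits (block j) + block j"
    using visits_le[of "block (Suc j)" j] two_block_le[of j] by simp
  then have "3 * visits (block (Suc j)) \<le> 4 * block j" using Suc by simp
  also have "\<dots> \<le> block (Suc j)" unfolding block_Suc by (intro mult_right_mono) auto
  finally show ?case .
qed

lemma visits_le_2_block: "h \<le> block (Suc j) \<Longrightarrow> visits h \<le> 2 * block j"
  using visits_le[of h j] visits_block[of j] by auto

lemma visits_density: "4 * visits h \<le> 3 * h"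
proof -
  have "\<forall>h\<le>block j. 4 * visits h \<le> 3 * h" for j
  proof (induction j)
    case 0
    show ?case
    proof (intro allI impI)
      fix h assume h: "h \<le> block 0"
      have e: "{i. i < h \<and> real i \<in> blocks} = {}"
        using h by (auto dest: block_0_le)
      show "4 * visits h \<le> 3 * h" unfolding visits_def e by simp
    qed
  next
    case (Suc j)
    show ?case
    proof (intro allI impI)
      fix h assume h: "h \<le> block (Suc j)"
      show "4 * visits h \<le> 3 * h"
      proof (cases "h \<le> block j")
        case True then show ?thesis using Suc by blast
      next
        case False
        then show ?thesis using visits_le[OF h] visits_block[of j] by (cases "h \<le> 2 * block j") (auto simp: min_def)
      qed
    qed
  qed
  from this[of h] show ?thesis using le_block[of h] by blast
qed

text \<open>A trajectory from the rung \<open>m\<close> climbs for some \<open>h\<close> steps before its first fall; afterwards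
  every climb starts at \<open>0\<close>, where the blocks have density at most \<open>3/4\<close>.\<close>

lemma path_visits:
  fixes \<omega> :: "nat \<Rightarrow> real"
  assumes "\<omega> 0 = real m" "\<And>i. \<omega> (Suc i) = \<omega> i + 1 \<or> \<omega> (Suc i) = 0"
  shows "\<exists>h\<le>n. (\<Sum>i<n. indicat_real blocks (\<omega> i)) \<le> 3/4 * real (n - h) + (real (visits (m + h)) - real (visits m))"
  using assms
proof (induction n arbitrary: \<omega> m)
  case (Suc n)
  have sum: "(\<Sum>i<Suc n. indicat_real blocks (\<omega> i)) = indicat_real blocks (real m) + (\<Sum>i<n. indicat_real blocks (\<omega> (Suc i)))"
    unfolding sum.lessThan_Suc_shift using Suc.prems(1) by simp
  have ind: "indicat_real blocks (real m) = real (visits (Suc m)) - real (visits m)"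
    by (simp add: visits_Suc)
  consider "\<omega> (Suc 0) = real (Suc m)" | "\<omega> (Suc 0) = real 0"
    using Suc.prems(1) Suc.prems(2)[of 0] by (auto simp: add.commute)
  then show ?case
  proof cases
    case 1
    from Suc.IH[of "\<lambda>i. \<omega> (Suc i)", OF 1] Suc.prems(2)
    obtain h where h: "h \<le> n" "(\<Sum>i<n. indicat_real blocks (\<omega> (Suc i)))
        \<le> 3/4 * real (n - h) + (real (visits (Suc m + h)) - real (visits (Suc m)))" by blast
    then show ?thesis unfolding sum ind by (intro exI[of _ "Suc h"]) auto
  next
    case 2
    from Suc.IH[of "\<lambda>i. \<omega> (Suc i)", OF 2] Suc.prems(2)
    obtain h where h: "h \<le> n" "(\<Sum>i<n. indicat_real blocks (\<omega> (Suc i)))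
        \<le> 3/4 * real (n - h) + (real (visits (0 + h)) - real (visits 0))" by blast
    have "4 * real (visits h) \<le> 3 * real h" using visits_density[of h] by linarith
    moreover have "real (n - h) = real n - real h" using h(1) by (rule of_nat_diff)
    ultimately have "(\<Sum>i<n. indicat_real blocks (\<omega> (Suc i))) \<le> 3/4 * real n"
      using h(2) unfolding visits_0 add_0_left by linarith
    then show ?thesis unfolding sum ind by (intro exI[of _ 1]) auto
  qed
qed (auto simp: visits_0)

definition block_density :: real where
  "block_density = (\<integral>x. indicator blocks x \<partial>ladder_law)"

definition block_functional :: "real \<Rightarrow> real" where
  "block_functional x = indicator blocks x - block_density"

lemma blocks_measurable [measurable]: "blocks \<in> sets borel"
  unfolding blocks_def by (intro sets.countable_UN) auto

lemma ladder_law_prob_space: "prob_space ladder_law"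
  using ladder_law_prob by (simp add: space_prob_algebra)

lemma sets_ladder_law: "sets ladder_law = sets borel"
  unfolding ladder_law_def by simp

lemma block_density_bounds: "0 \<le> block_density" "block_density \<le> 1"
proof -
  interpret prob_space ladder_law by (rule ladder_law_prob_space)
  have e: "block_density = prob blocks"
    unfolding block_density_def using sets_ladder_law by simp
  show "0 \<le> block_density" unfolding e by (rule measure_nonneg)
  show "block_density \<le> 1" unfolding e by (rule prob_le_1)
qed

lemma block_functional_measurable: "block_functional \<in> borel_measurable borel"
  unfolding block_functional_def[abs_def] by measurable

lemma abs_block_functional_le: "\<bar>block_functional x\<bar> \<le> 1"
  unfolding block_functional_def using block_density_bounds by (auto simp: indicator_def)

lemma block_functional_mean: "(\<integral>x. block_functional x \<partial>ladder_law) = 0"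
proof -
  interpret prob_space ladder_law by (rule ladder_law_prob_space)
  have "integrable ladder_law (indicat_real blocks)"
    by (rule integrable_const_bound[where B=1]) (auto simp: measurable_cong_sets[OF sets_ladder_law refl])
  then have "(\<integral>x. block_functional x \<partial>ladder_law) = block_density - block_density"
    unfolding block_functional_def block_density_def using prob_space by simp
  then show ?thesis by simp
qed

lemma block_functional_nonzero: "\<exists>m. block_functional (real m) \<noteq> 0"
proof -
  have "real (block 0) \<in> blocks" unfolding nat_in_blocks using block_pos[of 0] by (intro exI[of _ 0]) auto
  moreover have "real 0 \<notin> blocks" unfolding nat_in_blocks using block_pos by auto
  ultimately have "block_functional (real (block 0)) \<noteq> block_functional (real 0)" unfolding block_functional_def by simp
  then show ?thesis by metis
qed

lemma ladder_functional:
  "doeblin_functional borel ladder ((1 - exp (-1)) * exp (-1) / 2) (return borel 0) ladder_law block_functional"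
proof (intro doeblin_functional.intro ladder_doeblin doeblin_functional_axioms.intro)
  show "invariant_prob borel ladder ladder_law" by (rule ladder_law_invariant)
  show "block_functional \<in> borel_measurable borel" by (rule block_functional_measurable)
  show "block_functional x \<in> {-1..1}" for x using abs_block_functional_le[of x] by (auto simp: abs_le_iff)
  show "(\<integral>x. block_functional x \<partial>ladder_law) = 0" by (rule block_functional_mean)
  note F = block_functional_measurable abs_block_functional_le block_functional_mean
  show "\<exists>v>0. has_asymptotic_variance borel ladder block_functional v"
  proof (intro exI conjI)
    obtain m where m: "block_functional (real m) \<noteq> 0" using block_functional_nonzero by blast
    show "0 < (\<integral>y. (pot block_functional (y + 1) / 2)\<^sup>2 \<partial>ladder_law)" by (rule mean_square_pos[OF F m])
    show "has_asymptotic_variance borel ladder block_functional (\<integral>y. (pot block_functional (y + 1) / 2)\<^sup>2 \<partial>ladder_law)"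
      unfolding has_asymptotic_variance_def
    proof
      fix x :: real
      have "return borel x \<in> space (prob_algebra (borel :: real measure))" by (simp add: space_prob_algebra prob_space_return)
      from variance_tendsto[OF this F]
      show "(\<lambda>n. prob_space.variance (chain_law borel ladder (return borel x)) (\<lambda>\<omega>. partial_sum block_functional n \<omega> / sqrt (real n)))
        \<longlonglongrightarrow> (\<integral>y. (pot block_functional (y + 1) / 2)\<^sup>2 \<partial>ladder_law)" .
    qed
  qed
qed


text \<open>With \<open>m = n = block j\<close> and \<open>k = n - 1\<close> the probability is \<open>4\<^sup>-\<^sup>n\<close>: starting at the foot of
  a block and climbing through it, the path spends all its \<open>n\<close> steps inside at an exponential
  cost of bounded rate.\<close>

lemma climb_probability:
  "measure (chain_law borel ladder ladder_law) {\<omega> \<in> UNIV \<rightarrow> UNIV. \<forall>i<Suc k. \<omega> i = real (m + i)} = (1/2) ^ (Suc m + k)"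
proof -
  let ?N = "chain_law borel ladder ladder_law"
  note \<mu> = ladder_law_prob
  have sp: "space ?N = UNIV" using ladder.space_chain_law[OF \<mu>] by simp
  define G where "G k \<omega> = (\<Prod>i<Suc k. indicat_real {real (m + i)} (\<omega> i))" for k and \<omega> :: "nat \<Rightarrow> real"
  have mG: "G k \<in> borel_measurable (PiM I (\<lambda>_. borel))" if "{0..<Suc k} \<subseteq> I" for k I
    unfolding G_def[abs_def]
  proof (rule borel_measurable_prod)
    fix i assume "i \<in> {..<Suc k}"
    then have i: "i \<in> I" using that by auto
    show "(\<lambda>\<omega>. indicat_real {real (m + i)} (\<omega> i)) \<in> borel_measurable (PiM I (\<lambda>_. borel))"
      by (rule measurable_compose[OF measurable_component_singleton[OF i]]) measurable
  qed
  have G01: "\<bar>G k \<omega>\<bar> \<le> 1" for k \<omega>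
    unfolding G_def abs_prod by (rule prod_le_1) (auto simp: indicator_def)
  have G_int: "(\<integral>\<omega>. G k \<omega> \<partial>?N) = (1/2) ^ (Suc m + k)" for k
  proof (induction k)
    case 0
    have "(\<integral>\<omega>. G 0 \<omega> \<partial>?N) = (\<integral>\<omega>. indicat_real {real m} (\<omega> 0) \<partial>?N)" unfolding G_def by simp
    also have "\<dots> = (\<integral>x. indicat_real {real m} x \<partial>ladder_law)"
      by (rule ladder.integral_chain_law_0[OF \<mu>]) measurable
    also have "\<dots> = (\<Sum>n. (1/2) ^ Suc n * indicat_real {real m} (real n))"
      by (rule sums_unique[OF integral_ladder_law[where C=1]]) (auto simp: indicator_def)
    also have "\<dots> = (\<Sum>n\<in>{m}. (1/2) ^ Suc n * indicat_real {real m} (real n))"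
      by (rule suminf_finite) (auto simp: indicator_def)
    finally show ?case by simp
  next
    case (Suc k)
    let ?f = "indicat_real {real (m + Suc k)}"
    have "(\<integral>\<omega>. G (Suc k) \<omega> \<partial>?N) = (\<integral>\<omega>. G k \<omega> * ?f (\<omega> (Suc k)) \<partial>?N)"
      unfolding G_def by (subst prod.lessThan_Suc) simp
    also have "\<dots> = (\<integral>\<omega>. G k \<omega> * ((?f (\<omega> k + 1) + ?f 0) / 2) \<partial>?N)"
    proof (rule expectation_step[OF \<mu> mG _ G01])
      show "G k (restrict \<omega> {0..<Suc k}) = G k \<omega>" for \<omega>
        unfolding G_def by (intro prod.cong) auto
      show "\<bar>?f y\<bar> \<le> 1" for y by (simp add: indicator_def)
    qed auto
    also have "\<dots> = (\<integral>\<omega>. (1/2) * G k \<omega> \<partial>?N)"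
    proof (intro Bochner_Integration.integral_cong refl)
      fix \<omega> :: "nat \<Rightarrow> real"
      show "G k \<omega> * ((?f (\<omega> k + 1) + ?f 0) / 2) = (1/2) * G k \<omega>"
      proof (cases "\<omega> k = real (m + k)")
        case False
        then have "G k \<omega> = 0" unfolding G_def by (intro prod_zero bexI[of _ k]) auto
        then show ?thesis by simp
      qed (simp add: indicator_def)
    qed
    finally show ?case using Suc by simp
  qed
  have G_eq: "G k = indicat_real {\<omega>. \<forall>i<Suc k. \<omega> i = real (m + i)}"
  proof
    fix \<omega> :: "nat \<Rightarrow> real"
    show "G k \<omega> = indicat_real {\<omega>. \<forall>i<Suc k. \<omega> i = real (m + i)} \<omega>"
    proof (cases "\<forall>i<Suc k. \<omega> i = real (m + i)")
      case True then show ?thesis unfolding G_def by simp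
    next
      case False
      then obtain i where i: "i < Suc k" "\<omega> i \<noteq> real (m + i)" by blast
      then have "G k \<omega> = 0" unfolding G_def by (intro prod_zero bexI[of _ i]) auto
      then show ?thesis using False by simp
    qed
  qed
  have A: "{\<omega>. \<forall>i<Suc k. \<omega> i = real (m + i)} \<in> sets ?N"
  proof -
    have "G k \<in> borel_measurable ?N" unfolding ladder.measurable_chain_law[OF \<mu>] by (rule mG) simp
    then have "G k -` {1} \<inter> space ?N \<in> sets ?N" by (rule measurable_sets) simp
    moreover have "G k -` {1} \<inter> space ?N = {\<omega>. \<forall>i<Suc k. \<omega> i = real (m + i)}"
      unfolding G_eq sp by (auto simp: indicator_def)
    ultimately show ?thesis by simp
  qed
  have "measure ?N {\<omega>. \<forall>i<Suc k. \<omega> i = real (m + i)} = (\<integral>\<omega>. G k \<omega> \<partial>?N)"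
    unfolding G_eq Bochner_Integration.integral_indicator sp by simp
  then show ?thesis unfolding G_int by (simp add: Pi_def)
qed

lemma AE_ladder_steps:
  "AE \<omega> in chain_law borel ladder ladder_law. \<forall>i. \<omega> (Suc i) = \<omega> i + 1 \<or> \<omega> (Suc i) = 0"
proof (subst AE_all_countable, rule allI)
  fix n
  let ?N = "chain_law borel ladder ladder_law"
  note \<mu> = ladder_law_prob
  interpret N: prob_space ?N by (rule ladder.prob_space_chain_law[OF \<mu>])
  define H :: "(nat \<Rightarrow> real) \<Rightarrow> real" where
    "H \<omega> = (if \<omega> (Suc n) = \<omega> n + 1 \<or> \<omega> (Suc n) = 0 then 0 else 1)" for \<omega>
  have mH: "H \<in> borel_measurable (PiM I (\<lambda>_. borel))" if "{0..<Suc (Suc n)} \<subseteq> I" for I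
  proof -
    have "(\<lambda>\<omega>. \<omega> n) \<in> borel_measurable (PiM I (\<lambda>_. borel :: real measure))"
      "(\<lambda>\<omega>. \<omega> (Suc n)) \<in> borel_measurable (PiM I (\<lambda>_. borel :: real measure))"
      using that by (auto intro!: measurable_component_singleton)
    moreover have "(\<lambda>\<omega>. if v \<omega> = u \<omega> + 1 \<or> v \<omega> = 0 then 0 else 1 :: real) \<in> borel_measurable (PiM I (\<lambda>_. borel))"
      if "u \<in> borel_measurable (PiM I (\<lambda>_. borel))" "v \<in> borel_measurable (PiM I (\<lambda>_. borel))"
      for u v :: "(nat \<Rightarrow> real) \<Rightarrow> real"
    proof (rule measurable_If)
      let ?X = "PiM I (\<lambda>_. borel :: real measure)"
      have "{x \<in> space ?X. v x = u x + 1} \<in> sets ?X" "{x \<in> space ?X. v x = 0} \<in> sets ?X"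
        using that by (auto intro!: borel_measurable_eq)
      then have "{x \<in> space ?X. v x = u x + 1} \<union> {x \<in> space ?X. v x = 0} \<in> sets ?X" by (rule sets.Un)
      then show "{x \<in> space ?X. v x = u x + 1 \<or> v x = 0} \<in> sets ?X"
        by (simp add: Collect_disj_eq[symmetric] conj_disj_distribL[symmetric])
    qed simp_all
    ultimately show ?thesis unfolding H_def[abs_def] by blast
  qed
  have "(\<integral>\<omega>. H \<omega> \<partial>?N) = (\<integral>\<omega>. H (restrict \<omega> {0..<Suc (Suc n)}) \<partial>?N)" unfolding H_def by simp
  also have "\<dots> = (\<integral>\<omega>. (\<integral>y. H ((restrict \<omega> {0..<Suc n})(Suc n := y)) \<partial>ladder (\<omega> n)) \<partial>?N)"
    by (rule ladder.integral_chain_law_Suc[OF \<mu> mH, where B=1]) (auto simp: H_def)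
  also have "\<dots> = (\<integral>\<omega>. 0 \<partial>?N)"
  proof (intro Bochner_Integration.integral_cong refl)
    fix \<omega> :: "nat \<Rightarrow> real"
    have "(\<integral>y. H ((restrict \<omega> {0..<Suc n})(Suc n := y)) \<partial>ladder (\<omega> n)) = (\<integral>y. (if y = \<omega> n + 1 \<or> y = 0 then 0 else 1) \<partial>ladder (\<omega> n))"
      unfolding H_def by simp
    also have "\<dots> = 0" by (subst integral_ladder) simp_all
    finally show "(\<integral>y. H ((restrict \<omega> {0..<Suc n})(Suc n := y)) \<partial>ladder (\<omega> n)) = 0" .
  qed
  finally have z: "(\<integral>\<omega>. H \<omega> \<partial>?N) = 0" by simp
  have "integrable ?N H"
  proof (rule N.integrable_const_bound[where B=1])
    show "H \<in> borel_measurable ?N" unfolding ladder.measurable_chain_law[OF \<mu>] by (rule mH) simp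
  qed (simp add: H_def)
  then have "AE \<omega> in ?N. H \<omega> = 0"
    using z by (subst (asm) integral_nonneg_eq_0_iff_AE) (auto simp: H_def)
  then show "AE \<omega> in ?N. \<omega> (Suc n) = \<omega> n + 1 \<or> \<omega> (Suc n) = 0"
    by eventually_elim (auto simp: H_def split: if_splits)
qed

text \<open>A start at or below \<open>t = block (j + 1) - n\<close> confines the first climb to blocks of total length
  at most \<open>2 block j = n / 16\<close>, and the later climbs add at most \<open>3/4 n\<close> visits, in total at
  most \<open>13/16 n\<close>. A start above \<open>t = (j - 28) block j\<close> has probability \<open>2\<^sup>-\<^sup>t\<^sup>-\<^sup>1\<close>.\<close>

lemma many_visits_probability:
  assumes j: "28 \<le> j"
  defines "n \<equiv> 32 * block j"
  shows "measure (chain_law borel ladder ladder_law)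
     {\<omega> \<in> UNIV \<rightarrow> UNIV. 13/16 * real n < (\<Sum>i<n. indicat_real blocks (\<omega> i))} \<le> (1/2) ^ ((j - 28) * block j)"
proof -
  let ?N = "chain_law borel ladder ladder_law"
  note \<mu> = ladder_law_prob
  interpret N: prob_space ?N by (rule ladder.prob_space_chain_law[OF \<mu>])
  interpret L: prob_space ladder_law by (rule ladder_law_prob_space)
  have sp: "space ?N = UNIV" using ladder.space_chain_law[OF \<mu>] by simp
  define t where "t = (j - 28) * block j"
  have t: "t + n = block (Suc j)"
  proof -
    have "j - 28 + 32 = j + 4" using j by simp
    then show ?thesis unfolding t_def n_def block_Suc by (simp add: algebra_simps flip: add_mult_distrib)
  qed
  have m0: "(\<lambda>\<omega>. \<omega> 0) \<in> borel_measurable ?N"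
    unfolding ladder.measurable_chain_law[OF \<mu>] by (rule measurable_component_singleton) simp
  have mS: "(\<lambda>\<omega>. \<Sum>i<n. indicat_real blocks (\<omega> i)) \<in> borel_measurable ?N"
    by (intro borel_measurable_sum measurable_coordinate[OF \<mu>]) measurable
  have start: "N.prob {\<omega>. P (\<omega> 0)} = (\<Sum>n. (1/2) ^ Suc n * indicat_real {x. P x} (real n))" if P: "{x. P x} \<in> sets borel" for P
  proof -
    have "{\<omega>. P (\<omega> 0)} = (\<lambda>\<omega>. \<omega> 0) -` {x. P x} \<inter> space ?N" using sp by auto
    then have s: "{\<omega>. P (\<omega> 0)} \<in> sets ?N" using measurable_sets[OF m0 P] by simp
    have "N.prob {\<omega>. P (\<omega> 0)} = (\<integral>\<omega>. indicat_real {\<omega>. P (\<omega> 0)} \<omega> \<partial>?N)" using s sp by simp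
    also have "\<dots> = (\<integral>\<omega>. indicat_real {x. P x} (\<omega> 0) \<partial>?N)" by (intro Bochner_Integration.integral_cong refl) (simp add: indicator_def)
    also have "\<dots> = (\<integral>x. indicat_real {x. P x} x \<partial>ladder_law)"
      by (rule ladder.integral_chain_law_0[OF \<mu> borel_measurable_indicator[OF P]])
    also have "\<dots> = (\<Sum>n. (1/2) ^ Suc n * indicat_real {x. P x} (real n))"
      by (rule sums_unique[OF integral_ladder_law[OF borel_measurable_indicator[OF P], where C=1]]) (simp add: indicator_def)
    finally show ?thesis .
  qed
  have AE_start: "AE \<omega> in ?N. \<omega> 0 \<in> range real"
  proof -
    have b: "range real \<in> sets borel" by (rule sets.countable) auto
    have "N.prob {\<omega>. \<omega> 0 \<in> range real} = (\<Sum>n. (1/2) ^ Suc n * indicat_real {x. x \<in> range real} (real n))"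
      by (rule start[of "\<lambda>x. x \<in> range real"]) (use b in simp)
    also have "\<dots> = (\<Sum>n. (1/2) ^ Suc n)" by simp
    also have "\<dots> = 1" using sums_unique[OF power_half_series] by simp
    finally have "N.prob {\<omega>. \<omega> 0 \<in> range real} = 1" .
    moreover have "{\<omega>. \<omega> 0 \<in> range real} \<in> sets ?N" using measurable_sets[OF m0 b] sp by (simp add: vimage_def)
    ultimately show ?thesis using N.prob_eq_1 by simp
  qed
  have "AE \<omega> in ?N. \<omega> \<in> {\<omega>. 13/16 * real n < (\<Sum>i<n. indicat_real blocks (\<omega> i))} \<longrightarrow> \<omega> \<in> {\<omega>. real t < \<omega> 0}"
    using AE_ladder_steps AE_start
  proof eventually_elim
    case (elim \<omega>)
    obtain m where m: "\<omega> 0 = real m" using elim(2) by auto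
    show ?case
    proof (rule impI, rule ccontr)
      assume S: "\<omega> \<in> {\<omega>. 13/16 * real n < (\<Sum>i<n. indicat_real blocks (\<omega> i))}" and "\<omega> \<notin> {\<omega>. real t < \<omega> 0}"
      then have "m \<le> t" using m by simp
      obtain h where h: "h \<le> n" "(\<Sum>i<n. indicat_real blocks (\<omega> i)) \<le> 3/4 * real (n - h) + (real (visits (m + h)) - real (visits m))"
        using path_visits[of \<omega> m n] m elim(1) by blast
      have "m + h \<le> block (Suc j)" using \<open>m \<le> t\<close> h(1) t by simp
      then have "real (visits (m + h)) \<le> real (2 * block j)" using visits_le_2_block of_nat_le_iff by blast
      moreover have "real (n - h) \<le> real n" by simp
      moreover have "real n = 32 * real (block j)" unfolding n_def by simp
      ultimately have "(\<Sum>i<n. indicat_real blocks (\<omega> i)) \<le> 13/16 * real n" using h(2) by simp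
      then show False using S by simp
    qed
  qed
  then have "N.prob {\<omega>. 13/16 * real n < (\<Sum>i<n. indicat_real blocks (\<omega> i))} \<le> N.prob {\<omega>. real t < \<omega> 0}"
  proof (rule N.finite_measure_mono_AE)
    have "{real t<..} \<in> sets borel" by simp
    from measurable_sets[OF m0 this] show "{\<omega>. real t < \<omega> 0} \<in> sets ?N" using sp by (simp add: vimage_def)
  qed
  also have "\<dots> = (\<Sum>n. (1/2) ^ Suc n * indicat_real {x. real t < x} (real n))"
    by (rule start) (simp add: greaterThan_def[symmetric])
  also have "\<dots> \<le> (1/2) ^ t"
  proof -
    let ?a = "\<lambda>n. (1/2::real) ^ Suc n * indicat_real {x. real t < x} (real n)"
    have su: "summable ?a"
      by (rule summable_comparison_test'[OF sums_summable[OF power_half_series]]) (auto simp: indicator_def)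
    have "(\<Sum>n. ?a n) = (\<Sum>n. ?a (n + t)) + (\<Sum>i<t. ?a i)" by (rule suminf_split_initial_segment[OF su])
    also have "(\<Sum>i<t. ?a i) = 0" by (intro sum.neutral) (auto simp: indicator_def)
    also have "(\<Sum>n. ?a (n + t)) \<le> (\<Sum>n. (1/2) ^ t * (1/2) ^ Suc n)"
    proof (rule suminf_le)
      show "summable (\<lambda>n. ?a (n + t))" by (rule summable_ignore_initial_segment[OF su])
      show "summable (\<lambda>n. (1/2::real) ^ t * (1/2) ^ Suc n)" by (intro summable_mult sums_summable[OF power_half_series])
      show "?a (n + t) \<le> (1/2) ^ t * (1/2) ^ Suc n" for n by (simp add: indicator_def power_add)
    qed
    also have "\<dots> = (1/2) ^ t * 1" using sums_unique[OF sums_mult[OF power_half_series]] by simp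
    finally show ?thesis by simp
  qed
  finally show ?thesis by (simp add: t_def Pi_def)
qed

lemma elog_le:
  assumes "0 \<le> p" "p \<le> exp (- (B * real n))" "0 < n"
  shows "elog p / ereal (real n) \<le> ereal (- B)"
proof (cases "p = 0")
  case True
  then show ?thesis using assms(3) by (simp add: elog_def)
next
  case False
  then have "ln p \<le> ln (exp (- (B * real n)))" using assms by (intro ln_mono) auto
  then have "ln p / real n \<le> - B" using assms(3) by (simp add: field_simps)
  then show ?thesis using False assms(3) by (simp add: elog_def)
qed

lemma elog_ge:
  assumes "exp (- (B * real n)) \<le> p" "0 < n"
  shows "ereal (- B) \<le> elog p / ereal (real n)"
proof -
  have p: "0 < p" using assms(1) by (rule less_le_trans[OF exp_gt_zero])
  then have "ln (exp (- (B * real n))) \<le> ln p" using assms by (intro ln_mono) auto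
  then have "- B \<le> ln p / real n" using assms(2) by (simp add: field_simps)
  then show ?thesis using p assms(2) by (simp add: elog_def)
qed

text \<open>The two subsequences contradict the bounds of any rate function: the first one bounds its
  infimum over a closed half-line from above, and the second one sends the lower bound over a
  larger open half-line to \<open>-\<infinity>\<close>.\<close>

theorem ladder_no_LDP:
  "\<not> satisfies_LDP (\<lambda>n. distr (chain_law borel ladder ladder_law) borel
      (\<lambda>\<omega>. partial_sum block_functional n \<omega> / real n))"
proof
  let ?N = "chain_law borel ladder ladder_law" and ?p = block_density
  let ?\<mu> = "\<lambda>n. distr ?N borel (\<lambda>\<omega>. partial_sum block_functional n \<omega> / real n)"
  note \<mu> = ladder_law_prob
  interpret N: prob_space ?N by (rule ladder.prob_space_chain_law[OF \<mu>])
  have sp: "space ?N = UNIV" using ladder.space_chain_law[OF \<mu>] by simp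
  have mS: "partial_sum block_functional n \<in> borel_measurable ?N" for n
    by (rule measurable_partial_sum_path_law[OF \<mu> block_functional_measurable])
  have meas: "measure (?\<mu> n) B = N.prob {\<omega>. partial_sum block_functional n \<omega> / real n \<in> B}" if "B \<in> sets borel" for n B
    using mS that sp by (subst measure_distr) (auto simp: vimage_def)
  have S: "partial_sum block_functional n \<omega> / real n = (\<Sum>i<n. indicat_real blocks (\<omega> i)) / real n - ?p" if "0 < n" for n \<omega>
    using that unfolding partial_sum_def block_functional_def by (simp add: sum_subtractf diff_divide_distrib)
  define C where "C = {15/16 - ?p..}"
  define U where "U = {13/16 - ?p<..}"
  have sets: "C \<in> sets borel" "U \<in> sets borel" unfolding C_def U_def by simp_all
  have int_U: "interior U = U" unfolding U_def by (rule interior_open) simp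
  have CO: "C \<subseteq> U" unfolding C_def U_def by auto
  have C_lower: "ereal (-2) \<le> elog (measure (?\<mu> (block j)) C) / ereal (real (block j))" for j
  proof (rule elog_ge[OF _ block_pos])
    let ?n = "block j"
    obtain k where k: "?n = Suc k" using block_pos[of j] gr0_implies_Suc by blast
    have "(1/2::real) ^ (Suc ?n + k) = (1/4) ^ ?n"
    proof -
      have "Suc ?n + k = 2 * ?n" using k by simp
      then show ?thesis by (simp only: power_mult) (simp add: power2_eq_square)
    qed
    moreover have "exp (- (2 * real ?n)) \<le> (1/4) ^ ?n"
    proof -
      have "exp (- (2 * real ?n)) = exp (-2) ^ ?n" by (simp add: exp_of_nat_mult[symmetric] mult.commute)
      moreover have "exp (-2::real) \<le> 1/4"
      proof -
        have "2 * 2 \<le> exp 1 * exp (1::real)" using exp_ge_add_one_self[of "1::real"] by (intro mult_mono) auto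
        then have "4 \<le> exp (2::real)" by (simp add: exp_add[symmetric])
        then show ?thesis by (simp add: exp_minus field_simps)
      qed
      ultimately show ?thesis by (simp add: power_mono)
    qed
    moreover have "N.prob {\<omega> \<in> UNIV \<rightarrow> UNIV. \<forall>i<Suc k. \<omega> i = real (?n + i)} \<le> measure (?\<mu> ?n) C"
      unfolding meas[OF sets(1)]
    proof (rule N.finite_measure_mono)
      show "{\<omega> \<in> UNIV \<rightarrow> UNIV. \<forall>i<Suc k. \<omega> i = real (?n + i)} \<subseteq> {\<omega>. partial_sum block_functional ?n \<omega> / real ?n \<in> C}"
      proof safe
        fix \<omega> :: "nat \<Rightarrow> real" assume \<omega>: "\<forall>i<Suc k. \<omega> i = real (?n + i)"
        have "indicat_real blocks (\<omega> i) = 1" if "i < ?n" for i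
        proof -
          have "real (?n + i) \<in> blocks" unfolding nat_in_blocks using that by (intro exI[of _ j]) auto
          moreover have "\<omega> i = real (?n + i)" using \<omega> that k by simp
          ultimately show ?thesis by simp
        qed
        then have "(\<Sum>i<?n. indicat_real blocks (\<omega> i)) = real ?n" by simp
        then show "partial_sum block_functional ?n \<omega> / real ?n \<in> C"
          unfolding S[OF block_pos] C_def using block_pos[of j] by simp
      qed
      show "{\<omega>. partial_sum block_functional ?n \<omega> / real ?n \<in> C} \<in> sets ?N"
        using measurable_sets[OF borel_measurable_divide[OF mS borel_measurable_const] sets(1)] sp by (simp add: vimage_def)
    qed
    ultimately show "exp (- (2 * real ?n)) \<le> measure (?\<mu> ?n) C" unfolding climb_probability by simp
  qed
  have O_upper: "elog (measure (?\<mu> (32 * block j)) U) / ereal (real (32 * block j)) \<le> ereal (-3)" if j: "220 \<le> j" for j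
  proof (rule elog_le)
    let ?n = "32 * block j"
    have n: "0 < ?n" using block_pos[of j] by simp
    have n': "0 < real ?n" using n by simp
    have e: "{\<omega>. partial_sum block_functional ?n \<omega> / real ?n \<in> U} =
        {\<omega> \<in> UNIV \<rightarrow> UNIV. 13/16 * real ?n < (\<Sum>i<?n. indicat_real blocks (\<omega> i))}"
      unfolding U_def S[OF n] greaterThan_iff diff_less_eq diff_add_cancel pos_less_divide_eq[OF n'] by (simp add: Pi_def)
    have "measure (?\<mu> ?n) U = N.prob {\<omega> \<in> UNIV \<rightarrow> UNIV. 13/16 * real ?n < (\<Sum>i<?n. indicat_real blocks (\<omega> i))}"
      unfolding e[symmetric] by (rule meas[OF sets(2)])
    also have "\<dots> \<le> (1/2) ^ ((j - 28) * block j)" using j by (intro many_visits_probability) simp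
    \<comment> \<open>\<open>192 = 220 - 28\<close>, and \<open>192 block j / 2 = 3 n\<close>\<close>
    also have "\<dots> \<le> (1/2) ^ (192 * block j)" using j by (intro power_decreasing mult_right_mono) auto
    also have "\<dots> \<le> exp (-(1/2)) ^ (192 * block j)"
      using exp_ge_add_one_self[of "-(1/2) :: real"] by (intro power_mono) auto
    also have "\<dots> = exp (- (3 * real ?n))" by (simp add: exp_of_nat_mult[symmetric])
    finally show "measure (?\<mu> ?n) U \<le> exp (- (3 * real ?n))" .
    show "0 < ?n" by (rule n)
  qed simp
  have C_inf: "\<not> (\<forall>\<^sub>F n in sequentially. elog (measure (?\<mu> n) C) / ereal (real n) < ereal (-2))"
  proof
    assume "\<forall>\<^sub>F n in sequentially. elog (measure (?\<mu> n) C) / ereal (real n) < ereal (-2)"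
    then obtain k where "\<And>n. k \<le> n \<Longrightarrow> elog (measure (?\<mu> n) C) / ereal (real n) < ereal (-2)"
      unfolding eventually_sequentially by blast
    from this[of "block k"] C_lower[of k] le_block[of k] show False by (simp add: not_less[symmetric])
  qed
  have O_inf: "\<not> (\<forall>\<^sub>F n in sequentially. ereal (-3) < elog (measure (?\<mu> n) U) / ereal (real n))"
  proof
    assume "\<forall>\<^sub>F n in sequentially. ereal (-3) < elog (measure (?\<mu> n) U) / ereal (real n)"
    then obtain k where k: "\<And>n. k \<le> n \<Longrightarrow> ereal (-3) < elog (measure (?\<mu> n) U) / ereal (real n)"
      unfolding eventually_sequentially by blast
    define j where "j = max k 220"
    have "k \<le> 32 * block j" using le_block[of j] unfolding j_def by linarith
    from k[OF this] O_upper[of j] show False unfolding j_def by (simp add: not_less[symmetric])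
  qed
  assume "satisfies_LDP ?\<mu>"
  then obtain I :: "real \<Rightarrow> ereal" where I: "\<And>B. B \<in> sets borel \<Longrightarrow>
      - (INF x\<in>interior B. I x) \<le> liminf (\<lambda>n. elog (measure (?\<mu> n) B) / ereal (real n)) \<and>
      limsup (\<lambda>n. elog (measure (?\<mu> n) B) / ereal (real n)) \<le> - (INF x\<in>closure B. I x)"
    unfolding satisfies_LDP_def by blast
  have "limsup (\<lambda>n. elog (measure (?\<mu> n) C) / ereal (real n)) \<le> - (INF x\<in>C. I x)"
    using I[OF sets(1)] by (simp add: C_def)
  moreover have "\<not> limsup (\<lambda>n. elog (measure (?\<mu> n) C) / ereal (real n)) < ereal (-2)"
    using C_inf Limsup_lessD by blast
  ultimately have "ereal (-2) \<le> - (INF x\<in>C. I x)" by (simp add: not_less)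
  also have "\<dots> \<le> - (INF x\<in>U. I x)" using CO by (simp add: INF_superset_mono)
  also have "\<dots> \<le> liminf (\<lambda>n. elog (measure (?\<mu> n) U) / ereal (real n))"
    using I[OF sets(2)] int_U by simp
  finally have "ereal (-2) \<le> liminf (\<lambda>n. elog (measure (?\<mu> n) U) / ereal (real n))" .
  then have "ereal (-3) < liminf (\<lambda>n. elog (measure (?\<mu> n) U) / ereal (real n))"
    by (rule less_le_trans[rotated]) simp
  then show False using O_inf less_LiminfD by blast
qed

theorem proposition6p2:
  shows "(\<forall>(M :: 'a measure) K \<epsilon> \<nu> \<pi> F. doeblin_functional M K \<epsilon> \<nu> \<pi> F \<longrightarrow>
      (\<forall>x\<in>space M.
        let abar = (exp 1 - 1) / (2 - \<epsilon>) * \<epsilon>;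
            \<Lambda> = log_mgf_rate M K F x
        in (\<forall>c\<in>{0<..<deriv \<Lambda> abar}.
              (\<lambda>n. elog (\<P>(\<omega> in chain_law M K \<pi>. real n * c \<le> partial_sum F n \<omega>)) / ereal (real n))
                \<longlonglongrightarrow> - restricted_conjugate abar \<Lambda> c) \<and>
           (\<forall>c'\<in>{deriv \<Lambda> (-abar)<..<0}.
              (\<lambda>n. elog (\<P>(\<omega> in chain_law M K \<pi>. partial_sum F n \<omega> \<le> real n * c')) / ereal (real n))
                \<longlonglongrightarrow> - restricted_conjugate abar \<Lambda> c')))
    \<and> (\<exists>(M :: real measure) K \<epsilon> \<nu> \<pi> F. doeblin_functional M K \<epsilon> \<nu> \<pi> F \<and>
        \<not> satisfies_LDP (\<lambda>n. distr (chain_law M K \<pi>) borel (\<lambda>\<omega>. partial_sum F n \<omega> / real n)))"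
proof (intro conjI)
  show "\<forall>(M :: 'a measure) K \<epsilon> \<nu> \<pi> F. doeblin_functional M K \<epsilon> \<nu> \<pi> F \<longrightarrow>
      (\<forall>x\<in>space M.
        let abar = (exp 1 - 1) / (2 - \<epsilon>) * \<epsilon>;
            \<Lambda> = log_mgf_rate M K F x
        in (\<forall>c\<in>{0<..<deriv \<Lambda> abar}.
              (\<lambda>n. elog (\<P>(\<omega> in chain_law M K \<pi>. real n * c \<le> partial_sum F n \<omega>)) / ereal (real n))
                \<longlonglongrightarrow> - restricted_conjugate abar \<Lambda> c) \<and>
           (\<forall>c'\<in>{deriv \<Lambda> (-abar)<..<0}.
              (\<lambda>n. elog (\<P>(\<omega> in chain_law M K \<pi>. partial_sum F n \<omega> \<le> real n * c')) / ereal (real n))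
                \<longlonglongrightarrow> - restricted_conjugate abar \<Lambda> c'))"
  proof (intro allI impI ballI)
    fix M :: "'a measure" and K \<epsilon> \<nu> \<pi> F x
    assume "doeblin_functional M K \<epsilon> \<nu> \<pi> F" and x: "x \<in> space M"
    then interpret doeblin_functional M K \<epsilon> \<nu> \<pi> F by simp
    show "let abar = (exp 1 - 1) / (2 - \<epsilon>) * \<epsilon>;
            \<Lambda> = log_mgf_rate M K F x
        in (\<forall>c\<in>{0<..<deriv \<Lambda> abar}.
              (\<lambda>n. elog (\<P>(\<omega> in chain_law M K \<pi>. real n * c \<le> partial_sum F n \<omega>)) / ereal (real n))
                \<longlonglongrightarrow> - restricted_conjugate abar \<Lambda> c) \<and>
           (\<forall>c'\<in>{deriv \<Lambda> (-abar)<..<0}.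
              (\<lambda>n. elog (\<P>(\<omega> in chain_law M K \<pi>. partial_sum F n \<omega> \<le> real n * c')) / ereal (real n))
                \<longlonglongrightarrow> - restricted_conjugate abar \<Lambda> c')"
      unfolding Let_def abar_def[symmetric]
      by (intro conjI ballI) (rule local_large_deviations[OF x], assumption)+
  qed
  show "\<exists>(M :: real measure) K \<epsilon> \<nu> \<pi> F. doeblin_functional M K \<epsilon> \<nu> \<pi> F \<and>
        \<not> satisfies_LDP (\<lambda>n. distr (chain_law M K \<pi>) borel (\<lambda>\<omega>. partial_sum F n \<omega> / real n))"
    using ladder_functional ladder_no_LDP by blast
qed

end
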